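(* Let $N\ge 1$, let $\Omega\subset\mathbb{R}^N$ be a bounded open set, and let $A\in (L^\infty(\Omega))^{N\times N}$ be a matrix-valued function for which there exists $\alpha>0$ with $A(x)\xi\cdot\xi\ge\alpha|\xi|^2$ for a.e. $x\in\Omega$ and all $\xi\in\mathbb{R}^N$. Let $F:\Omega\times[0,+\infty)\to[0,+\infty]$ be a Carathéodory function (i.e. $x\mapsto F(x,s)$ is measurable for every $s\in[0,+\infty)$, and for a.e. $x\in\Omega$ the map $s\mapsto F(x,s)\in[0,+\infty]$ is continuous on $[0,+\infty)$) such that $$0\le F(x,s)\le \frac{h(x)}{\Gamma(s)}\quad\text{for a.e. } x\in\Omega,\ \forall s>0,$$ where $h\ge 0$ a.e., $h\in L^r(\Omega)$ with $r=\frac{2N}{N+2}$ if $N\ge3$, $r>1$ if $N=2$, $r=1$ if $N=1$, and where $\Gamma:[0,+\infty)\to[0,+\infty)$ is of class $C^1([0,+\infty))$ with $\Gamma(0)=0$ and $\Gamma'(s)>0$ for all $s>0$. Let $u$ be any solution, in the sense of the definition given in the context, to the problem $u\ge 0$, $-\operatorname{div}A(x)Du=F(x,u)$ in $\Omega$, $u=0$ on $\partial\Omega$. Let $v\in\mathcal{V}(\Omega)$, $v\ge0$, with $$-\operatorname{div}\,{}^tA(x)Dv=\sum_{i\in I}\hat\varphi_i(-\operatorname{div}\hat g_i)+\hat f\quad\text{in }\mathcal{D}'(\Omega),$$ where $I$ is finite, $\hat\varphi_i\in H_0^1(\Omega)\cap L^\infty(\Omega)$, $\hat g_i\in(L^2(\Omega))^N$,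 $\hat f\in L^1(\Omega)$. Then for every $\delta>0$, $$\int_\Omega F(x,u)Z_\delta(u)v\le\frac32\left(\int_\Omega\Big|\sum_{i\in I}\hat g_i\cdot D\hat\varphi_i+\hat f\Big|\right)\delta+\sum_{i\in I}\int_\Omega Z_\delta(u)\,\hat g_i\cdot Du\;\hat\varphi_i,$$ where $Z_\delta:[0,+\infty)\to[0,+\infty)$ is defined by $Z_\delta(s)=1$ if $0\le s\le\delta$, $Z_\delta(s)=-\frac{s}{\delta}+2$ if $\delta\le s\le2\delta$, and $Z_\delta(s)=0$ if $s\ge2\delta$.
   Context: All functions are real-valued unless otherwise said; $D$ denotes the gradient, ${}^tA$ the transpose of $A$, $\mathcal{D}(\Omega)=C_c^\infty(\Omega)$, $\mathcal{D}'(\Omega)$ the distributions on $\Omega$; no regularity of $\partial\Omega$ is assumed. For $k>0$ and $s\in\mathbb{R}$: $T_k(s)=\max\{-k,\min\{s,k\}\}$, $G_k(s)=s-T_k(s)$. Test functions. For $\hat\varphi\in H_0^1(\Omega)\cap L^\infty(\Omega)$ and $\hat g\in(L^2(\Omega))^N$, the distribution $\hat\varphi(-\operatorname{div}\hat g)$ is defined by $\langle\hat\varphi(-\operatorname{div}\hat g),\phi\rangle=\int_\Omega\hat g\cdot D(\hat\varphi\phi)$ for $\phi\in\mathcal{D}(\Omega)$. The space $\mathcal{V}(\Omega)$ is the set of $v\in H_0^1(\Omega)\cap L^\infty(\Omega)$ for which there exist a finite set $I$, functions $\hat\varphi_i\in H_0^1(\Omega)\cap L^\infty(\Omega)$, $\hat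 g_i\in(L^2(\Omega))^N$ ($i\in I$) and $\hat f\in L^1(\Omega)$ such that $$-\operatorname{div}\,{}^tA(x)Dv=\sum_{i\in I}\hat\varphi_i(-\operatorname{div}\hat g_i)+\hat f\quad\text{in }\mathcal{D}'(\Omega).\qquad( * )$$ Definition of solution. A function $u$ is a solution to the problem $u\ge0$, $-\operatorname{div}A(x)Du=F(x,u)$ in $\Omega$, $u=0$ on $\partial\Omega$ if: (1) $u\in L^2(\Omega)\cap H^1_{\rm loc}(\Omega)$; $u(x)\ge0$ for a.e. $x\in\Omega$; $G_k(u)\in H_0^1(\Omega)$ for all $k>0$; and $\varphi T_k(u)\in H_0^1(\Omega)$ for all $k>0$ and all $\varphi\in H_0^1(\Omega)\cap L^\infty(\Omega)$; (2) for every $v\in\mathcal{V}(\Omega)$ with $v\ge0$, and every $I,\hat\varphi_i,\hat g_i,\hat f$ as in $( * )$, one has $\int_\Omega F(x,u)v<+\infty$ (with the usual convention $0\cdot\infty=0$ in integrands) and $$\int_\Omega{}^tA(x)Dv\cdot DG_k(u)+\sum_{i\in I}\int_\Omega\hat g_i\cdot D(\hat\varphi_iT_k(u))+\int_\Omega\hat f\,T_k(u)=\int_\Omega F(x,u)v\qquad\forall k>0.$$ (Condition (1) is known to imply $\varphi Du\in(L^2(\Omega))^N$ for every $\varphi\in H_0^1(\Omega)\cap L^\infty(\Omega)$, so the last integrals in the claim make sense.) *)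

theory Defs
  imports "HOL-Analysis.Analysis"
begin

text \<open>
  Functions on \<open>\<Omega>\<close> are represented by total functions whose values outside \<open>\<Omega>\<close> are irrelevant;
  measurability, integrals and ``almost everywhere'' refer to \<^term>\<open>lebesgue_on \<Omega>\<close>, so that
  \<open>\<integral>\<^sub>\<Omega> f\<close> is \<^term>\<open>integral\<^sup>L (lebesgue_on \<Omega>) f\<close>.
\<close>

definition Lp :: "real \<Rightarrow> (real^'n) set \<Rightarrow> (real^'n \<Rightarrow> 'b::euclidean_space) set" where
  "Lp p \<Omega> = {f. f \<in> borel_measurable (lebesgue_on \<Omega>) \<and>
                integrable (lebesgue_on \<Omega>) (\<lambda>x. norm (f x) powr p)}"

definition Linf :: "(real^'n) set \<Rightarrow> (real^'n \<Rightarrow> real) set" where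
  "Linf \<Omega> = {f. f \<in> borel_measurable (lebesgue_on \<Omega>) \<and>
                (\<exists>M. AE x in lebesgue_on \<Omega>. \<bar>f x\<bar> \<le> M)}"

definition Lp_loc :: "real \<Rightarrow> (real^'n) set \<Rightarrow> (real^'n \<Rightarrow> 'b::euclidean_space) set" where
  "Lp_loc p \<Omega> = {f. \<forall>K. compact K \<and> K \<subseteq> \<Omega> \<longrightarrow> f \<in> Lp p K}"

primrec Ck :: "nat \<Rightarrow> (real^'n \<Rightarrow> real) \<Rightarrow> bool" where
  "Ck 0 f = continuous_on UNIV f"
| "Ck (Suc k) f = ((\<forall>x. f differentiable (at x)) \<and>
     (\<forall>i. Ck k (\<lambda>x. frechet_derivative f (at x) (axis i 1))))"

text \<open>
  \<open>C\<^sub>c\<^sup>\<infinity>(\<Omega>)\<close>: a test function is identified with its extension by zero to the whole space.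
\<close>

definition test_fun :: "(real^'n) set \<Rightarrow> (real^'n \<Rightarrow> real) set" where
  "test_fun \<Omega> = {\<phi>. (\<forall>k. Ck k \<phi>) \<and> compact (closure {x. \<phi> x \<noteq> 0}) \<and>
                    closure {x. \<phi> x \<noteq> 0} \<subseteq> \<Omega>}"

definition grad :: "(real^'n \<Rightarrow> real) \<Rightarrow> real^'n \<Rightarrow> real^'n" where
  "grad \<phi> x = (\<chi> i. frechet_derivative \<phi> (at x) (axis i 1))"

definition weak_gradient :: "(real^'n) set \<Rightarrow> (real^'n \<Rightarrow> real) \<Rightarrow> (real^'n \<Rightarrow> real^'n) \<Rightarrow> bool" where
  "weak_gradient \<Omega> u G \<longleftrightarrow> u \<in> Lp_loc 1 \<Omega> \<and> G \<in> Lp_loc 1 \<Omega> \<and>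
     (\<forall>\<phi>\<in>test_fun \<Omega>. (\<integral>x. u x *\<^sub>R grad \<phi> x \<partial>lebesgue_on \<Omega>) = - (\<integral>x. \<phi> x *\<^sub>R G x \<partial>lebesgue_on \<Omega>))"

text \<open>
  On an open set weak gradients are unique up to a null set; \<open>wgrad \<Omega> u\<close> is a
  representative of \<open>Du\<close> (meaningful only if \<open>u\<close> has a weak gradient).
\<close>

definition wgrad :: "(real^'n) set \<Rightarrow> (real^'n \<Rightarrow> real) \<Rightarrow> real^'n \<Rightarrow> real^'n" where
  "wgrad \<Omega> u = (SOME G. weak_gradient \<Omega> u G)"

definition H1 :: "(real^'n) set \<Rightarrow> (real^'n \<Rightarrow> real) set" where
  "H1 \<Omega> = {u. u \<in> Lp 2 \<Omega> \<and> (\<exists>G. weak_gradient \<Omega> u G \<and> G \<in> Lp 2 \<Omega>)}"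

definition H1_loc :: "(real^'n) set \<Rightarrow> (real^'n \<Rightarrow> real) set" where
  "H1_loc \<Omega> = {u. u \<in> Lp_loc 2 \<Omega> \<and> (\<exists>G. weak_gradient \<Omega> u G \<and> G \<in> Lp_loc 2 \<Omega>)}"

text \<open>\<open>H\<^sub>0\<^sup>1(\<Omega>)\<close>: the closure of the test functions in the \<open>H\<^sup>1\<close> norm.\<close>

definition H10 :: "(real^'n) set \<Rightarrow> (real^'n \<Rightarrow> real) set" where
  "H10 \<Omega> = {u. u \<in> H1 \<Omega> \<and> (\<exists>\<phi>. (\<forall>n::nat. \<phi> n \<in> test_fun \<Omega>) \<and>
     (\<lambda>n. (\<integral>x. (\<phi> n x - u x)\<^sup>2 \<partial>lebesgue_on \<Omega>)
          + (\<integral>x. (norm (grad (\<phi> n) x - wgrad \<Omega> u x))\<^sup>2 \<partial>lebesgue_on \<Omega>)) \<longlonglongrightarrow> 0)}"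

definition Tk :: "real \<Rightarrow> real \<Rightarrow> real" where
  "Tk k s = max (- k) (min s k)"

definition Gk :: "real \<Rightarrow> real \<Rightarrow> real" where
  "Gk k s = s - Tk k s"

definition Zd :: "real \<Rightarrow> real \<Rightarrow> real" where
  "Zd \<delta> s = (if s \<le> \<delta> then 1 else if s \<le> 2 * \<delta> then - s / \<delta> + 2 else 0)"

text \<open>
  Distributions are given by their action on test functions: \<open>neg_div \<Omega> G\<close> is \<open>-div G\<close>, and
  \<open>mult_neg_div \<Omega> \<phi>h gh\<close> is \<open>\<phi>h (-div gh)\<close>.
\<close>

definition neg_div :: "(real^'n) set \<Rightarrow> (real^'n \<Rightarrow> real^'n) \<Rightarrow> (real^'n \<Rightarrow> real) \<Rightarrow> real" where
  "neg_div \<Omega> G \<phi> = (\<integral>x. G x \<bullet> grad \<phi> x \<partial>lebesgue_on \<Omega>)"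

definition mult_neg_div ::
  "(real^'n) set \<Rightarrow> (real^'n \<Rightarrow> real) \<Rightarrow> (real^'n \<Rightarrow> real^'n) \<Rightarrow> (real^'n \<Rightarrow> real) \<Rightarrow> real" where
  "mult_neg_div \<Omega> \<phi>h gh \<phi> = (\<integral>x. gh x \<bullet> wgrad \<Omega> (\<lambda>y. \<phi>h y * \<phi> y) x \<partial>lebesgue_on \<Omega>)"

text \<open>
  \<open>V_rep \<Omega> A v I \<phi>h gh fh\<close>: the data represent \<open>-div (\<^sup>tA Dv)\<close> as
  \<open>\<Sum>i\<in>I. \<phi>h i (-div (gh i)) + fh\<close> in the sense of distributions. Finite index sets are taken to be
  sets of natural numbers, which is no restriction up to relabelling.
\<close>

definition V_rep ::
  "(real^'n) set \<Rightarrow> (real^'n \<Rightarrow> real^'n^'n) \<Rightarrow> (real^'n \<Rightarrow> real) \<Rightarrow> nat set \<Rightarrow>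
   (nat \<Rightarrow> real^'n \<Rightarrow> real) \<Rightarrow> (nat \<Rightarrow> real^'n \<Rightarrow> real^'n) \<Rightarrow> (real^'n \<Rightarrow> real) \<Rightarrow> bool" where
  "V_rep \<Omega> A v I \<phi>h gh fh \<longleftrightarrow>
     finite I \<and> (\<forall>i\<in>I. \<phi>h i \<in> H10 \<Omega> \<inter> Linf \<Omega>) \<and> (\<forall>i\<in>I. gh i \<in> Lp 2 \<Omega>) \<and> fh \<in> Lp 1 \<Omega> \<and>
     (\<forall>\<phi>\<in>test_fun \<Omega>. neg_div \<Omega> (\<lambda>x. transpose (A x) *v wgrad \<Omega> v x) \<phi>
        = (\<Sum>i\<in>I. mult_neg_div \<Omega> (\<phi>h i) (gh i) \<phi>) + (\<integral>x. fh x * \<phi> x \<partial>lebesgue_on \<Omega>))"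

definition V_space :: "(real^'n) set \<Rightarrow> (real^'n \<Rightarrow> real^'n^'n) \<Rightarrow> (real^'n \<Rightarrow> real) set" where
  "V_space \<Omega> A = {v. v \<in> H10 \<Omega> \<inter> Linf \<Omega> \<and> (\<exists>I \<phi>h gh fh. V_rep \<Omega> A v I \<phi>h gh fh)}"

text \<open>
  In \<^typ>\<open>ennreal\<close> one has \<open>0 * \<infinity> = 0\<close>, as required for the integrand \<open>F(x,u) v\<close>.
\<close>

definition is_solution ::
  "(real^'n) set \<Rightarrow> (real^'n \<Rightarrow> real^'n^'n) \<Rightarrow> (real^'n \<Rightarrow> real \<Rightarrow> ennreal) \<Rightarrow> (real^'n \<Rightarrow> real) \<Rightarrow> bool" where
  "is_solution \<Omega> A F u \<longleftrightarrow>
     u \<in> Lp 2 \<Omega> \<inter> H1_loc \<Omega> \<and> (AE x in lebesgue_on \<Omega>. u x \<ge> 0) \<and>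
     (\<forall>k>0. (\<lambda>x. Gk k (u x)) \<in> H10 \<Omega>) \<and>
     (\<forall>k>0. \<forall>\<phi>\<in>H10 \<Omega> \<inter> Linf \<Omega>. (\<lambda>x. \<phi> x * Tk k (u x)) \<in> H10 \<Omega>) \<and>
     (\<forall>v I \<phi>h gh fh.
        v \<in> V_space \<Omega> A \<and> (AE x in lebesgue_on \<Omega>. v x \<ge> 0) \<and> V_rep \<Omega> A v I \<phi>h gh fh \<longrightarrow>
        (\<integral>\<^sup>+x. F x (u x) * ennreal (v x) \<partial>lebesgue_on \<Omega>) < \<infinity> \<and>
        (\<forall>k>0.
           (\<integral>x. (transpose (A x) *v wgrad \<Omega> v x) \<bullet> wgrad \<Omega> (\<lambda>y. Gk k (u y)) x \<partial>lebesgue_on \<Omega>)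
           + (\<Sum>i\<in>I. \<integral>x. gh i x \<bullet> wgrad \<Omega> (\<lambda>y. \<phi>h i y * Tk k (u y)) x \<partial>lebesgue_on \<Omega>)
           + (\<integral>x. fh x * Tk k (u x) \<partial>lebesgue_on \<Omega>)
           = enn2real (\<integral>\<^sup>+x. F x (u x) * ennreal (v x) \<partial>lebesgue_on \<Omega>)))"

definition Caratheodory_fun :: "(real^'n) set \<Rightarrow> (real^'n \<Rightarrow> real \<Rightarrow> ennreal) \<Rightarrow> bool" where
  "Caratheodory_fun \<Omega> F \<longleftrightarrow>
     (\<forall>s\<ge>0. (\<lambda>x. F x s) \<in> borel_measurable (lebesgue_on \<Omega>)) \<and>
     (AE x in lebesgue_on \<Omega>. continuous_on {0..} (F x))"

end

theory Submission
  imports Defs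
begin

text \<open>
The inequality is what remains of the equation for \<open>u\<close> after testing it with \<open>Z\<^sub>\<delta>(u) v\<close>.
Formally,
\<open>\<integral> F(x,u) Z\<^sub>\<delta>(u) v = \<integral> Z\<^sub>\<delta>(u) A Du \<bullet> Dv + \<integral> Z\<^sub>\<delta>'(u) v A Du \<bullet> Du\<close>,
where the last integral is nonpositive because \<open>Z\<^sub>\<delta>\<close> decreases and \<open>A\<close> is coercive. With \<open>Y\<close> the
primitive of \<open>Z\<^sub>\<delta>\<close> vanishing at 0, the first one is the integral of \<open>\<^sup>tA Dv \<bullet> D(Y(u))\<close>, and the
representation of \<open>-div \<^sup>tA Dv\<close> turns it into
\<open>\<integral> (\<Sum> g\<^sub>i \<bullet> D\<phi>\<^sub>i + f) Y(u) + \<Sum> \<integral> Z\<^sub>\<delta>(u) \<phi>\<^sub>i g\<^sub>i \<bullet> Du\<close>.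
Since \<open>0 \<le> Y \<le> 3\<delta>/2\<close>, this gives the claim. Two steps need a justification.

First, \<open>Z\<^sub>\<delta>(u) v\<close> has to be an admissible test function. With \<open>w = (T\<^bsub>2\<delta>\<^esub>(u) - T\<^sub>\<delta>(u)) / \<delta>\<close>, which lies
in \<open>H\<^sub>0\<^sup>1 \<inter> L\<^sup>\<infinity>\<close>, one has \<open>Z\<^sub>\<delta>(u) v = v - v w\<close>. The product rule writes \<open>-div \<^sup>tA D(v w)\<close> as
\<open>w (-div \<^sup>tA Dv) + v (-div \<^sup>tA Dw)\<close> minus an integrable function, which is exactly the form that the
space of test functions asks for; this is \<open>V_rep_z\<close>. Evaluated on truncations of \<open>u\<close>, the added
integrable function cancels the terms that \<open>Dw\<close> and \<open>Dv\<close> contribute through the new coefficients.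

Second, the representation of \<open>-div \<^sup>tA Dv\<close> has to be tested with \<open>Y(u)\<close>, whereas it is given on
smooth functions, and the definition of solution only provides it on truncations. Subtracting the
equation for \<open>v\<close> at two levels gives an identity for the slice \<open>{k < u \<le> m}\<close> (\<open>level_identity\<close>);
cutting \<open>{\<delta> < u \<le> 2\<delta>}\<close> into thin slices and freezing the weight \<open>w\<close> on each yields the weighted
identity that is needed (\<open>weighted_identity\<close>). The error of a slice is its thickness times the
increment of a monotone function of the level, so the errors add up to something arbitrarily small.

All this requires the gradients of \<open>G\<^sub>k(u)\<close> and of \<open>\<phi> T\<^sub>k(u)\<close> in terms of \<open>Du\<close>. Elements of \<open>H\<^sub>0\<^sup>1\<close> are
limits of test functions together with their gradients, hence the product rule and the chain rule
for the positive part follow from integration by parts for \<open>C\<^sup>1\<close> functions. The solution itself is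
only locally in \<open>H\<^sup>1\<close>, but \<open>\<eta> u\<close> is in \<open>H\<^sub>0\<^sup>1\<close> for a test function \<open>\<eta>\<close>, and for \<open>\<eta> \<ge> 0\<close> the function
\<open>\<eta> G\<^sub>k(u)\<close> is the positive part of \<open>\<eta> u - k \<eta>\<close>; uniqueness of weak gradients then gives
\<open>D G\<^sub>k(u) = Du\<close> where \<open>u > k\<close> and \<open>0\<close> elsewhere (\<open>wgrad_Gk\<close>).
\<close>


section \<open>Smooth functions\<close>

lemma partial_derivative_eqI:
  fixes f :: "real^'n \<Rightarrow> real"
  assumes "(f has_derivative f') (at x)"
  shows "frechet_derivative f (at x) (axis i 1) = f' (axis i 1)"
  using frechet_derivative_at[OF assms] by simp

lemma Ck_SucD:
  fixes f :: "real^'n \<Rightarrow> real"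
  shows "Ck (Suc k) f \<Longrightarrow> Ck k f"
proof (induction k arbitrary: f)
  case 0
  then show ?case
    by (auto intro!: continuous_at_imp_continuous_on differentiable_imp_continuous_within)
next
  case (Suc k)
  then show ?case by (metis Ck.simps(2))
qed

lemma Ck_const: "Ck k (\<lambda>x::real^'n. c)"
  by (induction k arbitrary: c) auto

lemma Ck_add:
  fixes f g :: "real^'n \<Rightarrow> real"
  shows "Ck k f \<Longrightarrow> Ck k g \<Longrightarrow> Ck k (\<lambda>x. f x + g x)"
proof (induction k arbitrary: f g)
  case 0
  then show ?case by (auto intro: continuous_on_add)
next
  case (Suc k)
  have "frechet_derivative (\<lambda>x. f x + g x) (at x) (axis i 1)
      = frechet_derivative f (at x) (axis i 1) + frechet_derivative g (at x) (axis i 1)" for x i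
    using Suc.prems
    by (intro partial_derivative_eqI has_derivative_add) (auto simp: frechet_derivative_works[THEN iffD1])
  then show ?case using Suc by auto
qed

lemma Ck_mult:
  fixes f g :: "real^'n \<Rightarrow> real"
  shows "Ck k f \<Longrightarrow> Ck k g \<Longrightarrow> Ck k (\<lambda>x. f x * g x)"
proof (induction k arbitrary: f g)
  case 0
  then show ?case by (auto intro: continuous_on_mult)
next
  case (Suc k)
  have "frechet_derivative (\<lambda>x. f x * g x) (at x) (axis i 1)
      = f x * frechet_derivative g (at x) (axis i 1) + frechet_derivative f (at x) (axis i 1) * g x" for x i
    using Suc.prems
    by (intro partial_derivative_eqI has_derivative_mult) (auto simp: frechet_derivative_works[THEN iffD1])
  then show ?case
    using Suc Ck_SucD[OF Suc.prems(1)] Ck_SucD[OF Suc.prems(2)] by (auto intro!: Ck_add)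
qed

lemma Ck_prod:
  fixes f :: "'a \<Rightarrow> real^'n \<Rightarrow> real"
  shows "(\<And>i. i \<in> I \<Longrightarrow> Ck k (f i)) \<Longrightarrow> Ck k (\<lambda>x. \<Prod>i\<in>I. f i x)"
  by (induction I rule: infinite_finite_induct) (auto intro: Ck_const Ck_mult)

text \<open>
The exponent \<open>m\<close> is a parameter because the derivative of \<open>flat m\<close> is a linear combination of
\<open>flat (m + 1)\<close> and \<open>flat (m + 2)\<close>: smoothness of the whole family then follows by one induction.
\<close>

definition flat :: "nat \<Rightarrow> real \<Rightarrow> real" where
  "flat m t = (if t > 0 then inverse t ^ m * exp (- inverse t) else 0)"

lemma flat_tendsto_0: "(flat m \<longlongrightarrow> 0) (at 0)"
proof -
  have "((\<lambda>t::real. inverse t ^ m / exp (inverse t)) \<longlongrightarrow> 0) (at_right 0)"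
    by (rule filterlim_compose[OF tendsto_power_div_exp_0 filterlim_inverse_at_top_right])
  moreover have "\<forall>\<^sub>F t in at_right 0. flat m t = inverse t ^ m / exp (inverse t)"
    by (auto simp: flat_def exp_minus divide_inverse eventually_at_right_less)
       (auto simp: eventually_at_right_less eventually_at_filter)
  ultimately have "(flat m \<longlongrightarrow> 0) (at_right 0)"
    by (simp add: tendsto_cong)
  moreover have "(flat m \<longlongrightarrow> 0) (at_left 0)"
    by (rule tendsto_eventually) (auto simp: flat_def eventually_at_filter)
  ultimately show ?thesis
    using filterlim_split_at by blast
qed

lemma flat_has_derivative:
  "(flat m has_real_derivative (flat (m + 2) t - real m * flat (m + 1) t)) (at t)"
proof -
  consider "t > 0" | "t = 0" | "t < 0" by linarith
  then show ?thesis
  proof cases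
    case 1
    have pow: "real m * inverse t ^ (m - 1) * (inverse t * inverse t) = real m * inverse t ^ (m + 1)"
      by (cases m) (simp_all add: mult_ac)
    have "((\<lambda>t. inverse t ^ m * exp (- inverse t)) has_real_derivative
             (flat (m + 2) t - real m * flat (m + 1) t)) (at t)"
      using 1 pow by (auto intro!: derivative_eq_intros simp: flat_def power2_eq_square algebra_simps)
    then show ?thesis
      by (rule has_field_derivative_transform_within_open[where S="{0<..}"])
         (use 1 in \<open>auto simp: flat_def\<close>)
  next
    case 2
    have "((\<lambda>y. (flat m y - flat m 0) / (y - 0)) \<longlongrightarrow> 0) (at 0)"
      by (rule Lim_transform_eventually[OF flat_tendsto_0[of "m+1"]])
         (auto simp: flat_def eventually_at_filter field_simps)
    then show ?thesis
      using 2 by (simp add: has_field_derivative_iff flat_def)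
  next
    case 3
    have "((\<lambda>t. 0) has_real_derivative (flat (m + 2) t - real m * flat (m + 1) t)) (at t)"
      using 3 by (auto simp: flat_def)
    then show ?thesis
      by (rule has_field_derivative_transform_within_open[where S="{..<0}"])
         (use 3 in \<open>auto simp: flat_def\<close>)
  qed
qed

text \<open>
Only affine functions of one coordinate are composed with \<open>flat\<close>, so that the inner derivative is
constant and the induction on the order stays within the family.
\<close>

lemma Ck_flat_affine: "Ck k (\<lambda>x::real^'n. flat m (c * x $ i + d))"
proof (induction k arbitrary: m)
  case 0
  have "continuous_on UNIV (flat m)"
    using flat_has_derivative DERIV_isCont by (blast intro: continuous_at_imp_continuous_on)
  then show ?case
    by (auto intro!: continuous_intros elim!: continuous_on_compose2)
next
  case (Suc k)
  define D where "D = (\<lambda>x::real^'n. \<lambda>h::real^'n.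
     (flat (m + 2) (c * x $ i + d) - real m * flat (m + 1) (c * x $ i + d)) * (c * h $ i))"
  have D: "((\<lambda>x::real^'n. flat m (c * x $ i + d)) has_derivative D x) (at x)" for x
  proof -
    have "((\<lambda>x::real^'n. c * x $ i + d) has_derivative (\<lambda>h. c * h $ i)) (at x)"
      by (auto intro!: derivative_eq_intros bounded_linear_imp_has_derivative bounded_linear_vec_nth)
    from has_derivative_compose[OF this, of "flat m"
          "(*) (flat (m + 2) (c * x $ i + d) - real m * flat (m + 1) (c * x $ i + d))"]
    show ?thesis
      using flat_has_derivative[of m "c * x $ i + d"]
      by (auto simp: has_field_derivative_def D_def o_def)
  qed
  have "Ck k (\<lambda>x. D x (axis j 1))" for j
  proof -
    have eq: "D x (axis j 1) = (flat (m + 2) (c * x $ i + d) + (- real m) * flat (m + 1) (c * x $ i + d))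
        * (c * axis j 1 $ i)" for x
      by (simp add: D_def)
    show ?thesis
      unfolding eq by (intro Ck_mult Ck_add Ck_const Suc)
  qed
  then show ?case
    using D by (auto simp: partial_derivative_eqI[OF D] differentiable_def)
qed

section \<open>Test functions\<close>

lemma grad_eqI:
  assumes "(f has_derivative f') (at x)"
  shows "grad f x = (\<chi> i. f' (axis i 1))"
  unfolding grad_def using partial_derivative_eqI[OF assms] by simp

lemma test_fun_differentiable:
  assumes "\<phi> \<in> test_fun \<Omega>"
  shows "\<phi> differentiable (at x)"
proof -
  have "Ck 1 \<phi>" using assms by (auto simp: test_fun_def)
  then show ?thesis by simp
qed

lemma has_derivative_grad:
  fixes f :: "real^'n \<Rightarrow> real"
  assumes "f differentiable (at x)"
  shows "(f has_derivative (\<lambda>h. grad f x \<bullet> h)) (at x)"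
proof -
  have d: "(f has_derivative frechet_derivative f (at x)) (at x)"
    using assms by (simp add: frechet_derivative_works)
  interpret bounded_linear "frechet_derivative f (at x)"
    using d by (rule has_derivative_bounded_linear)
  have "frechet_derivative f (at x) h = grad f x \<bullet> h" for h
  proof -
    have "frechet_derivative f (at x) h = frechet_derivative f (at x) (\<Sum>i\<in>UNIV. h $ i *\<^sub>R axis i 1)"
      using basis_expansion[of h] by (simp only: scalar_mult_eq_scaleR)
    also have "\<dots> = grad f x \<bullet> h"
      by (simp add: sum scaleR grad_def inner_vec_def mult.commute)
    finally show ?thesis .
  qed
  then have "frechet_derivative f (at x) = (\<lambda>h. grad f x \<bullet> h)" by blast
  then show ?thesis using d by simp
qed

lemma grad_eq_gradI:
  assumes "(f has_derivative (\<lambda>h. G \<bullet> h)) (at x)"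
  shows "grad f x = G"
  unfolding grad_eqI[OF assms] by (simp add: inner_axis vec_eq_iff)

lemma continuous_on_grad_test_fun:
  assumes "\<phi> \<in> test_fun \<Omega>"
  shows "continuous_on UNIV (grad \<phi>)"
proof -
  have "Ck 2 \<phi>" using assms by (auto simp: test_fun_def)
  then have "Ck 1 (\<lambda>x. frechet_derivative \<phi> (at x) (axis i 1))" for i
    by (simp add: numeral_2_eq_2)
  then have "Ck 0 (\<lambda>x. frechet_derivative \<phi> (at x) (axis i 1))" for i
    by (metis Ck_SucD One_nat_def)
  then show ?thesis
    unfolding grad_def by (auto intro!: continuous_on_vec_lambda)
qed

lemma continuous_on_test_fun:
  assumes "\<phi> \<in> test_fun \<Omega>"
  shows "continuous_on UNIV \<phi>"
proof -
  have "Ck 0 \<phi>" using assms by (auto simp: test_fun_def)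
  then show ?thesis by simp
qed

lemma test_fun_support:
  assumes "\<phi> \<in> test_fun \<Omega>"
  obtains K where "compact K" "K \<subseteq> \<Omega>" "\<And>x. x \<notin> K \<Longrightarrow> \<phi> x = 0" "\<And>x. x \<notin> K \<Longrightarrow> grad \<phi> x = 0"
proof -
  define K where "K = closure {x. \<phi> x \<noteq> 0}"
  have K: "compact K" "K \<subseteq> \<Omega>" using assms by (auto simp: test_fun_def K_def)
  have 0: "\<phi> x = 0" if "x \<notin> K" for x
    using that closure_subset[of "{x. \<phi> x \<noteq> 0}"] unfolding K_def by blast
  have "grad \<phi> x = 0" if "x \<notin> K" for x
  proof (rule grad_eq_gradI)
    have "open (- K)" using K(1) by (simp add: compact_imp_closed open_Compl)
    then have "(\<phi> has_derivative (\<lambda>h. 0)) (at x)"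
      by (rule has_derivative_transform_within_open[OF has_derivative_const[of 0], of "- K" x \<phi>])
         (simp_all add: that 0)
    then show "(\<phi> has_derivative (\<lambda>h. 0 \<bullet> h)) (at x)" by simp
  qed
  with K 0 that show ?thesis by metis
qed

lemma bounded_range_of_compact_support:
  fixes f :: "'a::metric_space \<Rightarrow> 'b::real_normed_vector"
  assumes "continuous_on UNIV f" "compact K" "\<And>x. x \<notin> K \<Longrightarrow> f x = 0"
  obtains C where "C > 0" "\<And>x. norm (f x) \<le> C"
proof -
  have "bounded (f ` K)"
    using assms by (meson compact_continuous_image compact_imp_bounded continuous_on_subset subset_UNIV)
  then obtain C where C: "C > 0" "\<And>y. y \<in> f ` K \<Longrightarrow> norm y \<le> C"
    by (meson bounded_pos)
  have "norm (f x) \<le> C" for x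
    using C assms(3)[of x] by (cases "x \<in> K") auto
  then show ?thesis using that C by blast
qed

lemma test_fun_bounded:
  assumes "\<phi> \<in> test_fun \<Omega>"
  obtains C where "C > 0" "\<And>x. \<bar>\<phi> x\<bar> \<le> C" "\<And>x. norm (grad \<phi> x) \<le> C"
proof -
  obtain K where K: "compact K" "\<And>x. x \<notin> K \<Longrightarrow> \<phi> x = 0" "\<And>x. x \<notin> K \<Longrightarrow> grad \<phi> x = 0"
    using test_fun_support[OF assms] by metis
  obtain C where C: "C > 0" "\<And>x. norm (\<phi> x) \<le> C"
    using bounded_range_of_compact_support[OF continuous_on_test_fun[OF assms]] K by metis
  obtain C' where C': "C' > 0" "\<And>x. norm (grad \<phi> x) \<le> C'"
    using bounded_range_of_compact_support[OF continuous_on_grad_test_fun[OF assms]] K by metis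
  show ?thesis
    using that[of "max C C'"] C C' by (simp add: le_max_iff_disj)
qed

lemma compact_closure_subset:
  fixes S :: "'a::metric_space set"
  assumes "closure S \<subseteq> K" "compact K"
  shows "compact (closure S)"
  using compact_Int_closed[OF assms(2) closed_closure, of S] assms(1) by (simp only: inf.absorb2)

lemma test_fun_add:
  assumes "\<phi> \<in> test_fun \<Omega>" "\<psi> \<in> test_fun \<Omega>"
  shows "(\<lambda>x. \<phi> x + \<psi> x) \<in> test_fun \<Omega>"
proof -
  have "closure {x. \<phi> x + \<psi> x \<noteq> 0} \<subseteq> closure ({x. \<phi> x \<noteq> 0} \<union> {x. \<psi> x \<noteq> 0})"
  proof (intro closure_mono subsetI)
    fix x assume "x \<in> {x. \<phi> x + \<psi> x \<noteq> 0}"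
    then have "\<phi> x + \<psi> x \<noteq> 0" by (rule CollectD)
    then have "\<phi> x \<noteq> 0 \<or> \<psi> x \<noteq> 0" by linarith
    then show "x \<in> {x. \<phi> x \<noteq> 0} \<union> {x. \<psi> x \<noteq> 0}" by simp
  qed
  also have "\<dots> = closure {x. \<phi> x \<noteq> 0} \<union> closure {x. \<psi> x \<noteq> 0}" by simp
  finally have *: "closure {x. \<phi> x + \<psi> x \<noteq> 0} \<subseteq> closure {x. \<phi> x \<noteq> 0} \<union> closure {x. \<psi> x \<noteq> 0}" .
  moreover have "compact (closure {x. \<phi> x \<noteq> 0} \<union> closure {x. \<psi> x \<noteq> 0})"
    using assms by (auto simp: test_fun_def)
  ultimately have "compact (closure {x. \<phi> x + \<psi> x \<noteq> 0})"
    by (rule compact_closure_subset)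
  then show ?thesis using assms * by (auto simp: test_fun_def intro: Ck_add)
qed

lemma test_fun_mult_Ck:
  assumes "\<phi> \<in> test_fun \<Omega>" "\<And>k. Ck k \<psi>"
  shows "(\<lambda>x. \<phi> x * \<psi> x) \<in> test_fun \<Omega>"
proof -
  have *: "closure {x. \<phi> x * \<psi> x \<noteq> 0} \<subseteq> closure {x. \<phi> x \<noteq> 0}"
    by (intro closure_mono) auto
  moreover have "compact (closure {x. \<phi> x \<noteq> 0})"
    using assms by (auto simp: test_fun_def)
  ultimately have "compact (closure {x. \<phi> x * \<psi> x \<noteq> 0})"
    by (rule compact_closure_subset)
  then show ?thesis using assms * by (auto simp: test_fun_def intro: Ck_mult)
qed

lemma test_fun_mult: "\<phi> \<in> test_fun \<Omega> \<Longrightarrow> \<psi> \<in> test_fun \<Omega> \<Longrightarrow> (\<lambda>x. \<phi> x * \<psi> x) \<in> test_fun \<Omega>"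
  by (rule test_fun_mult_Ck) (auto simp: test_fun_def)

lemma test_fun_scale: "\<phi> \<in> test_fun \<Omega> \<Longrightarrow> (\<lambda>x. c * \<phi> x) \<in> test_fun \<Omega>"
  using test_fun_mult_Ck[of \<phi> \<Omega> "\<lambda>x. c"] by (simp add: Ck_const mult.commute)

lemma grad_mult_differentiable:
  fixes \<phi> \<psi> :: "real^'n \<Rightarrow> real"
  assumes "\<phi> differentiable (at x)" "\<psi> differentiable (at x)"
  shows "grad (\<lambda>x. \<phi> x * \<psi> x) x = \<phi> x *\<^sub>R grad \<psi> x + \<psi> x *\<^sub>R grad \<phi> x"
proof (rule grad_eq_gradI)
  have "((\<lambda>x. \<phi> x * \<psi> x) has_derivative (\<lambda>h. \<phi> x * (grad \<psi> x \<bullet> h) + grad \<phi> x \<bullet> h * \<psi> x)) (at x)"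
    by (intro has_derivative_mult has_derivative_grad assms)
  then show "((\<lambda>x. \<phi> x * \<psi> x) has_derivative (\<lambda>h. (\<phi> x *\<^sub>R grad \<psi> x + \<psi> x *\<^sub>R grad \<phi> x) \<bullet> h)) (at x)"
    by (simp only: inner_add_left inner_scaleR_left mult.commute[of "_ \<bullet> _"])
qed

lemma grad_add:
  assumes "\<phi> \<in> test_fun \<Omega>" "\<psi> \<in> test_fun \<Omega>"
  shows "grad (\<lambda>x. \<phi> x + \<psi> x) x = grad \<phi> x + grad \<psi> x"
proof (rule grad_eq_gradI)
  have "((\<lambda>x. \<phi> x + \<psi> x) has_derivative (\<lambda>h. grad \<phi> x \<bullet> h + grad \<psi> x \<bullet> h)) (at x)"
    by (intro has_derivative_add has_derivative_grad test_fun_differentiable[OF assms(1)]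
        test_fun_differentiable[OF assms(2)])
  then show "((\<lambda>x. \<phi> x + \<psi> x) has_derivative (\<lambda>h. (grad \<phi> x + grad \<psi> x) \<bullet> h)) (at x)"
    by (simp only: inner_add_left)
qed

lemma grad_mult:
  assumes "\<phi> \<in> test_fun \<Omega>" "\<psi> \<in> test_fun \<Omega>"
  shows "grad (\<lambda>x. \<phi> x * \<psi> x) x = \<phi> x *\<^sub>R grad \<psi> x + \<psi> x *\<^sub>R grad \<phi> x"
  by (intro grad_mult_differentiable test_fun_differentiable[OF assms(1)] test_fun_differentiable[OF assms(2)])

lemma grad_scale:
  assumes "\<phi> \<in> test_fun \<Omega>"
  shows "grad (\<lambda>x. c * \<phi> x) x = c *\<^sub>R grad \<phi> x"
proof -
  have "grad (\<lambda>x. c) x = 0"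
    by (rule grad_eq_gradI) simp
  then show ?thesis
    using grad_mult_differentiable[of "\<lambda>x. c" x \<phi>] test_fun_differentiable[OF assms] by simp
qed

text \<open>
For \<open>n > 0\<close> a smooth function that is positive exactly on \<open>box a b\<close>; the factor \<open>n\<close> makes it steeper, and it tends to
the indicator of the box as \<open>n \<rightarrow> \<infinity>\<close>.
\<close>

definition bump :: "real \<Rightarrow> real^'n \<Rightarrow> real^'n \<Rightarrow> real^'n \<Rightarrow> real" where
  "bump n a b x = (\<Prod>i\<in>UNIV. flat 0 (n * x $ i + (- n * a $ i)) * flat 0 ((- n) * x $ i + n * b $ i))"

lemma flat_0_pos: "t > 0 \<Longrightarrow> flat 0 t > 0" and flat_0_nonneg: "flat 0 t \<ge> 0"
  and flat_0_le_1: "flat 0 t \<le> 1" and flat_0_nonpos: "t \<le> 0 \<Longrightarrow> flat 0 t = 0"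
  by (auto simp: flat_def)

lemma bump_bounds: "0 \<le> bump n a b x" "bump n a b x \<le> 1"
  unfolding bump_def
  by (intro prod_nonneg prod_le_1 conjI mult_le_one mult_nonneg_nonneg flat_0_nonneg flat_0_le_1)+

lemma bump_outside:
  assumes "n > 0" "x \<notin> box a b"
  shows "bump n a b x = 0"
proof -
  obtain i where "x $ i \<le> a $ i \<or> b $ i \<le> x $ i"
    using assms(2) by (auto simp: mem_box_cart not_less)
  then have "flat 0 (n * x $ i + (- n * a $ i)) = 0 \<or> flat 0 ((- n) * x $ i + n * b $ i) = 0"
    using assms(1) by (auto intro: flat_0_nonpos)
  then show ?thesis unfolding bump_def by (auto intro!: bexI[of _ i])
qed

lemma bump_pos:
  assumes "n > 0" "x \<in> box a b"
  shows "bump n a b x > 0"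
  unfolding bump_def using assms
  by (intro prod_pos ballI mult_pos_pos flat_0_pos) (auto simp: mem_box_cart)

lemma bump_test_fun:
  assumes "n > 0" "cbox a b \<subseteq> \<Omega>"
  shows "bump n a b \<in> test_fun \<Omega>"
proof -
  have "{x. bump n a b x \<noteq> 0} \<subseteq> cbox a b"
    using bump_outside[OF assms(1)] box_subset_cbox by blast
  then have *: "closure {x. bump n a b x \<noteq> 0} \<subseteq> cbox a b"
    by (rule closure_minimal[OF _ closed_cbox])
  then have "compact (closure {x. bump n a b x \<noteq> 0})"
    by (rule compact_closure_subset) (rule compact_cbox)
  moreover have "Ck k (bump n a b)" for k
    unfolding bump_def[abs_def] by (intro Ck_prod Ck_mult Ck_flat_affine)
  ultimately show ?thesis using * assms by (auto simp: test_fun_def)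
qed

lemma flat_0_tendsto_1:
  assumes "t > 0"
  shows "(\<lambda>n. flat 0 (real (Suc n) * t)) \<longlonglongrightarrow> 1"
proof -
  have "(\<lambda>n. exp (- (inverse (real (Suc n)) * inverse t))) \<longlonglongrightarrow> exp (- (0 * inverse t))"
    by (intro tendsto_intros LIMSEQ_inverse_real_of_nat)
  then show ?thesis using assms by (simp add: flat_def)
qed

lemma bump_tendsto: "(\<lambda>n. bump (real (Suc n)) a b x) \<longlonglongrightarrow> indicator (box a b) x"
proof (cases "x \<in> box a b")
  case True
  have "(\<lambda>n. \<Prod>i\<in>UNIV. flat 0 (real (Suc n) * (x $ i - a $ i)) * flat 0 (real (Suc n) * (b $ i - x $ i)))
     \<longlonglongrightarrow> (\<Prod>i\<in>(UNIV::'a set). 1 * 1)"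
    using True by (intro tendsto_prod tendsto_mult flat_0_tendsto_1) (auto simp: mem_box_cart)
  then show ?thesis using True by (simp add: bump_def algebra_simps)
next
  case False
  have "(\<lambda>n. bump (real (Suc n)) a b x) = (\<lambda>n. 0)"
    by (rule ext, rule bump_outside) (use False in auto)
  then show ?thesis using False by simp
qed

section \<open>The fundamental lemma of the calculus of variations\<close>

text \<open>
The positive and the negative part of \<open>g\<close> are densities of finite measures that agree on open boxes.
Boxes form an intersection-stable generator of the Borel sets, so the measures, and with them the
densities, coincide; the two parts of a function can only be equal where both vanish.
\<close>

lemma AE_eq_0_of_box_integrals:
  fixes g :: "'a::euclidean_space \<Rightarrow> real"
  assumes g: "integrable lebesgue g"
    and 0: "\<And>c d. (\<integral>x. indicator (box c d) x * g x \<partial>lebesgue) = 0"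
  shows "AE x in lebesgue. g x = 0"
proof -
  obtain g' where g'[measurable]: "g' \<in> borel_measurable lborel" and ae: "AE x in lborel. g x = g' x"
    using completion_ex_borel_measurable_real[of g lborel] g by auto
  have ae': "AE x in lebesgue. g x = g' x"
    using ae by (rule AE_completion)
  have int': "integrable lborel g'"
    using g integrable_cong_AE[OF _ _ ae'] integrable_completion[OF g'] g'
    by (metis borel_measurable_integrable measurable_completion)
  have g'0: "(\<integral>x. indicator (box c d) x * g' x \<partial>lborel) = 0" for c d :: 'a
  proof -
    have "(\<integral>x. indicator (box c d) x * g' x \<partial>lborel) = (\<integral>x. indicator (box c d) x * g' x \<partial>lebesgue)"
      by (rule integral_completion[symmetric]) measurable
    also have "\<dots> = (\<integral>x. indicator (box c d) x * g x \<partial>lebesgue)"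
    proof (rule integral_cong_AE)
      show "(\<lambda>x. indicat_real (box c d) x * g' x) \<in> borel_measurable lebesgue"
        by (rule measurable_completion) measurable
      show "(\<lambda>x. indicat_real (box c d) x * g x) \<in> borel_measurable lebesgue"
        using g by (intro borel_measurable_times borel_measurable_indicator) auto
    qed (use ae' in auto)
    finally show ?thesis using 0 by simp
  qed
  define p where "p = (\<lambda>x. ennreal (max 0 (g' x)))"
  define q where "q = (\<lambda>x. ennreal (max 0 (- g' x)))"
  have [measurable]: "p \<in> borel_measurable lborel" "q \<in> borel_measurable lborel"
    unfolding p_def q_def by measurable
  have ip: "integrable lborel (\<lambda>x. max 0 (g' x))" "integrable lborel (\<lambda>x. max 0 (- g' x))"
    using int' by auto
  have fin: "(\<integral>\<^sup>+x. p x \<partial>lborel) \<noteq> \<infinity>"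
    using ip(1) unfolding p_def by (subst nn_integral_eq_integral) auto
  have box_eq: "emeasure (density lborel p) (box c d) = emeasure (density lborel q) (box c d)" for c d
  proof -
    have i1: "integrable lborel (\<lambda>x. indicator (box c d) x * max 0 (g' x))"
      using integrable_mult_indicator[OF _ ip(1), of "box c d"] by simp
    have i2: "integrable lborel (\<lambda>x. indicator (box c d) x * max 0 (- g' x))"
      using integrable_mult_indicator[OF _ ip(2), of "box c d"] by simp
    have "(\<integral>x. indicator (box c d) x * max 0 (g' x) \<partial>lborel)
        - (\<integral>x. indicator (box c d) x * max 0 (- g' x) \<partial>lborel)
        = (\<integral>x. indicator (box c d) x * g' x \<partial>lborel)"
      unfolding Bochner_Integration.integral_diff[OF i1 i2, symmetric]
      by (intro Bochner_Integration.integral_cong) (auto simp: indicator_def max_def)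
    also have "\<dots> = 0" by (rule g'0)
    finally have "(\<integral>x. indicator (box c d) x * max 0 (g' x) \<partial>lborel)
        = (\<integral>x. indicator (box c d) x * max 0 (- g' x) \<partial>lborel)" by simp
    moreover have "emeasure (density lborel p) (box c d)
        = ennreal (\<integral>x. indicator (box c d) x * max 0 (g' x) \<partial>lborel)"
      using nn_integral_eq_integral[OF i1] unfolding p_def
      by (subst emeasure_density) (auto simp: ennreal_mult'' mult.commute ennreal_indicator)
    moreover have "emeasure (density lborel q) (box c d)
        = ennreal (\<integral>x. indicator (box c d) x * max 0 (- g' x) \<partial>lborel)"
      using nn_integral_eq_integral[OF i2] unfolding q_def
      by (subst emeasure_density) (auto simp: ennreal_mult'' mult.commute ennreal_indicator)
    ultimately show ?thesis by simp
  qed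
  have "density lborel p = density lborel q"
  proof (rule measure_eqI_generator_eq)
    let ?E = "range (\<lambda>(a, b). box a b::'a set)"
    show "Int_stable ?E"
      by (auto simp: Int_stable_def box_Int_box)
    show "?E \<subseteq> Pow UNIV" "sets (density lborel p) = sigma_sets UNIV ?E"
      "sets (density lborel q) = sigma_sets UNIV ?E"
      by (simp_all add: borel_eq_box)
    let ?A = "\<lambda>n::nat. box (- (real n *\<^sub>R One)) (real n *\<^sub>R One) :: 'a set"
    show "range ?A \<subseteq> ?E" "(\<Union>i. ?A i) = UNIV"
      unfolding UN_box_eq_UNIV by auto
    show "emeasure (density lborel p) (?A i) \<noteq> \<infinity>" for i
    proof -
      have "emeasure (density lborel p) (?A i) \<le> (\<integral>\<^sup>+x. p x \<partial>lborel)"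
        by (subst emeasure_density) (auto intro!: nn_integral_mono simp: indicator_def)
      then show ?thesis using fin neq_top_trans by (simp add: infinity_ennreal_def)
    qed
    show "emeasure (density lborel p) X = emeasure (density lborel q) X" if "X \<in> ?E" for X
      using that box_eq by auto
  qed
  then have "AE x in lborel. p x = q x"
    using finite_density_unique[of p lborel q] fin by simp
  then have "AE x in lborel. g' x = 0"
    by eventually_elim (auto simp: p_def q_def max_def split: if_splits)
  then have "AE x in lborel. g x = 0"
    using ae by eventually_elim simp
  then show ?thesis by (rule AE_completion)
qed

text \<open>
An open set is a countable union of closed boxes, and the boundary of a box is a null set.
\<close>

lemma AE_lebesgue_on_open_boxI:
  fixes \<Omega> :: "'a::euclidean_space set"
  assumes "open \<Omega>"
    and box: "\<And>a b. cbox a b \<subseteq> \<Omega> \<Longrightarrow> AE x in lebesgue. x \<in> box a b \<longrightarrow> P x"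
  shows "AE x in lebesgue_on \<Omega>. P x"
proof -
  obtain D where D: "countable D" "D \<subseteq> Pow \<Omega>" "\<And>X. X \<in> D \<Longrightarrow> \<exists>a b. X = cbox a b" "\<Union>D = \<Omega>"
    using open_countable_Union_open_cbox[OF assms(1)] by metis
  have "AE x in lebesgue. x \<in> X \<longrightarrow> P x" if "X \<in> D" for X
  proof -
    obtain a b where X: "X = cbox a b" using D(3) \<open>X \<in> D\<close> by blast
    have "negligible (cbox a b - box a b)" by (rule negligible_frontier_interval)
    then have "AE x in lebesgue. x \<notin> cbox a b - box a b"
      unfolding negligible_iff_null_sets by (rule AE_not_in)
    moreover have "AE x in lebesgue. x \<in> box a b \<longrightarrow> P x"
      using box D(2) that X by blast
    ultimately show ?thesis unfolding X by eventually_elim blast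
  qed
  then have "AE x in lebesgue. \<forall>X\<in>D. x \<in> X \<longrightarrow> P x"
    using AE_ball_countable[OF D(1), where P="\<lambda>x X. x \<in> X \<longrightarrow> P x" and M=lebesgue] by blast
  then show ?thesis
  proof (subst AE_restrict_space_iff)
    show "\<Omega> \<inter> space lebesgue \<in> sets lebesgue" using assms(1) by simp
    assume "AE x in lebesgue. \<forall>X\<in>D. x \<in> X \<longrightarrow> P x"
    then show "AE x in lebesgue. x \<in> \<Omega> \<longrightarrow> P x"
      by eventually_elim (use D(4) in blast)
  qed
qed

lemma Lp_1_iff: "f \<in> Lp 1 S \<longleftrightarrow> integrable (lebesgue_on S) f"
proof -
  have "(\<lambda>x. norm (f x) powr 1) = (\<lambda>x. norm (f x))" by auto
  then show ?thesis
    unfolding Lp_def using integrable_norm_iff[of f "lebesgue_on S"] by auto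
qed

lemma measurable_bilinear:
  fixes prod :: "'a::euclidean_space \<Rightarrow> 'b::euclidean_space \<Rightarrow> 'c::euclidean_space"
  assumes "bounded_bilinear prod" and [measurable]: "f \<in> borel_measurable M" "g \<in> borel_measurable M"
  shows "(\<lambda>x. prod (f x) (g x)) \<in> borel_measurable M"
  by (rule borel_measurable_continuous_Pair)
     (auto intro!: bounded_bilinear.continuous_on[OF assms(1)] continuous_intros)

lemma integrable_bilinear_bounded:
  fixes prod :: "'a::euclidean_space \<Rightarrow> 'b::euclidean_space \<Rightarrow> 'c::euclidean_space"
  assumes "bounded_bilinear prod" "integrable M f" "g \<in> borel_measurable M"
    and bd: "AE x in M. norm (g x) \<le> C"
  shows "integrable M (\<lambda>x. prod (f x) (g x))"
proof -
  obtain B where B: "0 < B" "\<And>a b. norm (prod a b) \<le> norm a * norm b * B"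
    using bounded_bilinear.pos_bounded[OF assms(1)] by blast
  have "integrable M (\<lambda>x. (B * C) *\<^sub>R f x)" using assms(2) by simp
  then show ?thesis
  proof (rule Bochner_Integration.integrable_bound)
    show "(\<lambda>x. prod (f x) (g x)) \<in> borel_measurable M"
      by (rule measurable_bilinear[OF assms(1) borel_measurable_integrable[OF assms(2)] assms(3)])
    show "AE x in M. norm (prod (f x) (g x)) \<le> norm ((B * C) *\<^sub>R f x)"
      using bd
    proof eventually_elim
      case (elim x)
      then have C: "0 \<le> C" by (meson norm_ge_zero order_trans)
      have "norm (prod (f x) (g x)) \<le> norm (f x) * norm (g x) * B" by (rule B)
      also have "\<dots> \<le> norm (f x) * C * B"
        using elim B(1) by (intro mult_right_mono mult_left_mono) auto
      finally show ?case using B(1) C by (simp add: mult_ac)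
    qed
  qed
qed

lemma integrable_lebesgue_on_extend:
  fixes f :: "'a::euclidean_space \<Rightarrow> 'b::euclidean_space"
  assumes "integrable (lebesgue_on K) f" "K \<subseteq> \<Omega>" "K \<in> sets lebesgue" "\<Omega> \<in> sets lebesgue"
    and "\<And>x. x \<notin> K \<Longrightarrow> f x = 0"
  shows "integrable (lebesgue_on \<Omega>) f"
proof -
  have "(\<lambda>x. if x \<in> K then f x else 0) = (\<lambda>x. if x \<in> \<Omega> then f x else 0)"
    using assms(2,5) by (auto simp: fun_eq_iff)
  then show ?thesis
    using assms Lebesgue_Measure.integrable_restrict_UNIV[of K f] Lebesgue_Measure.integrable_restrict_UNIV[of \<Omega> f] by simp
qed

lemma Lp_loc_1_integrable:
  fixes prod :: "'b::euclidean_space \<Rightarrow> 'c::euclidean_space \<Rightarrow> 'd::euclidean_space"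
  assumes prod: "bounded_bilinear prod" and f: "f \<in> Lp_loc 1 \<Omega>" and "open \<Omega>"
    and g: "continuous_on UNIV g" and K: "compact K" "K \<subseteq> \<Omega>" "\<And>x. x \<notin> K \<Longrightarrow> g x = 0"
  shows "integrable (lebesgue_on \<Omega>) (\<lambda>x. prod (f x) (g x))"
proof -
  interpret bounded_bilinear prod by fact
  have Ks: "K \<in> sets lebesgue" "\<Omega> \<in> sets lebesgue"
    using K(1) \<open>open \<Omega>\<close> by (auto simp: borel_closed compact_imp_closed)
  obtain C where C: "C > 0" "\<And>x. norm (g x) \<le> C"
    using bounded_range_of_compact_support[OF g K(1) K(3)] by blast
  have "f \<in> Lp 1 K" using f K unfolding Lp_loc_def by blast
  then have "integrable (lebesgue_on K) f" by (simp only: Lp_1_iff)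
  moreover have "g \<in> borel_measurable (lebesgue_on K)"
    by (rule continuous_imp_measurable_on_sets_lebesgue[OF continuous_on_subset[OF g]]) (use Ks in auto)
  ultimately have "integrable (lebesgue_on K) (\<lambda>x. prod (f x) (g x))"
    by (rule integrable_bilinear_bounded[OF prod]) (use C in auto)
  then show ?thesis
    by (rule integrable_lebesgue_on_extend) (use K Ks in \<open>simp_all add: zero_right\<close>)
qed

lemma Lp_loc_1_integrable_test_fun:
  fixes f :: "real^'n \<Rightarrow> 'b::euclidean_space"
  assumes "f \<in> Lp_loc 1 \<Omega>" "open \<Omega>" "\<phi> \<in> test_fun \<Omega>"
  shows "integrable (lebesgue_on \<Omega>) (\<lambda>x. \<phi> x *\<^sub>R f x)"
proof -
  obtain K where K: "compact K" "K \<subseteq> \<Omega>" "\<And>x. x \<notin> K \<Longrightarrow> \<phi> x = 0"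
    using test_fun_support[OF assms(3)] by metis
  show ?thesis
    using Lp_loc_1_integrable[OF bounded_bilinear.flip[OF bounded_bilinear_scaleR] assms(1,2)
        continuous_on_test_fun[OF assms(3)] K] .
qed

lemma Lp_loc_1_integrable_grad:
  fixes f :: "real^'n \<Rightarrow> real"
  assumes "f \<in> Lp_loc 1 \<Omega>" "open \<Omega>" "\<phi> \<in> test_fun \<Omega>"
  shows "integrable (lebesgue_on \<Omega>) (\<lambda>x. f x *\<^sub>R grad \<phi> x)"
proof -
  obtain K where K: "compact K" "K \<subseteq> \<Omega>" "\<And>x. x \<notin> K \<Longrightarrow> grad \<phi> x = 0"
    using test_fun_support[OF assms(3)] by metis
  show ?thesis
    using Lp_loc_1_integrable[OF bounded_bilinear_scaleR assms(1,2)
        continuous_on_grad_test_fun[OF assms(3)] K] .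
qed

text \<open>
Steep bumps approximate the indicator of a box, so the integral of \<open>f\<close> over every box inside \<open>\<Omega>\<close>
vanishes, and \<open>AE_eq_0_of_box_integrals\<close> applies to each coordinate of \<open>f\<close>.
\<close>

lemma fundamental_lemma:
  fixes f :: "real^'n \<Rightarrow> 'b::euclidean_space"
  assumes f: "f \<in> Lp_loc 1 \<Omega>" and "open \<Omega>"
    and 0: "\<And>\<phi>. \<phi> \<in> test_fun \<Omega> \<Longrightarrow> (\<integral>x. \<phi> x *\<^sub>R f x \<partial>lebesgue_on \<Omega>) = 0"
  shows "AE x in lebesgue_on \<Omega>. f x = 0"
proof (rule AE_lebesgue_on_open_boxI[OF \<open>open \<Omega>\<close>])
  fix a b :: "real^'n" assume ab: "cbox a b \<subseteq> \<Omega>"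
  have \<Omega>: "\<Omega> \<in> sets lebesgue" using \<open>open \<Omega>\<close> by auto
  define F where "F = (\<lambda>x. indicator (box a b) x *\<^sub>R f x)"
  have "f \<in> Lp 1 (cbox a b)" using f ab unfolding Lp_loc_def by auto
  then have fi: "integrable (lebesgue_on (cbox a b)) f" by (simp only: Lp_1_iff)
  then have fi': "integrable lebesgue (\<lambda>x. indicator (cbox a b) x *\<^sub>R f x)"
    by (simp add: integrable_restrict_space)
  have F: "integrable lebesgue F"
  proof -
    have "F = (\<lambda>x. indicator (box a b) x *\<^sub>R (indicator (cbox a b) x *\<^sub>R f x))"
      using box_subset_cbox[of a b] by (auto simp: F_def fun_eq_iff indicator_def)
    then show ?thesis using integrable_mult_indicator[OF _ fi', of "box a b"] by simp
  qed
  have box0: "(\<integral>x. indicator (box c d) x *\<^sub>R F x \<partial>lebesgue) = 0" for c d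
  proof -
    obtain c' d' where cd: "box a b \<inter> box c d = box c' d'"
      by (rule that[OF box_Int_box])
    have eq: "(\<lambda>x. indicator (box c d) x *\<^sub>R F x) = (\<lambda>x. indicator (box c' d') x *\<^sub>R f x)"
      unfolding F_def cd[symmetric] by (auto simp: fun_eq_iff indicator_def)
    show ?thesis
    proof (cases "box c' d' = {}")
      case True
      then show ?thesis unfolding eq by simp
    next
      case False
      then have sub: "cbox c' d' \<subseteq> cbox a b"
        using cd closure_mono[of "box c' d'" "box a b"]
        by (metis closure_box empty_iff inf.cobounded1 inf_bot_left)
      have "(\<lambda>n. \<integral>x. bump (real (Suc n)) c' d' x *\<^sub>R (indicator (cbox a b) x *\<^sub>R f x) \<partial>lebesgue)
          \<longlonglongrightarrow> (\<integral>x. indicator (box c' d') x *\<^sub>R (indicator (cbox a b) x *\<^sub>R f x) \<partial>lebesgue)"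
      proof (rule integral_dominated_convergence[where w="\<lambda>x. norm (indicator (cbox a b) x *\<^sub>R f x)"])
        have m: "(\<lambda>x. indicator (cbox a b) x *\<^sub>R f x) \<in> borel_measurable lebesgue"
          using fi' by (rule borel_measurable_integrable)
        show "(\<lambda>x. indicat_real (box c' d') x *\<^sub>R indicat_real (cbox a b) x *\<^sub>R f x) \<in> borel_measurable lebesgue"
          by (rule borel_measurable_scaleR[OF borel_measurable_indicator m]) simp
        show "(\<lambda>x. bump (real (Suc n)) c' d' x *\<^sub>R indicat_real (cbox a b) x *\<^sub>R f x) \<in> borel_measurable lebesgue"
          for n
        proof (rule borel_measurable_scaleR[OF _ m])
          have "continuous_on UNIV (bump (real (Suc n)) c' d')"
            by (rule continuous_on_test_fun[OF bump_test_fun[of _ c' d' UNIV]]) auto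
          then show "bump (real (Suc n)) c' d' \<in> borel_measurable lebesgue"
            using borel_measurable_continuous_onI by (intro measurable_completion) auto
        qed
        show "AE x in lebesgue. norm (bump (real (Suc n)) c' d' x *\<^sub>R indicat_real (cbox a b) x *\<^sub>R f x)
           \<le> norm (indicat_real (cbox a b) x *\<^sub>R f x)" for n
        proof (rule AE_I2)
          fix x
          have "\<bar>bump (real (Suc n)) c' d' x\<bar> \<le> 1"
            using bump_bounds[of "real (Suc n)" c' d' x] by linarith
          then show "norm (bump (real (Suc n)) c' d' x *\<^sub>R indicat_real (cbox a b) x *\<^sub>R f x)
             \<le> norm (indicat_real (cbox a b) x *\<^sub>R f x)"
            unfolding norm_scaleR[of "bump _ _ _ _"] by (intro mult_left_le_one_le) auto
        qed
        show "integrable lebesgue (\<lambda>x. norm (indicat_real (cbox a b) x *\<^sub>R f x))"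
          using fi' by (rule integrable_norm)
        show "AE x in lebesgue. (\<lambda>n. bump (real (Suc n)) c' d' x *\<^sub>R indicat_real (cbox a b) x *\<^sub>R f x)
            \<longlonglongrightarrow> indicat_real (box c' d') x *\<^sub>R indicat_real (cbox a b) x *\<^sub>R f x"
          by (intro AE_I2 tendsto_scaleR bump_tendsto tendsto_const)
      qed
      moreover have "(\<integral>x. bump (real (Suc n)) c' d' x *\<^sub>R (indicator (cbox a b) x *\<^sub>R f x) \<partial>lebesgue) = 0" for n
      proof -
        have "bump (real (Suc n)) c' d' \<in> test_fun \<Omega>"
          by (rule bump_test_fun) (use sub ab in auto)
        from 0[OF this] have "(\<integral>x. indicator \<Omega> x *\<^sub>R (bump (real (Suc n)) c' d' x *\<^sub>R f x) \<partial>lebesgue) = 0"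
          using \<Omega> by (simp add: integral_restrict_space)
        moreover have "indicator \<Omega> x *\<^sub>R (bump (real (Suc n)) c' d' x *\<^sub>R f x)
            = bump (real (Suc n)) c' d' x *\<^sub>R (indicator (cbox a b) x *\<^sub>R f x)" for x
        proof (cases "x \<in> box c' d'")
          case True
          then have "x \<in> cbox a b" using sub box_subset_cbox by blast
          then show ?thesis using ab by (auto simp: indicator_def)
        next
          case False
          then have "bump (real (Suc n)) c' d' x = 0" by (intro bump_outside) auto
          then show ?thesis by simp
        qed
        ultimately show ?thesis by (simp only:)
      qed
      ultimately have "(\<integral>x. indicator (box c' d') x *\<^sub>R (indicator (cbox a b) x *\<^sub>R f x) \<partial>lebesgue) = 0"
        by (simp only: LIMSEQ_const_iff)
      moreover have "indicator (box c' d') x *\<^sub>R (indicator (cbox a b) x *\<^sub>R f x) = indicator (box c' d') x *\<^sub>R f x" for x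
        using sub box_subset_cbox[of c' d'] by (auto simp: indicator_def)
      ultimately show ?thesis unfolding eq by (simp only:)
    qed
  qed
  have "AE x in lebesgue. F x \<bullet> e = 0" if "e \<in> Basis" for e
  proof (rule AE_eq_0_of_box_integrals)
    show "integrable lebesgue (\<lambda>x. F x \<bullet> e)" using F by simp
    fix c d
    have "integrable lebesgue (\<lambda>x. indicat_real (box c d) x *\<^sub>R F x)"
      using integrable_mult_indicator[OF _ F, of "box c d"] by simp
    from integral_inner_left[OF this, of e]
    show "(\<integral>x. indicator (box c d) x * (F x \<bullet> e) \<partial>lebesgue) = 0"
      using box0[of c d] by simp
  qed
  then have "AE x in lebesgue. \<forall>e\<in>Basis. F x \<bullet> e = 0"
    by (simp add: AE_finite_all)
  then show "AE x in lebesgue. x \<in> box a b \<longrightarrow> f x = 0"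
    by eventually_elim (auto simp: F_def euclidean_all_zero_iff)
qed

section \<open>Square-integrable functions\<close>

lemma Lp_2_iff:
  "f \<in> Lp 2 S \<longleftrightarrow> f \<in> borel_measurable (lebesgue_on S) \<and> integrable (lebesgue_on S) (\<lambda>x. (norm (f x))\<^sup>2)"
  unfolding Lp_def by simp

lemma Lp_2_measurable: "f \<in> Lp 2 S \<Longrightarrow> f \<in> borel_measurable (lebesgue_on S)"
  by (simp add: Lp_2_iff)

lemma Lp_2_square: "f \<in> Lp 2 S \<Longrightarrow> integrable (lebesgue_on S) (\<lambda>x. (norm (f x))\<^sup>2)"
  by (simp add: Lp_2_iff)

lemma Lp_2_norm_mult_integrable:
  assumes f: "f \<in> Lp 2 S" and g: "g \<in> Lp 2 S"
  shows "integrable (lebesgue_on S) (\<lambda>x. norm (f x) * norm (g x))"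
proof -
  have [measurable]: "f \<in> borel_measurable (lebesgue_on S)" "g \<in> borel_measurable (lebesgue_on S)"
    using f g by (auto intro: Lp_2_measurable)
  have "integrable (lebesgue_on S) (\<lambda>x. (norm (f x))\<^sup>2 + (norm (g x))\<^sup>2)"
    by (intro Bochner_Integration.integrable_add Lp_2_square f g)
  then show ?thesis
  proof (rule Bochner_Integration.integrable_bound)
    have "norm (f x) * norm (g x) \<le> (norm (f x))\<^sup>2 + (norm (g x))\<^sup>2" for x
    proof -
      have "2 * norm (f x) * norm (g x) \<le> (norm (f x))\<^sup>2 + (norm (g x))\<^sup>2"
        by (rule sum_squares_bound)
      moreover have "0 \<le> norm (f x) * norm (g x)" by simp
      ultimately show ?thesis by linarith
    qed
    then show "AE x in lebesgue_on S. norm (norm (f x) * norm (g x))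
        \<le> norm ((norm (f x))\<^sup>2 + (norm (g x))\<^sup>2)"
      by simp
  qed measurable
qed

lemma Lp_2_bilinear_integrable:
  fixes prod :: "'b::euclidean_space \<Rightarrow> 'c::euclidean_space \<Rightarrow> 'd::euclidean_space"
  assumes prod: "bounded_bilinear prod" and f: "f \<in> Lp 2 S" and g: "g \<in> Lp 2 S"
  shows "integrable (lebesgue_on S) (\<lambda>x. prod (f x) (g x))"
proof -
  obtain B where B: "0 < B" "\<And>a b. norm (prod a b) \<le> norm a * norm b * B"
    using bounded_bilinear.pos_bounded[OF prod] by blast
  have "integrable (lebesgue_on S) (\<lambda>x. norm (f x) * norm (g x) * B)"
    using Lp_2_norm_mult_integrable[OF f g] by simp
  then show ?thesis
  proof (rule Bochner_Integration.integrable_bound)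
    show "(\<lambda>x. prod (f x) (g x)) \<in> borel_measurable (lebesgue_on S)"
      by (rule measurable_bilinear[OF prod Lp_2_measurable[OF f] Lp_2_measurable[OF g]])
    show "AE x in lebesgue_on S. norm (prod (f x) (g x)) \<le> norm (norm (f x) * norm (g x) * B)"
      using B by simp
  qed
qed

lemma Lp_2_bilinear_bounded:
  fixes prod :: "'b::euclidean_space \<Rightarrow> 'c::euclidean_space \<Rightarrow> 'd::euclidean_space"
  assumes prod: "bounded_bilinear prod" and f: "f \<in> Lp 2 S"
    and g: "g \<in> borel_measurable (lebesgue_on S)" and bd: "AE x in lebesgue_on S. norm (g x) \<le> C"
  shows "(\<lambda>x. prod (f x) (g x)) \<in> Lp 2 S"
proof -
  obtain B where B: "0 < B" "\<And>a b. norm (prod a b) \<le> norm a * norm b * B"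
    using bounded_bilinear.pos_bounded[OF prod] by blast
  have m[measurable]: "(\<lambda>x. prod (f x) (g x)) \<in> borel_measurable (lebesgue_on S)"
    by (rule measurable_bilinear[OF prod Lp_2_measurable[OF f] g])
  have "integrable (lebesgue_on S) (\<lambda>x. (C * B)\<^sup>2 * (norm (f x))\<^sup>2)"
    using Lp_2_square[OF f] by simp
  then have "integrable (lebesgue_on S) (\<lambda>x. (norm (prod (f x) (g x)))\<^sup>2)"
  proof (rule Bochner_Integration.integrable_bound)
    show "AE x in lebesgue_on S. norm ((norm (prod (f x) (g x)))\<^sup>2) \<le> norm ((C * B)\<^sup>2 * (norm (f x))\<^sup>2)"
      using bd
    proof eventually_elim
      case (elim x)
      have "norm (prod (f x) (g x)) \<le> norm (f x) * norm (g x) * B" by (rule B)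
      also have "\<dots> \<le> norm (f x) * C * B"
        using elim B(1) by (intro mult_right_mono mult_left_mono) auto
      finally have "(norm (prod (f x) (g x)))\<^sup>2 \<le> (norm (f x) * C * B)\<^sup>2"
        by (rule power_mono) simp
      then show ?case by (simp add: power_mult_distrib mult_ac)
    qed
  qed measurable
  with m show ?thesis by (simp only: Lp_2_iff)
qed

lemma Lp_2_bounded_scaleR:
  fixes f :: "real^'n \<Rightarrow> 'b::euclidean_space"
  assumes "f \<in> Lp 2 S" "g \<in> borel_measurable (lebesgue_on S)" "AE x in lebesgue_on S. \<bar>g x\<bar> \<le> C"
  shows "(\<lambda>x. g x *\<^sub>R f x) \<in> Lp 2 S"
  using Lp_2_bilinear_bounded[OF bounded_bilinear.flip[OF bounded_bilinear_scaleR] assms(1,2)] assms(3)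
  by (simp only: real_norm_def)

lemma Lp_2_scaleR: "f \<in> Lp 2 S \<Longrightarrow> (\<lambda>x. c *\<^sub>R f x) \<in> Lp 2 S"
  by (rule Lp_2_bounded_scaleR[of f S "\<lambda>x. c" "\<bar>c\<bar>"]) auto

lemma Lp_2_add:
  assumes f: "f \<in> Lp 2 S" and g: "g \<in> Lp 2 S"
  shows "(\<lambda>x. f x + g x) \<in> Lp 2 S"
proof -
  have [measurable]: "f \<in> borel_measurable (lebesgue_on S)" "g \<in> borel_measurable (lebesgue_on S)"
    using f g by (auto intro: Lp_2_measurable)
  have "integrable (lebesgue_on S) (\<lambda>x. 2 * ((norm (f x))\<^sup>2 + (norm (g x))\<^sup>2))"
    by (intro Bochner_Integration.integrable_add Lp_2_square f g integrable_mult_right)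
  then have "integrable (lebesgue_on S) (\<lambda>x. (norm (f x + g x))\<^sup>2)"
  proof (rule Bochner_Integration.integrable_bound)
    have "(norm (f x + g x))\<^sup>2 \<le> 2 * ((norm (f x))\<^sup>2 + (norm (g x))\<^sup>2)" for x
    proof -
      have "(norm (f x + g x))\<^sup>2 \<le> (norm (f x) + norm (g x))\<^sup>2"
        by (intro power_mono norm_triangle_ineq norm_ge_zero)
      also have "\<dots> \<le> 2 * ((norm (f x))\<^sup>2 + (norm (g x))\<^sup>2)"
        using sum_squares_bound[of "norm (f x)" "norm (g x)"] by (simp add: power2_sum)
      finally show ?thesis .
    qed
    then show "AE x in lebesgue_on S. norm ((norm (f x + g x))\<^sup>2)
        \<le> norm (2 * ((norm (f x))\<^sup>2 + (norm (g x))\<^sup>2))"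
      by simp
  qed measurable
  then show ?thesis by (simp add: Lp_2_iff)
qed

lemma Lp_2_diff: "f \<in> Lp 2 S \<Longrightarrow> g \<in> Lp 2 S \<Longrightarrow> (\<lambda>x. f x - g x) \<in> Lp 2 S"
  using Lp_2_add[of f S "\<lambda>x. (-1) *\<^sub>R g x"] Lp_2_scaleR[of g S "-1"] by simp

lemma Lp_2_bound:
  assumes f: "f \<in> Lp 2 S" and g: "g \<in> borel_measurable (lebesgue_on S)"
    and le: "AE x in lebesgue_on S. norm (g x) \<le> norm (f x)"
  shows "g \<in> Lp 2 S"
proof -
  have "integrable (lebesgue_on S) (\<lambda>x. (norm (g x))\<^sup>2)"
    by (rule Bochner_Integration.integrable_bound[OF Lp_2_square[OF f]])
       (use g le in \<open>auto intro: power_mono elim!: eventually_mono\<close>)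
  with g show ?thesis by (simp add: Lp_2_iff)
qed

text \<open>
By completeness of the Lebesgue measure; this makes it harmless that \<open>wgrad\<close> is an arbitrary
representative.
\<close>

lemma borel_measurable_AE_eq:
  fixes f g :: "'a::euclidean_space \<Rightarrow> 'b::euclidean_space"
  assumes S: "S \<in> sets lebesgue" and f: "f \<in> borel_measurable (lebesgue_on S)"
    and ae: "AE x in lebesgue_on S. f x = g x"
  shows "g \<in> borel_measurable (lebesgue_on S)"
proof (rule measurableI)
  fix B :: "'b set" assume B: "B \<in> sets borel"
  obtain N where N: "N \<in> null_sets (lebesgue_on S)" "{x \<in> space (lebesgue_on S). f x \<noteq> g x} \<subseteq> N"
    using ae by (auto simp: eventually_ae_filter)
  have NS: "N \<subseteq> S" "N \<in> null_sets lebesgue"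
    using N(1) S null_sets_restrict_space[of S lebesgue N] by auto
  have "g -` B \<inter> N \<inter> S \<in> null_sets lebesgue"
    by (rule null_sets_completion_subset[OF _ NS(2)]) auto
  then have "g -` B \<inter> N \<inter> S \<in> sets (lebesgue_on S)"
    using S by (auto simp: sets_restrict_space_iff null_sets_def)
  moreover have "f -` B \<inter> space (lebesgue_on S) - N \<in> sets (lebesgue_on S)"
    using N(1) by (intro sets.Diff measurable_sets[OF f B]) auto
  moreover have "g -` B \<inter> space (lebesgue_on S) = (f -` B \<inter> space (lebesgue_on S) - N) \<union> (g -` B \<inter> N \<inter> S)"
    using N(2) by auto
  ultimately show "g -` B \<inter> space (lebesgue_on S) \<in> sets (lebesgue_on S)"
    by auto
qed auto

lemma Lp_2_AE_eq:
  fixes f g :: "real^'n \<Rightarrow> 'b::euclidean_space"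
  assumes "S \<in> sets lebesgue" "f \<in> Lp 2 S" "AE x in lebesgue_on S. f x = g x"
  shows "g \<in> Lp 2 S"
proof (rule Lp_2_bound[OF assms(2)])
  show "g \<in> borel_measurable (lebesgue_on S)"
    by (rule borel_measurable_AE_eq[OF assms(1) Lp_2_measurable[OF assms(2)] assms(3)])
  show "AE x in lebesgue_on S. norm (g x) \<le> norm (f x)"
    using assms(3) by eventually_elim simp
qed

abbreviation L2sq where "L2sq S f \<equiv> \<integral>x. (norm (f x))\<^sup>2 \<partial>lebesgue_on S"

text \<open>
The integral of \<open>(|f| - t |g|)\<^sup>2\<close> is a nonnegative quadratic polynomial in \<open>t\<close>; it is evaluated at its
minimum.
\<close>

lemma Cauchy_Schwarz_integral:
  assumes f: "f \<in> Lp 2 S" and g: "g \<in> Lp 2 S"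
  shows "(\<integral>x. norm (f x) * norm (g x) \<partial>lebesgue_on S)
     \<le> sqrt (L2sq S f) * sqrt (L2sq S g)"
proof -
  define a where "a = L2sq S f"
  define b where "b = L2sq S g"
  define c where "c = (\<integral>x. norm (f x) * norm (g x) \<partial>lebesgue_on S)"
  have pos: "0 \<le> a" "0 \<le> b" "0 \<le> c"
    unfolding a_def b_def c_def by (auto intro!: integral_nonneg_AE)
  have q: "0 \<le> a - 2 * t * c + t\<^sup>2 * b" for t
  proof -
    have "a - 2 * t * c + t\<^sup>2 * b
      = (\<integral>x. (norm (f x))\<^sup>2 - 2 * t * (norm (f x) * norm (g x)) + t\<^sup>2 * (norm (g x))\<^sup>2 \<partial>lebesgue_on S)"
      unfolding a_def b_def c_def
      using Lp_2_square[OF f] Lp_2_square[OF g] Lp_2_norm_mult_integrable[OF f g] by simp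
    also have "\<dots> = (\<integral>x. (norm (f x) - t * norm (g x))\<^sup>2 \<partial>lebesgue_on S)"
      by (intro Bochner_Integration.integral_cong) (auto simp: power2_diff power_mult_distrib)
    also have "\<dots> \<ge> 0" by (intro integral_nonneg_AE) auto
    finally show ?thesis .
  qed
  have "c\<^sup>2 \<le> a * b"
  proof (cases "b = 0")
    case True
    have "c = 0"
    proof (rule ccontr)
      assume "c \<noteq> 0"
      with q[of "(a + 1) / (2 * c)"] True show False by simp
    qed
    then show ?thesis using True by simp
  next
    case False
    then have "0 < b" using pos by simp
    have "0 \<le> a - 2 * (c / b) * c + (c / b)\<^sup>2 * b" by (rule q)
    also have "\<dots> = a - c\<^sup>2 / b" using \<open>0 < b\<close> by (simp add: power2_eq_square field_simps)
    finally show ?thesis using \<open>0 < b\<close> by (simp add: field_simps)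
  qed
  then have "c \<le> sqrt (a * b)" by (rule real_le_rsqrt)
  then show ?thesis unfolding a_def b_def c_def real_sqrt_mult .
qed

definition L2_tendsto ::
  "(real^'n) set \<Rightarrow> (nat \<Rightarrow> real^'n \<Rightarrow> 'b::euclidean_space) \<Rightarrow> (real^'n \<Rightarrow> 'b) \<Rightarrow> bool" where
  "L2_tendsto S f g \<longleftrightarrow> (\<forall>n. f n \<in> Lp 2 S) \<and> g \<in> Lp 2 S \<and>
     (\<lambda>n. L2sq S (\<lambda>x. f n x - g x)) \<longlonglongrightarrow> 0"

lemma LIMSEQ_0_le:
  fixes a b :: "nat \<Rightarrow> real"
  assumes "b \<longlonglongrightarrow> z" "z = 0" "\<And>n. 0 \<le> a n" "\<And>n. a n \<le> b n"
  shows "a \<longlonglongrightarrow> 0"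
  using tendsto_sandwich[of "\<lambda>_. 0" a sequentially b 0] assms by auto

lemma L2_tendsto_const: "f \<in> Lp 2 S \<Longrightarrow> L2_tendsto S (\<lambda>n. f) f"
  by (simp add: L2_tendsto_def)

lemma L2_tendsto_mono:
  assumes f: "L2_tendsto S f f'" and g: "\<And>n. g n \<in> Lp 2 S" "g' \<in> Lp 2 S"
    and le: "\<And>n. AE x in lebesgue_on S. norm (g n x - g' x) \<le> C * norm (f n x - f' x)"
  shows "L2_tendsto S g g'"
proof -
  have "(\<lambda>n. C\<^sup>2 * (L2sq S (\<lambda>x. f n x - f' x))) \<longlonglongrightarrow> C\<^sup>2 * 0"
    using f unfolding L2_tendsto_def by (intro tendsto_mult tendsto_const) auto
  then have "(\<lambda>n. L2sq S (\<lambda>x. g n x - g' x)) \<longlonglongrightarrow> 0"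
  proof (rule LIMSEQ_0_le)
    show "0 \<le> (L2sq S (\<lambda>x. g n x - g' x))" for n
      by (intro integral_nonneg_AE) auto
    show "(L2sq S (\<lambda>x. g n x - g' x))
        \<le> C\<^sup>2 * (L2sq S (\<lambda>x. f n x - f' x))" for n
    proof -
      have "(L2sq S (\<lambda>x. g n x - g' x))
        \<le> (\<integral>x. C\<^sup>2 * (norm (f n x - f' x))\<^sup>2 \<partial>lebesgue_on S)"
      proof (rule integral_mono_AE)
        show "integrable (lebesgue_on S) (\<lambda>x. (norm (g n x - g' x))\<^sup>2)"
          by (intro Lp_2_square Lp_2_diff g)
        have "(\<lambda>x. f n x - f' x) \<in> Lp 2 S"
          using f by (intro Lp_2_diff) (auto simp: L2_tendsto_def)
        from Lp_2_square[OF this]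
        show "integrable (lebesgue_on S) (\<lambda>x. C\<^sup>2 * (norm (f n x - f' x))\<^sup>2)"
          by simp
        show "AE x in lebesgue_on S. (norm (g n x - g' x))\<^sup>2 \<le> C\<^sup>2 * (norm (f n x - f' x))\<^sup>2"
          using le[of n]
        proof eventually_elim
          case (elim x)
          then have "(norm (g n x - g' x))\<^sup>2 \<le> (C * norm (f n x - f' x))\<^sup>2"
            by (rule power_mono) simp
          then show ?case by (simp add: power_mult_distrib)
        qed
      qed
      then show ?thesis by simp
    qed
  qed simp
  with g show ?thesis by (simp add: L2_tendsto_def)
qed

lemma L2_tendsto_bounded_bilinear:
  fixes prod :: "'b::euclidean_space \<Rightarrow> 'c::euclidean_space \<Rightarrow> 'd::euclidean_space"
  assumes prod: "bounded_bilinear prod" and f: "L2_tendsto S f f'"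
    and g: "g \<in> borel_measurable (lebesgue_on S)" and bd: "\<And>x. norm (g x) \<le> C"
  shows "L2_tendsto S (\<lambda>n x. prod (f n x) (g x)) (\<lambda>x. prod (f' x) (g x))"
proof -
  obtain B where B: "0 < B" "\<And>a b. norm (prod a b) \<le> norm a * norm b * B"
    using bounded_bilinear.pos_bounded[OF prod] by blast
  show ?thesis
  proof (rule L2_tendsto_mono[OF f, of _ _ "C * B"])
    show "(\<lambda>x. prod (f n x) (g x)) \<in> Lp 2 S" for n
      by (rule Lp_2_bilinear_bounded[OF prod _ g]) (use f bd in \<open>auto simp: L2_tendsto_def\<close>)
    show "(\<lambda>x. prod (f' x) (g x)) \<in> Lp 2 S"
      by (rule Lp_2_bilinear_bounded[OF prod _ g]) (use f bd in \<open>auto simp: L2_tendsto_def\<close>)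
    show "AE x in lebesgue_on S. norm (prod (f n x) (g x) - prod (f' x) (g x)) \<le> C * B * norm (f n x - f' x)" for n
    proof (rule AE_I2)
      fix x
      have "norm (prod (f n x) (g x) - prod (f' x) (g x)) = norm (prod (f n x - f' x) (g x))"
        by (simp only: bounded_bilinear.diff_left[OF prod])
      also have "\<dots> \<le> norm (f n x - f' x) * norm (g x) * B" by (rule B)
      also have "\<dots> \<le> norm (f n x - f' x) * C * B"
        using bd B(1) by (intro mult_right_mono mult_left_mono) auto
      finally show "norm (prod (f n x) (g x) - prod (f' x) (g x)) \<le> C * B * norm (f n x - f' x)"
        by (simp only: mult_ac)
    qed
  qed
qed

lemma L2_tendsto_add:
  assumes f: "L2_tendsto S f f'" and g: "L2_tendsto S g g'"
  shows "L2_tendsto S (\<lambda>n x. f n x + g n x) (\<lambda>x. f' x + g' x)"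
proof -
  have L: "\<And>n. f n \<in> Lp 2 S" "f' \<in> Lp 2 S" "\<And>n. g n \<in> Lp 2 S" "g' \<in> Lp 2 S"
    using f g by (auto simp: L2_tendsto_def)
  let ?F = "\<lambda>n. L2sq S (\<lambda>x. f n x - f' x)"
  let ?G = "\<lambda>n. L2sq S (\<lambda>x. g n x - g' x)"
  have "(\<lambda>n. 2 * (?F n + ?G n)) \<longlonglongrightarrow> 2 * (0 + 0)"
    using f g unfolding L2_tendsto_def by (intro tendsto_mult tendsto_add tendsto_const) auto
  then have "(\<lambda>n. L2sq S (\<lambda>x. f n x + g n x - (f' x + g' x))) \<longlonglongrightarrow> 0"
  proof (rule LIMSEQ_0_le)
    show "0 \<le> (L2sq S (\<lambda>x. f n x + g n x - (f' x + g' x)))" for n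
      by (intro integral_nonneg_AE) auto
    show "(L2sq S (\<lambda>x. f n x + g n x - (f' x + g' x)))
        \<le> 2 * (?F n + ?G n)" for n
    proof -
      have i: "integrable (lebesgue_on S) (\<lambda>x. (norm (f n x - f' x))\<^sup>2)"
        "integrable (lebesgue_on S) (\<lambda>x. (norm (g n x - g' x))\<^sup>2)"
        by (intro Lp_2_square Lp_2_diff L)+
      have "(L2sq S (\<lambda>x. f n x + g n x - (f' x + g' x)))
        \<le> (\<integral>x. 2 * ((norm (f n x - f' x))\<^sup>2 + (norm (g n x - g' x))\<^sup>2) \<partial>lebesgue_on S)"
      proof (rule integral_mono)
        show "integrable (lebesgue_on S) (\<lambda>x. (norm (f n x + g n x - (f' x + g' x)))\<^sup>2)"
          by (intro Lp_2_square Lp_2_diff Lp_2_add L)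
        show "integrable (lebesgue_on S) (\<lambda>x. 2 * ((norm (f n x - f' x))\<^sup>2 + (norm (g n x - g' x))\<^sup>2))"
          using i by simp
        fix x
        have "norm (f n x + g n x - (f' x + g' x)) \<le> norm (f n x - f' x) + norm (g n x - g' x)"
          using norm_triangle_ineq[of "f n x - f' x" "g n x - g' x"] by (simp add: algebra_simps)
        then have "(norm (f n x + g n x - (f' x + g' x)))\<^sup>2 \<le> (norm (f n x - f' x) + norm (g n x - g' x))\<^sup>2"
          by (intro power_mono) auto
        also have "\<dots> \<le> 2 * ((norm (f n x - f' x))\<^sup>2 + (norm (g n x - g' x))\<^sup>2)"
          using sum_squares_bound[of "norm (f n x - f' x)" "norm (g n x - g' x)"] by (simp add: power2_sum)
        finally show "(norm (f n x + g n x - (f' x + g' x)))\<^sup>2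
            \<le> 2 * ((norm (f n x - f' x))\<^sup>2 + (norm (g n x - g' x))\<^sup>2)" .
      qed
      also have "\<dots> = 2 * (?F n + ?G n)" using i by simp
      finally show ?thesis .
    qed
  qed simp
  then show ?thesis using L by (auto simp: L2_tendsto_def intro: Lp_2_add)
qed

text \<open>
All limits in the integration by parts formulas have this form: two factors converging in \<open>L\<^sup>2\<close>. No
almost everywhere convergent subsequence is ever extracted.
\<close>

lemma L2_tendsto_integral_bilinear:
  fixes prod :: "'b::euclidean_space \<Rightarrow> 'c::euclidean_space \<Rightarrow> 'd::euclidean_space"
  assumes prod: "bounded_bilinear prod" and f: "L2_tendsto S f f'" and g: "L2_tendsto S g g'"
  shows "(\<lambda>n. \<integral>x. prod (f n x) (g n x) \<partial>lebesgue_on S) \<longlonglongrightarrow> (\<integral>x. prod (f' x) (g' x) \<partial>lebesgue_on S)"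
proof -
  interpret bounded_bilinear prod by fact
  obtain B where B: "0 < B" "\<And>a b. norm (prod a b) \<le> norm a * norm b * B"
    using pos_bounded by blast
  have L: "\<And>n. f n \<in> Lp 2 S" "f' \<in> Lp 2 S" "\<And>n. g n \<in> Lp 2 S" "g' \<in> Lp 2 S"
    using f g by (auto simp: L2_tendsto_def)
  define F where "F = (\<lambda>n. L2sq S (\<lambda>x. f n x - f' x))"
  define G where "G = (\<lambda>n. L2sq S (\<lambda>x. g n x - g' x))"
  define a where "a = L2sq S f'"
  define b where "b = L2sq S g'"
  have lim: "F \<longlonglongrightarrow> 0" "G \<longlonglongrightarrow> 0" using f g by (auto simp: L2_tendsto_def F_def G_def)
  have est: "norm (\<integral>x. prod (p x) (q x) \<partial>lebesgue_on S)
      \<le> B * (sqrt (L2sq S p) * sqrt (L2sq S q))"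
    if p: "p \<in> Lp 2 S" and q: "q \<in> Lp 2 S" for p :: "real^'a \<Rightarrow> 'b" and q :: "real^'a \<Rightarrow> 'c"
  proof -
    have "norm (\<integral>x. prod (p x) (q x) \<partial>lebesgue_on S) \<le> (\<integral>x. norm (prod (p x) (q x)) \<partial>lebesgue_on S)"
      by (rule integral_norm_bound)
    also have "\<dots> \<le> (\<integral>x. B * (norm (p x) * norm (q x)) \<partial>lebesgue_on S)"
    proof (rule integral_mono)
      show "integrable (lebesgue_on S) (\<lambda>x. norm (prod (p x) (q x)))"
        by (rule integrable_norm[OF Lp_2_bilinear_integrable[OF prod p q]])
      show "integrable (lebesgue_on S) (\<lambda>x. B * (norm (p x) * norm (q x)))"
        using Lp_2_norm_mult_integrable[OF p q] by simp
    qed (use B(2) in \<open>simp only: mult_ac\<close>)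
    also have "\<dots> = B * (\<integral>x. norm (p x) * norm (q x) \<partial>lebesgue_on S)" by simp
    also have "\<dots> \<le> B * (sqrt (L2sq S p) * sqrt (L2sq S q))"
      using Cauchy_Schwarz_integral[OF p q] B(1) by (intro mult_left_mono) auto
    finally show ?thesis .
  qed
  have Ld: "(\<lambda>x. f n x - f' x) \<in> Lp 2 S" "(\<lambda>x. g n x - g' x) \<in> Lp 2 S" for n
    by (intro Lp_2_diff L)+
  have "(\<lambda>n. B * (sqrt (F n) * sqrt (G n)) + B * (sqrt (F n) * sqrt b) + B * (sqrt a * sqrt (G n)))
      \<longlonglongrightarrow> B * (sqrt 0 * sqrt 0) + B * (sqrt 0 * sqrt b) + B * (sqrt a * sqrt 0)"
    by (intro tendsto_intros lim)
  then have lim0: "(\<lambda>n. B * (sqrt (F n) * sqrt (G n)) + B * (sqrt (F n) * sqrt b) + B * (sqrt a * sqrt (G n))) \<longlonglongrightarrow> 0"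
    by simp
  have "(\<lambda>n. (\<integral>x. prod (f n x) (g n x) \<partial>lebesgue_on S) - (\<integral>x. prod (f' x) (g' x) \<partial>lebesgue_on S)) \<longlonglongrightarrow> 0"
  proof (rule Lim_null_comparison[OF always_eventually lim0], rule allI)
    fix n
    have i: "integrable (lebesgue_on S) (\<lambda>x. prod (f n x) (g n x))"
      "integrable (lebesgue_on S) (\<lambda>x. prod (f' x) (g' x))"
      "integrable (lebesgue_on S) (\<lambda>x. prod (f n x - f' x) (g n x - g' x))"
      "integrable (lebesgue_on S) (\<lambda>x. prod (f n x - f' x) (g' x))"
      "integrable (lebesgue_on S) (\<lambda>x. prod (f' x) (g n x - g' x))"
      by (intro Lp_2_bilinear_integrable[OF prod] L Ld)+
    have "(\<integral>x. prod (f n x) (g n x) \<partial>lebesgue_on S) - (\<integral>x. prod (f' x) (g' x) \<partial>lebesgue_on S)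
      = (\<integral>x. prod (f n x) (g n x) - prod (f' x) (g' x) \<partial>lebesgue_on S)"
      using i by simp
    also have "\<dots> = (\<integral>x. prod (f n x - f' x) (g n x - g' x) + prod (f n x - f' x) (g' x)
          + prod (f' x) (g n x - g' x) \<partial>lebesgue_on S)"
      by (intro Bochner_Integration.integral_cong) (auto simp: diff_left diff_right)
    also have "\<dots> = (\<integral>x. prod (f n x - f' x) (g n x - g' x) \<partial>lebesgue_on S)
        + (\<integral>x. prod (f n x - f' x) (g' x) \<partial>lebesgue_on S)
        + (\<integral>x. prod (f' x) (g n x - g' x) \<partial>lebesgue_on S)"
      using i by simp
    finally have "norm ((\<integral>x. prod (f n x) (g n x) \<partial>lebesgue_on S) - (\<integral>x. prod (f' x) (g' x) \<partial>lebesgue_on S))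
       \<le> norm (\<integral>x. prod (f n x - f' x) (g n x - g' x) \<partial>lebesgue_on S)
        + norm (\<integral>x. prod (f n x - f' x) (g' x) \<partial>lebesgue_on S)
        + norm (\<integral>x. prod (f' x) (g n x - g' x) \<partial>lebesgue_on S)"
      by (simp only:) (intro norm_triangle_le add_mono norm_triangle_ineq order_refl)
    then show "norm ((\<integral>x. prod (f n x) (g n x) \<partial>lebesgue_on S) - (\<integral>x. prod (f' x) (g' x) \<partial>lebesgue_on S))
      \<le> B * (sqrt (F n) * sqrt (G n)) + B * (sqrt (F n) * sqrt b) + B * (sqrt a * sqrt (G n))"
      using est[OF Ld(1) Ld(2), of n n] est[OF Ld(1) L(4), of n] est[OF L(2) Ld(2), of n]
      unfolding F_def G_def a_def b_def by linarith
  qed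
  then show ?thesis by (simp only: LIM_zero_iff)
qed

section \<open>Weak gradients\<close>

lemma integrable_lebesgue_on_subset:
  fixes f :: "'a::euclidean_space \<Rightarrow> 'b::euclidean_space"
  assumes "integrable (lebesgue_on S) f" "T \<subseteq> S" "S \<in> sets lebesgue" "T \<in> sets lebesgue"
  shows "integrable (lebesgue_on T) f"
proof -
  have "integrable lebesgue (\<lambda>x. if x \<in> S then f x else 0)"
    using assms(1,3) by (simp only: Lebesgue_Measure.integrable_restrict_UNIV)
  from integrable_mult_indicator[OF assms(4) this]
  have "integrable lebesgue (\<lambda>x. indicator T x *\<^sub>R (if x \<in> S then f x else 0))" .
  moreover have "(\<lambda>x. indicator T x *\<^sub>R (if x \<in> S then f x else 0)) = (\<lambda>x. if x \<in> T then f x else 0)"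
    using assms(2) by (auto simp: indicator_def fun_eq_iff)
  ultimately show ?thesis
    using assms(4) by (simp only: Lebesgue_Measure.integrable_restrict_UNIV)
qed

lemma compact_sets_lebesgue: "compact K \<Longrightarrow> K \<in> sets lebesgue"
  by (auto simp: borel_closed compact_imp_closed)

lemma integrable_imp_Lp_loc_1:
  assumes "integrable (lebesgue_on \<Omega>) f" "\<Omega> \<in> sets lebesgue"
  shows "f \<in> Lp_loc 1 \<Omega>"
  unfolding Lp_loc_def Lp_1_iff
  using integrable_lebesgue_on_subset[OF assms(1) _ assms(2) compact_sets_lebesgue] by blast

lemma Lp_loc_1_add: "f \<in> Lp_loc 1 \<Omega> \<Longrightarrow> g \<in> Lp_loc 1 \<Omega> \<Longrightarrow> (\<lambda>x. f x + g x) \<in> Lp_loc 1 \<Omega>"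
  unfolding Lp_loc_def Lp_1_iff by (auto intro: Bochner_Integration.integrable_add)

lemma Lp_loc_1_scaleR: "f \<in> Lp_loc 1 \<Omega> \<Longrightarrow> (\<lambda>x. c *\<^sub>R f x) \<in> Lp_loc 1 \<Omega>"
  unfolding Lp_loc_def Lp_1_iff by auto

lemma Lp_loc_1_diff: "f \<in> Lp_loc 1 \<Omega> \<Longrightarrow> g \<in> Lp_loc 1 \<Omega> \<Longrightarrow> (\<lambda>x. f x - g x) \<in> Lp_loc 1 \<Omega>"
  unfolding Lp_loc_def Lp_1_iff by (auto intro: Bochner_Integration.integrable_diff)

lemma AE_lebesgue_on_subset:
  assumes "AE x in lebesgue_on S. P x" "T \<subseteq> S" "S \<in> sets lebesgue" "T \<in> sets lebesgue"
  shows "AE x in lebesgue_on T. P x"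
proof -
  have "AE x in lebesgue. x \<in> S \<longrightarrow> P x"
    using assms(1,3) by (subst (asm) AE_restrict_space_iff) auto
  then have "AE x in lebesgue. x \<in> T \<longrightarrow> P x"
    by eventually_elim (use assms(2) in blast)
  then show ?thesis
    using assms(4) by (subst AE_restrict_space_iff) auto
qed

lemma Lp_loc_1_AE_eq:
  fixes f g :: "real^'n \<Rightarrow> 'b::euclidean_space"
  assumes f: "f \<in> Lp_loc 1 \<Omega>" and ae: "AE x in lebesgue_on \<Omega>. f x = g x" and \<Omega>: "\<Omega> \<in> sets lebesgue"
  shows "g \<in> Lp_loc 1 \<Omega>"
  unfolding Lp_loc_def Lp_1_iff
proof (intro CollectI allI impI)
  fix K assume K: "compact K \<and> K \<subseteq> \<Omega>"
  have Ks: "K \<in> sets lebesgue" using K compact_sets_lebesgue by blast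
  have ae': "AE x in lebesgue_on K. f x = g x"
    using AE_lebesgue_on_subset[OF ae _ \<Omega> Ks] K by blast
  have fi: "integrable (lebesgue_on K) f" using f K unfolding Lp_loc_def Lp_1_iff by blast
  have "g \<in> borel_measurable (lebesgue_on K)"
    by (rule borel_measurable_AE_eq[OF Ks borel_measurable_integrable[OF fi] ae'])
  then show "integrable (lebesgue_on K) g"
    using integrable_cong_AE[OF borel_measurable_integrable[OF fi] _ ae'] fi by blast
qed

lemma integral_AE_eq:
  fixes f g :: "'a::euclidean_space \<Rightarrow> 'b::euclidean_space"
  assumes \<Omega>: "\<Omega> \<in> sets lebesgue" and f: "integrable (lebesgue_on \<Omega>) f"
    and ae: "AE x in lebesgue_on \<Omega>. f x = g x"
  shows "integral\<^sup>L (lebesgue_on \<Omega>) f = integral\<^sup>L (lebesgue_on \<Omega>) g"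
  using integral_cong_AE[OF borel_measurable_integrable[OF f]
      borel_measurable_AE_eq[OF \<Omega> borel_measurable_integrable[OF f] ae] ae] .

lemma weak_gradientD:
  assumes "weak_gradient \<Omega> u G"
  shows "u \<in> Lp_loc 1 \<Omega>" "G \<in> Lp_loc 1 \<Omega>"
    "\<phi> \<in> test_fun \<Omega> \<Longrightarrow> (\<integral>x. u x *\<^sub>R grad \<phi> x \<partial>lebesgue_on \<Omega>) = - (\<integral>x. \<phi> x *\<^sub>R G x \<partial>lebesgue_on \<Omega>)"
  using assms unfolding weak_gradient_def by blast+

lemma weak_gradient_AE_eq:
  assumes w: "weak_gradient \<Omega> u G" and "open \<Omega>"
    and u: "AE x in lebesgue_on \<Omega>. u x = u' x" and G: "AE x in lebesgue_on \<Omega>. G x = G' x"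
  shows "weak_gradient \<Omega> u' G'"
  unfolding weak_gradient_def
proof (intro conjI ballI)
  have \<Omega>: "\<Omega> \<in> sets lebesgue" using \<open>open \<Omega>\<close> by auto
  show "u' \<in> Lp_loc 1 \<Omega>" "G' \<in> Lp_loc 1 \<Omega>"
    using Lp_loc_1_AE_eq[OF weak_gradientD(1)[OF w] u \<Omega>] Lp_loc_1_AE_eq[OF weak_gradientD(2)[OF w] G \<Omega>] .
  fix \<phi> assume \<phi>: "\<phi> \<in> test_fun \<Omega>"
  have "(\<integral>x. u x *\<^sub>R grad \<phi> x \<partial>lebesgue_on \<Omega>) = (\<integral>x. u' x *\<^sub>R grad \<phi> x \<partial>lebesgue_on \<Omega>)"
    by (rule integral_AE_eq[OF \<Omega> Lp_loc_1_integrable_grad[OF weak_gradientD(1)[OF w] \<open>open \<Omega>\<close> \<phi>]])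
       (use u in eventually_elim, simp)
  moreover have "(\<integral>x. \<phi> x *\<^sub>R G x \<partial>lebesgue_on \<Omega>) = (\<integral>x. \<phi> x *\<^sub>R G' x \<partial>lebesgue_on \<Omega>)"
    by (rule integral_AE_eq[OF \<Omega> Lp_loc_1_integrable_test_fun[OF weak_gradientD(2)[OF w] \<open>open \<Omega>\<close> \<phi>]])
       (use G in eventually_elim, simp)
  ultimately show "(\<integral>x. u' x *\<^sub>R grad \<phi> x \<partial>lebesgue_on \<Omega>) = - (\<integral>x. \<phi> x *\<^sub>R G' x \<partial>lebesgue_on \<Omega>)"
    using weak_gradientD(3)[OF w \<phi>] by simp
qed

text \<open>
The difference of two weak gradients is orthogonal to all test functions.
\<close>

lemma weak_gradient_unique:
  assumes "open \<Omega>" and 1: "weak_gradient \<Omega> u G" and 2: "weak_gradient \<Omega> u G'"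
  shows "AE x in lebesgue_on \<Omega>. G x = G' x"
proof -
  have "AE x in lebesgue_on \<Omega>. G x - G' x = 0"
  proof (rule fundamental_lemma[OF Lp_loc_1_diff[OF weak_gradientD(2)[OF 1] weak_gradientD(2)[OF 2]] \<open>open \<Omega>\<close>])
    fix \<phi> assume \<phi>: "\<phi> \<in> test_fun \<Omega>"
    have "(\<integral>x. \<phi> x *\<^sub>R (G x - G' x) \<partial>lebesgue_on \<Omega>)
        = (\<integral>x. \<phi> x *\<^sub>R G x \<partial>lebesgue_on \<Omega>) - (\<integral>x. \<phi> x *\<^sub>R G' x \<partial>lebesgue_on \<Omega>)"
      unfolding scaleR_diff_right
      by (intro Bochner_Integration.integral_diff Lp_loc_1_integrable_test_fun \<phi> \<open>open \<Omega>\<close>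
          weak_gradientD(2)[OF 1] weak_gradientD(2)[OF 2])
    then show "(\<integral>x. \<phi> x *\<^sub>R (G x - G' x) \<partial>lebesgue_on \<Omega>) = 0"
      using weak_gradientD(3)[OF 1 \<phi>] weak_gradientD(3)[OF 2 \<phi>] by simp
  qed
  then show ?thesis by eventually_elim simp
qed

lemma weak_gradient_wgrad: "weak_gradient \<Omega> u G \<Longrightarrow> weak_gradient \<Omega> u (wgrad \<Omega> u)"
  unfolding wgrad_def by (rule someI[of "weak_gradient \<Omega> u"])

lemma wgrad_AE_eq:
  assumes "open \<Omega>" "weak_gradient \<Omega> u G"
  shows "AE x in lebesgue_on \<Omega>. wgrad \<Omega> u x = G x"
  by (rule weak_gradient_unique[OF assms(1) weak_gradient_wgrad[OF assms(2)] assms(2)])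

lemma weak_gradient_add:
  assumes "open \<Omega>" and 1: "weak_gradient \<Omega> u G" and 2: "weak_gradient \<Omega> v H"
  shows "weak_gradient \<Omega> (\<lambda>x. u x + v x) (\<lambda>x. G x + H x)"
  unfolding weak_gradient_def
proof (intro conjI ballI Lp_loc_1_add weak_gradientD(1)[OF 1] weak_gradientD(1)[OF 2]
    weak_gradientD(2)[OF 1] weak_gradientD(2)[OF 2])
  fix \<phi> assume \<phi>: "\<phi> \<in> test_fun \<Omega>"
  note i = Lp_loc_1_integrable_test_fun[OF weak_gradientD(2)[OF 1] \<open>open \<Omega>\<close> \<phi>]
    Lp_loc_1_integrable_test_fun[OF weak_gradientD(2)[OF 2] \<open>open \<Omega>\<close> \<phi>]
    Lp_loc_1_integrable_grad[OF weak_gradientD(1)[OF 1] \<open>open \<Omega>\<close> \<phi>]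
    Lp_loc_1_integrable_grad[OF weak_gradientD(1)[OF 2] \<open>open \<Omega>\<close> \<phi>]
  show "(\<integral>x. (u x + v x) *\<^sub>R grad \<phi> x \<partial>lebesgue_on \<Omega>) = - (\<integral>x. \<phi> x *\<^sub>R (G x + H x) \<partial>lebesgue_on \<Omega>)"
    unfolding scaleR_add_left scaleR_add_right
      Bochner_Integration.integral_add[OF i(1) i(2)] Bochner_Integration.integral_add[OF i(3) i(4)]
      weak_gradientD(3)[OF 1 \<phi>] weak_gradientD(3)[OF 2 \<phi>] by simp
qed

lemma weak_gradient_scale:
  assumes 1: "weak_gradient \<Omega> u G"
  shows "weak_gradient \<Omega> (\<lambda>x. c * u x) (\<lambda>x. c *\<^sub>R G x)"
  unfolding weak_gradient_def
proof (intro conjI ballI)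
  show "(\<lambda>x. c * u x) \<in> Lp_loc 1 \<Omega>"
    using Lp_loc_1_scaleR[OF weak_gradientD(1)[OF 1], of c] by simp
  show "(\<lambda>x. c *\<^sub>R G x) \<in> Lp_loc 1 \<Omega>"
    by (rule Lp_loc_1_scaleR[OF weak_gradientD(2)[OF 1]])
  fix \<phi> assume \<phi>: "\<phi> \<in> test_fun \<Omega>"
  have "(\<integral>x. (c * u x) *\<^sub>R grad \<phi> x \<partial>lebesgue_on \<Omega>) = c *\<^sub>R (\<integral>x. u x *\<^sub>R grad \<phi> x \<partial>lebesgue_on \<Omega>)"
    unfolding scaleR_scaleR[symmetric] by (rule integral_scaleR_right)
  moreover have "(\<integral>x. \<phi> x *\<^sub>R c *\<^sub>R G x \<partial>lebesgue_on \<Omega>) = c *\<^sub>R (\<integral>x. \<phi> x *\<^sub>R G x \<partial>lebesgue_on \<Omega>)"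
    unfolding scaleR_left_commute[of "\<phi> _" c] by (rule integral_scaleR_right)
  ultimately show "(\<integral>x. (c * u x) *\<^sub>R grad \<phi> x \<partial>lebesgue_on \<Omega>) = - (\<integral>x. \<phi> x *\<^sub>R c *\<^sub>R G x \<partial>lebesgue_on \<Omega>)"
    using weak_gradientD(3)[OF 1 \<phi>] by simp
qed

lemma weak_gradient_diff:
  assumes "open \<Omega>" "weak_gradient \<Omega> u G" "weak_gradient \<Omega> v H"
  shows "weak_gradient \<Omega> (\<lambda>x. u x - v x) (\<lambda>x. G x - H x)"
  using weak_gradient_add[OF assms(1,2) weak_gradient_scale[OF assms(3), of "-1"]] by simp

text \<open>
If \<open>\<phi>\<close> is a test function then so is \<open>\<eta> \<phi>\<close>, and testing the definition of \<open>G\<close> with it is the product rule.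
\<close>

lemma weak_gradient_test_fun_mult:
  assumes "open \<Omega>" and 1: "weak_gradient \<Omega> u G" and \<eta>: "\<eta> \<in> test_fun \<Omega>"
  shows "weak_gradient \<Omega> (\<lambda>x. \<eta> x * u x) (\<lambda>x. \<eta> x *\<^sub>R G x + u x *\<^sub>R grad \<eta> x)"
  unfolding weak_gradient_def
proof (intro conjI ballI)
  have \<Omega>: "\<Omega> \<in> sets lebesgue" using \<open>open \<Omega>\<close> by auto
  show "(\<lambda>x. \<eta> x * u x) \<in> Lp_loc 1 \<Omega>"
    using integrable_imp_Lp_loc_1[OF Lp_loc_1_integrable_test_fun[OF weak_gradientD(1)[OF 1] \<open>open \<Omega>\<close> \<eta>] \<Omega>]
    by simp
  show "(\<lambda>x. \<eta> x *\<^sub>R G x + u x *\<^sub>R grad \<eta> x) \<in> Lp_loc 1 \<Omega>"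
    by (intro integrable_imp_Lp_loc_1[OF _ \<Omega>] Bochner_Integration.integrable_add
        Lp_loc_1_integrable_test_fun[OF weak_gradientD(2)[OF 1] \<open>open \<Omega>\<close> \<eta>]
        Lp_loc_1_integrable_grad[OF weak_gradientD(1)[OF 1] \<open>open \<Omega>\<close> \<eta>])
  fix \<phi> assume \<phi>: "\<phi> \<in> test_fun \<Omega>"
  have \<eta>\<phi>: "(\<lambda>x. \<eta> x * \<phi> x) \<in> test_fun \<Omega>" by (rule test_fun_mult[OF \<eta> \<phi>])
  have i1: "integrable (lebesgue_on \<Omega>) (\<lambda>x. u x *\<^sub>R (\<phi> x *\<^sub>R grad \<eta> x))"
  proof -
    obtain K where K: "compact K" "K \<subseteq> \<Omega>" "\<And>x. x \<notin> K \<Longrightarrow> \<phi> x = 0"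
      using test_fun_support[OF \<phi>] by metis
    show ?thesis
      by (rule Lp_loc_1_integrable[OF bounded_bilinear_scaleR weak_gradientD(1)[OF 1] \<open>open \<Omega>\<close> _ K(1,2)])
         (simp_all add: K(3) continuous_on_scaleR[OF continuous_on_test_fun[OF \<phi>] continuous_on_grad_test_fun[OF \<eta>]])
  qed
  note i2 = Lp_loc_1_integrable_grad[OF weak_gradientD(1)[OF 1] \<open>open \<Omega>\<close> \<eta>\<phi>]
  note i3 = Lp_loc_1_integrable_test_fun[OF weak_gradientD(2)[OF 1] \<open>open \<Omega>\<close> \<eta>\<phi>]
  have "(\<integral>x. (\<eta> x * u x) *\<^sub>R grad \<phi> x \<partial>lebesgue_on \<Omega>)
      = (\<integral>x. u x *\<^sub>R grad (\<lambda>x. \<eta> x * \<phi> x) x - u x *\<^sub>R (\<phi> x *\<^sub>R grad \<eta> x) \<partial>lebesgue_on \<Omega>)"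
    by (intro Bochner_Integration.integral_cong) (auto simp: grad_mult[OF \<eta> \<phi>] algebra_simps)
  also have "\<dots> = - (\<integral>x. (\<eta> x * \<phi> x) *\<^sub>R G x \<partial>lebesgue_on \<Omega>) - (\<integral>x. u x *\<^sub>R (\<phi> x *\<^sub>R grad \<eta> x) \<partial>lebesgue_on \<Omega>)"
    unfolding Bochner_Integration.integral_diff[OF i2 i1] weak_gradientD(3)[OF 1 \<eta>\<phi>] ..
  also have "\<dots> = - (\<integral>x. (\<eta> x * \<phi> x) *\<^sub>R G x + u x *\<^sub>R (\<phi> x *\<^sub>R grad \<eta> x) \<partial>lebesgue_on \<Omega>)"
    unfolding Bochner_Integration.integral_add[OF i3 i1] by simp
  also have "\<dots> = - (\<integral>x. \<phi> x *\<^sub>R (\<eta> x *\<^sub>R G x + u x *\<^sub>R grad \<eta> x) \<partial>lebesgue_on \<Omega>)"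
    by (intro arg_cong[where f=uminus] Bochner_Integration.integral_cong) (auto simp: algebra_simps)
  finally show "(\<integral>x. (\<eta> x * u x) *\<^sub>R grad \<phi> x \<partial>lebesgue_on \<Omega>)
      = - (\<integral>x. \<phi> x *\<^sub>R (\<eta> x *\<^sub>R G x + u x *\<^sub>R grad \<eta> x) \<partial>lebesgue_on \<Omega>)" .
qed

section \<open>Integration by parts\<close>

text \<open>
By translation invariance the integral of every difference quotient of \<open>g\<close> is zero; the quotients are
bounded and supported in a fixed ball, so the integral of their limit is zero as well.
\<close>

lemma integral_partial_derivative_eq_0:
  fixes g :: "real^'n \<Rightarrow> real"
  assumes d: "\<And>x. g differentiable (at x)" and c: "continuous_on UNIV (grad g)"
    and K: "compact K" "\<And>x. x \<notin> K \<Longrightarrow> g x = 0" "\<And>x. x \<notin> K \<Longrightarrow> grad g x = 0"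
    and e: "norm e = 1"
  shows "(\<integral>x. grad g x \<bullet> e \<partial>lborel) = 0"
proof -
  obtain C where C: "C > 0" "\<And>x. norm (grad g x) \<le> C"
    using bounded_range_of_compact_support[OF c K(1,3)] by blast
  obtain R where R: "K \<subseteq> cball 0 R"
    using compact_imp_bounded[OF K(1)] by (auto simp: bounded_iff subset_iff)
  have gc: "continuous_on UNIV g"
    using d by (auto intro!: continuous_at_imp_continuous_on differentiable_imp_continuous_within)
  then have [measurable]: "g \<in> borel_measurable borel" by (rule borel_measurable_continuous_onI)
  have [measurable]: "grad g \<in> borel_measurable borel" using c by (rule borel_measurable_continuous_onI)
  have gi: "integrable lborel g"
  proof -
    obtain C' where "C' > 0" "\<And>x. norm (g x) \<le> C'"
      using bounded_range_of_compact_support[OF gc K(1,2)] by blast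
    then show ?thesis
      using K(1,2) by (intro integrableI_bounded_set[of K _ _ C'])
        (auto simp: borel_closed compact_imp_closed intro!: emeasure_bounded_finite[unfolded infinity_ennreal_def] compact_imp_bounded)
  qed
  define t where "t = (\<lambda>n. inverse (real (Suc n)))"
  have t: "0 < t n" "t n \<le> 1" "t n \<noteq> 0" for n by (auto simp: t_def divide_simps)
  have t0: "t \<longlonglongrightarrow> 0" unfolding t_def by (rule LIMSEQ_inverse_real_of_nat)
  define q where "q = (\<lambda>n x. (g (t n *\<^sub>R e + x) - g x) / t n)"
  have int0: "(\<integral>x. q n x \<partial>lborel) = 0" for n
  proof -
    have "(\<integral>x. g (t n *\<^sub>R e + x) \<partial>lborel) = (\<integral>x. g x \<partial>distr lborel borel ((+) (t n *\<^sub>R e)))"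
      by (subst integral_distr) auto
    also have "\<dots> = (\<integral>x. g x \<partial>lborel)" by (simp only: lborel_distr_plus)
    finally have eq: "(\<integral>x. g (t n *\<^sub>R e + x) \<partial>lborel) = (\<integral>x. g x \<partial>lborel)" .
    have "integrable (distr lborel borel ((+) (t n *\<^sub>R e))) g"
      using gi by (simp only: lborel_distr_plus)
    then have "integrable lborel (\<lambda>x. g (t n *\<^sub>R e + x))"
      by (subst (asm) integrable_distr_eq) auto
    then have "(\<integral>x. g (t n *\<^sub>R e + x) - g x \<partial>lborel) = 0"
      using eq gi by simp
    then show ?thesis unfolding q_def by simp
  qed
  have "(\<lambda>n. \<integral>x. q n x \<partial>lborel) \<longlonglongrightarrow> (\<integral>x. grad g x \<bullet> e \<partial>lborel)"
  proof (rule integral_dominated_convergence[where w="\<lambda>x. indicator (cball 0 (R + 1)) x *\<^sub>R C"])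
    show "integrable lborel (\<lambda>x. indicator (cball 0 (R + 1)) x *\<^sub>R C)"
      using C(1) by (intro integrableI_bounded_set_indicator[where B=C]) (auto intro!: emeasure_bounded_finite[unfolded infinity_ennreal_def])
    show "AE x in lborel. norm (q n x) \<le> indicator (cball 0 (R + 1)) x *\<^sub>R C" for n
    proof (rule AE_I2)
      fix x
      show "norm (q n x) \<le> indicator (cball 0 (R + 1)) x *\<^sub>R C"
      proof (cases "x \<in> cball 0 (R + 1)")
        case True
        have "norm (g (t n *\<^sub>R e + x) - g x) \<le> C * norm (t n *\<^sub>R e + x - x)"
        proof (rule differentiable_bound[OF convex_UNIV])
          show "(g has_derivative (\<lambda>h. grad g y \<bullet> h)) (at y within UNIV)" for y
            using has_derivative_grad[OF d] by simp
          show "onorm (\<lambda>h. grad g y \<bullet> h) \<le> C" for y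
          proof (rule onorm_le)
            fix h
            have "norm (grad g y \<bullet> h) \<le> norm (grad g y) * norm h"
              by (simp add: Cauchy_Schwarz_ineq2)
            also have "\<dots> \<le> C * norm h" by (intro mult_right_mono C) simp
            finally show "norm (grad g y \<bullet> h) \<le> C * norm h" .
          qed
        qed auto
        then have "norm (g (t n *\<^sub>R e + x) - g x) \<le> C * t n" using e t(1)[of n] by simp
        then have "norm (q n x) \<le> C" using t(1)[of n] by (simp add: q_def divide_simps abs_divide)
        then show ?thesis using True by simp
      next
        case False
        then have 1: "norm x > R + 1" by simp
        have "norm x \<le> norm (t n *\<^sub>R e + x) + norm (t n *\<^sub>R e)"
          using norm_triangle_ineq4[of "t n *\<^sub>R e + x" "t n *\<^sub>R e"] by simp
        then have "norm (t n *\<^sub>R e + x) > R" using 1 e t(1,2)[of n] by simp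
        then have "x \<notin> K" "t n *\<^sub>R e + x \<notin> K" using R 1 by (auto simp: subset_iff)
        then have "q n x = 0" by (simp add: q_def K(2))
        then show ?thesis using C(1) by simp
      qed
    qed
    show "AE x in lborel. (\<lambda>n. q n x) \<longlonglongrightarrow> grad g x \<bullet> e"
    proof (rule AE_I2)
      fix x
      have "((\<lambda>s. g (s *\<^sub>R e + x)) has_derivative (\<lambda>s. grad g x \<bullet> (s *\<^sub>R e))) (at 0)"
      proof (rule has_derivative_compose[of "\<lambda>s. s *\<^sub>R e + x" "\<lambda>s. s *\<^sub>R e" 0 UNIV g])
        show "((\<lambda>s. s *\<^sub>R e + x) has_derivative (\<lambda>s. s *\<^sub>R e)) (at 0)"
          by (auto intro!: derivative_eq_intros)
        show "(g has_derivative (\<bullet>) (grad g x)) (at (0 *\<^sub>R e + x))"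
          using has_derivative_grad[OF d[of x]] by simp
      qed
      then have "((\<lambda>s. g (s *\<^sub>R e + x)) has_real_derivative (grad g x \<bullet> e)) (at 0)"
        by (simp add: has_field_derivative_def mult.commute[of _ "grad g x \<bullet> e"])
      then have "((\<lambda>s. (g (s *\<^sub>R e + x) - g x) / s) \<longlongrightarrow> grad g x \<bullet> e) (at 0)"
        by (simp add: has_field_derivative_iff)
      moreover have "filterlim t (at 0) sequentially"
        using t0 t(3) by (simp add: filterlim_at)
      ultimately show "(\<lambda>n. q n x) \<longlonglongrightarrow> grad g x \<bullet> e"
        unfolding q_def by (rule filterlim_compose)
    qed
  qed (auto simp: q_def)
  then show ?thesis by (simp add: int0 LIMSEQ_const_iff)
qed

lemma integral_grad_eq_0:
  fixes g :: "real^'n \<Rightarrow> real"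
  assumes d: "\<And>x. g differentiable (at x)" and c: "continuous_on UNIV (grad g)"
    and K: "compact K" "K \<subseteq> \<Omega>" "\<And>x. x \<notin> K \<Longrightarrow> g x = 0" "\<And>x. x \<notin> K \<Longrightarrow> grad g x = 0"
    and \<Omega>: "\<Omega> \<in> sets lebesgue"
  shows "(\<integral>x. grad g x \<partial>lebesgue_on \<Omega>) = 0"
proof -
  have [measurable]: "grad g \<in> borel_measurable borel" using c by (rule borel_measurable_continuous_onI)
  obtain C where C: "C > 0" "\<And>x. norm (grad g x) \<le> C"
    using bounded_range_of_compact_support[OF c K(1,4)] by blast
  have i: "integrable lborel (grad g)"
    using C K(1,4) by (intro integrableI_bounded_set[of K _ _ C])
        (auto simp: borel_closed compact_imp_closed intro!: emeasure_bounded_finite[unfolded infinity_ennreal_def] compact_imp_bounded)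
  have "(\<integral>x. grad g x \<partial>lborel) = 0"
  proof (rule euclidean_eqI)
    fix e :: "real^'n" assume e: "e \<in> Basis"
    have "(\<integral>x. grad g x \<partial>lborel) \<bullet> e = (\<integral>x. grad g x \<bullet> e \<partial>lborel)"
      using i by simp
    also have "\<dots> = 0"
      by (rule integral_partial_derivative_eq_0[OF d c K(1,3,4)]) (use e in auto)
    finally show "(\<integral>x. grad g x \<partial>lborel) \<bullet> e = 0 \<bullet> e" by simp
  qed
  then have "(\<integral>x. grad g x \<partial>lebesgue) = 0" by (subst integral_completion) auto
  moreover have "(\<integral>x. grad g x \<partial>lebesgue_on \<Omega>) = (\<integral>x. grad g x \<partial>lebesgue)"
  proof -
    have "indicator \<Omega> x *\<^sub>R grad g x = grad g x" for x
      using K(2,4) by (cases "x \<in> K") (auto simp: indicator_def)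
    then show ?thesis using \<Omega> by (subst integral_restrict_space) auto
  qed
  ultimately show ?thesis by simp
qed

lemma integral_by_parts_compose:
  fixes \<phi> \<eta> :: "real^'n \<Rightarrow> real"
  assumes S: "\<And>s. (S has_real_derivative S' s) (at s)" and S': "continuous_on UNIV S'"
    and \<phi>: "\<phi> \<in> test_fun \<Omega>" and \<eta>: "\<eta> \<in> test_fun \<Omega>" and "open \<Omega>"
  shows "(\<integral>x. S (\<phi> x) *\<^sub>R grad \<eta> x \<partial>lebesgue_on \<Omega>) = - (\<integral>x. (S' (\<phi> x) * \<eta> x) *\<^sub>R grad \<phi> x \<partial>lebesgue_on \<Omega>)"
proof -
  have \<Omega>: "\<Omega> \<in> sets lebesgue" using \<open>open \<Omega>\<close> by auto
  obtain K where K: "compact K" "K \<subseteq> \<Omega>" "\<And>x. x \<notin> K \<Longrightarrow> \<eta> x = 0" "\<And>x. x \<notin> K \<Longrightarrow> grad \<eta> x = 0"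
    using test_fun_support[OF \<eta>] by metis
  have Sc: "continuous_on UNIV S"
    using S DERIV_isCont by (blast intro: continuous_at_imp_continuous_on)
  have d\<phi>: "((\<lambda>x. S (\<phi> x)) has_derivative (\<lambda>h. (S' (\<phi> x) *\<^sub>R grad \<phi> x) \<bullet> h)) (at x)" for x
    using has_derivative_compose[OF has_derivative_grad[OF test_fun_differentiable[OF \<phi>, of x]],
        of S "(*) (S' (\<phi> x))"] S[of "\<phi> x"]
    by (simp add: has_field_derivative_def)
  have dS: "(\<lambda>x. S (\<phi> x)) differentiable (at x)" for x
    using d\<phi> unfolding differentiable_def by blast
  have gS: "grad (\<lambda>x. S (\<phi> x)) x = S' (\<phi> x) *\<^sub>R grad \<phi> x" for x
    by (rule grad_eq_gradI[OF d\<phi>])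
  define g where "g = (\<lambda>x. S (\<phi> x) * \<eta> x)"
  have gg: "grad g x = S (\<phi> x) *\<^sub>R grad \<eta> x + (S' (\<phi> x) * \<eta> x) *\<^sub>R grad \<phi> x" for x
    unfolding g_def grad_mult_differentiable[OF dS test_fun_differentiable[OF \<eta>]] gS by (simp add: mult.commute)
  note c = continuous_on_compose2[OF Sc continuous_on_test_fun[OF \<phi>] subset_UNIV]
    continuous_on_compose2[OF S' continuous_on_test_fun[OF \<phi>] subset_UNIV]
    continuous_on_test_fun[OF \<phi>] continuous_on_test_fun[OF \<eta>]
    continuous_on_grad_test_fun[OF \<phi>] continuous_on_grad_test_fun[OF \<eta>]
  have int: "integrable (lebesgue_on \<Omega>) h"
    if h: "continuous_on UNIV h" "\<And>x. x \<notin> K \<Longrightarrow> h x = 0" for h :: "real^'n \<Rightarrow> real^'n"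
  proof -
    have "(\<lambda>x::real^'n. 1::real) \<in> Lp_loc 1 \<Omega>"
      unfolding Lp_loc_def Lp_1_iff
      using lmeasurable_compact finite_measure.integrable_const[OF finite_measure_lebesgue_on] by blast
    from Lp_loc_1_integrable[OF bounded_bilinear_scaleR this \<open>open \<Omega>\<close> h(1) K(1,2) h(2)]
    show ?thesis by simp
  qed
  have i1: "integrable (lebesgue_on \<Omega>) (\<lambda>x. S (\<phi> x) *\<^sub>R grad \<eta> x)"
    by (rule int) (intro continuous_on_scaleR c, simp add: K(4))
  have i2: "integrable (lebesgue_on \<Omega>) (\<lambda>x. (S' (\<phi> x) * \<eta> x) *\<^sub>R grad \<phi> x)"
    by (rule int) (intro continuous_on_scaleR continuous_on_mult c, simp add: K(3))
  have "(\<integral>x. grad g x \<partial>lebesgue_on \<Omega>) = 0"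
  proof (rule integral_grad_eq_0[OF _ _ K(1,2) _ _ \<Omega>])
    show "g differentiable (at x)" for x
      unfolding g_def by (intro differentiable_mult dS test_fun_differentiable[OF \<eta>])
    show "continuous_on UNIV (grad g)"
      unfolding gg[abs_def] by (intro continuous_on_add continuous_on_scaleR continuous_on_mult c)
    show "g x = 0" if "x \<notin> K" for x
      unfolding g_def using K(3)[OF that] by simp
    show "grad g x = 0" if "x \<notin> K" for x
      unfolding gg using K(3,4)[OF that] by simp
  qed
  then show ?thesis
    unfolding gg Bochner_Integration.integral_add[OF i1 i2] by (simp add: eq_neg_iff_add_eq_0)
qed

section \<open>Limits of test functions\<close>

lemma Lp_2_bounded:
  fixes f :: "real^'n \<Rightarrow> 'b::euclidean_space"
  assumes "\<Omega> \<in> lmeasurable" "f \<in> borel_measurable (lebesgue_on \<Omega>)" "AE x in lebesgue_on \<Omega>. norm (f x) \<le> C"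
  shows "f \<in> Lp 2 \<Omega>"
proof -
  interpret finite_measure "lebesgue_on \<Omega>" by (rule finite_measure_lebesgue_on[OF assms(1)])
  have "(\<lambda>x. 1::real) \<in> Lp 2 \<Omega>" unfolding Lp_2_iff by simp
  from Lp_2_bilinear_bounded[OF bounded_bilinear_scaleR this assms(2,3)]
  show ?thesis by simp
qed

lemma Lp_2_integrable:
  fixes f :: "real^'n \<Rightarrow> 'b::euclidean_space"
  assumes "\<Omega> \<in> lmeasurable" "f \<in> Lp 2 \<Omega>"
  shows "integrable (lebesgue_on \<Omega>) f"
proof -
  have "(\<lambda>x::real^'n. 1::real) \<in> Lp 2 \<Omega>"
    by (rule Lp_2_bounded[OF assms(1), of _ 1]) auto
  from Lp_2_bilinear_integrable[OF bounded_bilinear_scaleR this assms(2)]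
  show ?thesis by simp
qed

lemma continuous_measurable_lebesgue_on:
  fixes f :: "'a::euclidean_space \<Rightarrow> 'b::euclidean_space"
  assumes "continuous_on UNIV f" "S \<in> sets lebesgue"
  shows "f \<in> borel_measurable (lebesgue_on S)"
  by (rule continuous_imp_measurable_on_sets_lebesgue[OF continuous_on_subset[OF assms(1)] assms(2)]) simp

lemma continuous_compose_measurable:
  fixes S :: "'b::euclidean_space \<Rightarrow> 'c::euclidean_space"
  assumes "continuous_on UNIV S" "f \<in> borel_measurable M"
  shows "(\<lambda>x. S (f x)) \<in> borel_measurable M"
  using measurable_compose[OF assms(2) borel_measurable_continuous_onI[OF assms(1)]] .

text \<open>
Membership in \<open>H\<^sub>0\<^sup>1\<close> with the gradient as an explicit argument: calculations with gradients then need no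
reference to the representative chosen by \<open>wgrad\<close>.
\<close>

definition H10_limit :: "(real^'n) set \<Rightarrow> (real^'n \<Rightarrow> real) \<Rightarrow> (real^'n \<Rightarrow> real^'n) \<Rightarrow> bool" where
  "H10_limit \<Omega> u G \<longleftrightarrow> (\<exists>\<phi>. (\<forall>n. \<phi> n \<in> test_fun \<Omega>) \<and> L2_tendsto \<Omega> \<phi> u \<and> L2_tendsto \<Omega> (\<lambda>n. grad (\<phi> n)) G)"

lemma H10_limit_Lp_2: "H10_limit \<Omega> u G \<Longrightarrow> u \<in> Lp 2 \<Omega>" "H10_limit \<Omega> u G \<Longrightarrow> G \<in> Lp 2 \<Omega>"
  by (auto simp: H10_limit_def L2_tendsto_def)

locale bounded_domain =
  fixes \<Omega> :: "(real^'n) set"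
  assumes Omega_open: "open \<Omega>" and Omega_bounded: "bounded \<Omega>"
begin

abbreviation \<mu> where "\<mu> \<equiv> lebesgue_on \<Omega>"

lemma Omega_lmeasurable: "\<Omega> \<in> lmeasurable" by (rule lmeasurable_open[OF Omega_bounded Omega_open])
lemma Omega_sets: "\<Omega> \<in> sets lebesgue" using Omega_open by auto

lemma test_fun_measurable: "\<phi> \<in> test_fun \<Omega>' \<Longrightarrow> \<phi> \<in> borel_measurable \<mu>"
  by (rule continuous_measurable_lebesgue_on[OF continuous_on_test_fun Omega_sets])

lemma grad_test_fun_measurable: "\<phi> \<in> test_fun \<Omega>' \<Longrightarrow> grad \<phi> \<in> borel_measurable \<mu>"
  by (rule continuous_measurable_lebesgue_on[OF continuous_on_grad_test_fun Omega_sets])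

lemma test_fun_Lp_2:
  assumes "\<phi> \<in> test_fun \<Omega>"
  shows "\<phi> \<in> Lp 2 \<Omega>" "grad \<phi> \<in> Lp 2 \<Omega>"
proof -
  obtain C where C: "C > 0" "\<And>x. \<bar>\<phi> x\<bar> \<le> C" "\<And>x. norm (grad \<phi> x) \<le> C"
    using test_fun_bounded[OF assms] by blast
  show "\<phi> \<in> Lp 2 \<Omega>"
    by (rule Lp_2_bounded[OF Omega_lmeasurable test_fun_measurable[OF assms], of C]) (simp add: C)
  show "grad \<phi> \<in> Lp 2 \<Omega>"
    by (rule Lp_2_bounded[OF Omega_lmeasurable grad_test_fun_measurable[OF assms], of C]) (simp add: C)
qed

lemma Lp_2_imp_Lp_loc_1: "f \<in> Lp 2 \<Omega> \<Longrightarrow> f \<in> Lp_loc 1 \<Omega>"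
  by (rule integrable_imp_Lp_loc_1[OF Lp_2_integrable[OF Omega_lmeasurable] Omega_sets])

lemma H10_limit_test_fun: "\<phi> \<in> test_fun \<Omega> \<Longrightarrow> H10_limit \<Omega> \<phi> (grad \<phi>)"
  unfolding H10_limit_def
  by (intro exI[of _ "\<lambda>n. \<phi>"] conjI allI L2_tendsto_const test_fun_Lp_2)

lemma H10_imp_H10_limit:
  assumes "u \<in> H10 \<Omega>"
  shows "H10_limit \<Omega> u (wgrad \<Omega> u)"
proof -
  obtain G where G: "weak_gradient \<Omega> u G" "G \<in> Lp 2 \<Omega>" and u: "u \<in> Lp 2 \<Omega>"
    using assms unfolding H10_def H1_def by blast
  obtain \<phi> where \<phi>: "\<And>n::nat. \<phi> n \<in> test_fun \<Omega>"
    and lim: "(\<lambda>n. (\<integral>x. (\<phi> n x - u x)\<^sup>2 \<partial>\<mu>)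
          + (\<integral>x. (norm (grad (\<phi> n) x - wgrad \<Omega> u x))\<^sup>2 \<partial>\<mu>)) \<longlonglongrightarrow> 0"
    using assms unfolding H10_def by blast
  have ae: "AE x in \<mu>. G x = wgrad \<Omega> u x"
    using wgrad_AE_eq[OF Omega_open G(1)] by eventually_elim simp
  have w: "wgrad \<Omega> u \<in> Lp 2 \<Omega>" by (rule Lp_2_AE_eq[OF Omega_sets G(2) ae])
  have 1: "0 \<le> (\<integral>x. (\<phi> n x - u x)\<^sup>2 \<partial>\<mu>)" for n
    by (intro integral_nonneg_AE) simp
  have 2: "0 \<le> (\<integral>x. (norm (grad (\<phi> n) x - wgrad \<Omega> u x))\<^sup>2 \<partial>\<mu>)" for n
    by (intro integral_nonneg_AE) simp
  have l1: "(\<lambda>n. \<integral>x. (\<phi> n x - u x)\<^sup>2 \<partial>\<mu>) \<longlonglongrightarrow> 0"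
    by (rule LIMSEQ_0_le[OF lim]) (use 1 2 in simp_all)
  have l2: "(\<lambda>n. \<integral>x. (norm (grad (\<phi> n) x - wgrad \<Omega> u x))\<^sup>2 \<partial>\<mu>) \<longlonglongrightarrow> 0"
    by (rule LIMSEQ_0_le[OF lim]) (use 1 2 in simp_all)
  have "L2_tendsto \<Omega> \<phi> u"
    unfolding L2_tendsto_def using test_fun_Lp_2(1)[OF \<phi>] u l1 by simp
  moreover have "L2_tendsto \<Omega> (\<lambda>n. grad (\<phi> n)) (wgrad \<Omega> u)"
    unfolding L2_tendsto_def using test_fun_Lp_2(2)[OF \<phi>] w l2 by simp
  ultimately show ?thesis unfolding H10_limit_def using \<phi> by blast
qed

lemma test_fun_by_parts:
  assumes \<phi>: "\<phi> \<in> test_fun \<Omega>" and \<eta>: "\<eta> \<in> test_fun \<Omega>"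
  shows "(\<integral>x. \<phi> x *\<^sub>R grad \<eta> x \<partial>\<mu>) = - (\<integral>x. \<eta> x *\<^sub>R grad \<phi> x \<partial>\<mu>)"
  using integral_by_parts_compose[of "\<lambda>x. x" "\<lambda>x. 1", OF _ _ \<phi> \<eta> Omega_open] by simp

lemma L2_tendsto_mult_test_fun:
  fixes f :: "nat \<Rightarrow> real^'n \<Rightarrow> 'b::euclidean_space"
  assumes f: "L2_tendsto \<Omega> f f'" and \<eta>: "\<eta> \<in> test_fun \<Omega>"
  shows "L2_tendsto \<Omega> (\<lambda>n x. \<eta> x *\<^sub>R f n x) (\<lambda>x. \<eta> x *\<^sub>R f' x)"
proof -
  obtain C where C: "C > 0" "\<And>x. \<bar>\<eta> x\<bar> \<le> C" "\<And>x. norm (grad \<eta> x) \<le> C"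
    using test_fun_bounded[OF \<eta>] by blast
  show ?thesis
    by (rule L2_tendsto_bounded_bilinear[OF bounded_bilinear.flip[OF bounded_bilinear_scaleR] f
          test_fun_measurable[OF \<eta>], of C]) (simp add: C)
qed

lemma Lp_2_mult_test_fun:
  fixes f :: "real^'n \<Rightarrow> 'b::euclidean_space"
  assumes "f \<in> Lp 2 \<Omega>" "\<eta> \<in> test_fun \<Omega>"
  shows "(\<lambda>x. \<eta> x *\<^sub>R f x) \<in> Lp 2 \<Omega>"
  using L2_tendsto_mult_test_fun[OF L2_tendsto_const[OF assms(1)] assms(2)]
  unfolding L2_tendsto_def by blast

lemma L2_tendsto_mult_grad:
  assumes f: "L2_tendsto \<Omega> f f'" and \<eta>: "\<eta> \<in> test_fun \<Omega>"
  shows "L2_tendsto \<Omega> (\<lambda>n x. f n x *\<^sub>R grad \<eta> x) (\<lambda>x. f' x *\<^sub>R grad \<eta> x)"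
proof -
  obtain C where C: "C > 0" "\<And>x. \<bar>\<eta> x\<bar> \<le> C" "\<And>x. norm (grad \<eta> x) \<le> C"
    using test_fun_bounded[OF \<eta>] by blast
  show ?thesis
    by (rule L2_tendsto_bounded_bilinear[OF bounded_bilinear_scaleR f
          grad_test_fun_measurable[OF \<eta>], of C]) (simp add: C)
qed

text \<open>
The product rule holds for the approximating test functions, and both sides of the integrated identity
pass to the limit since they are products of two factors converging in \<open>L\<^sup>2\<close>. The product is only
claimed to have a weak gradient; whether it lies in \<open>H\<^sub>0\<^sup>1\<close> has to be known otherwise.
\<close>

lemma H10_limit_product:
  assumes f: "H10_limit \<Omega> f F" and g: "H10_limit \<Omega> g G"
  shows "weak_gradient \<Omega> (\<lambda>x. f x * g x) (\<lambda>x. f x *\<^sub>R G x + g x *\<^sub>R F x)"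
proof -
  obtain \<phi> where \<phi>: "\<And>n::nat. \<phi> n \<in> test_fun \<Omega>" and \<phi>l: "L2_tendsto \<Omega> \<phi> f" "L2_tendsto \<Omega> (\<lambda>n. grad (\<phi> n)) F"
    using f unfolding H10_limit_def by blast
  obtain \<psi> where \<psi>: "\<And>n::nat. \<psi> n \<in> test_fun \<Omega>" and \<psi>l: "L2_tendsto \<Omega> \<psi> g" "L2_tendsto \<Omega> (\<lambda>n. grad (\<psi> n)) G"
    using g unfolding H10_limit_def by blast
  note L = H10_limit_Lp_2[OF f] H10_limit_Lp_2[OF g]
  note i = Lp_2_bilinear_integrable[OF bounded_bilinear_mult L(1,3)]
    Lp_2_bilinear_integrable[OF bounded_bilinear_scaleR L(1,4)]
    Lp_2_bilinear_integrable[OF bounded_bilinear_scaleR L(3,2)]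
  show ?thesis
    unfolding weak_gradient_def
  proof (intro conjI ballI integrable_imp_Lp_loc_1[OF _ Omega_sets] Bochner_Integration.integrable_add i)
    fix \<eta> assume \<eta>: "\<eta> \<in> test_fun \<Omega>"
    have "(\<lambda>n. \<integral>x. \<phi> n x *\<^sub>R (\<psi> n x *\<^sub>R grad \<eta> x) \<partial>\<mu>)
        \<longlonglongrightarrow> (\<integral>x. f x *\<^sub>R (g x *\<^sub>R grad \<eta> x) \<partial>\<mu>)"
      by (rule L2_tendsto_integral_bilinear[OF bounded_bilinear_scaleR \<phi>l(1) L2_tendsto_mult_grad[OF \<psi>l(1) \<eta>]])
    moreover have a: "(\<lambda>n. \<integral>x. \<phi> n x *\<^sub>R (\<eta> x *\<^sub>R grad (\<psi> n) x) \<partial>\<mu>)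
        \<longlonglongrightarrow> (\<integral>x. f x *\<^sub>R (\<eta> x *\<^sub>R G x) \<partial>\<mu>)"
      by (rule L2_tendsto_integral_bilinear[OF bounded_bilinear_scaleR \<phi>l(1) L2_tendsto_mult_test_fun[OF \<psi>l(2) \<eta>]])
    moreover have b: "(\<lambda>n. \<integral>x. \<psi> n x *\<^sub>R (\<eta> x *\<^sub>R grad (\<phi> n) x) \<partial>\<mu>)
        \<longlonglongrightarrow> (\<integral>x. g x *\<^sub>R (\<eta> x *\<^sub>R F x) \<partial>\<mu>)"
      by (rule L2_tendsto_integral_bilinear[OF bounded_bilinear_scaleR \<psi>l(1) L2_tendsto_mult_test_fun[OF \<phi>l(2) \<eta>]])
    moreover have "(\<integral>x. \<phi> n x *\<^sub>R (\<psi> n x *\<^sub>R grad \<eta> x) \<partial>\<mu>)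
        = - ((\<integral>x. \<phi> n x *\<^sub>R (\<eta> x *\<^sub>R grad (\<psi> n) x) \<partial>\<mu>)
          + (\<integral>x. \<psi> n x *\<^sub>R (\<eta> x *\<^sub>R grad (\<phi> n) x) \<partial>\<mu>))" for n
    proof -
      have i1: "integrable \<mu> (\<lambda>x. \<phi> n x *\<^sub>R (\<eta> x *\<^sub>R grad (\<psi> n) x))"
        "integrable \<mu> (\<lambda>x. \<psi> n x *\<^sub>R (\<eta> x *\<^sub>R grad (\<phi> n) x))"
        by (rule Lp_2_bilinear_integrable[OF bounded_bilinear_scaleR test_fun_Lp_2(1)[OF \<phi>]
              Lp_2_mult_test_fun[OF test_fun_Lp_2(2)[OF \<psi>] \<eta>]],
            rule Lp_2_bilinear_integrable[OF bounded_bilinear_scaleR test_fun_Lp_2(1)[OF \<psi>]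
              Lp_2_mult_test_fun[OF test_fun_Lp_2(2)[OF \<phi>] \<eta>]])
      have "(\<integral>x. \<phi> n x *\<^sub>R (\<psi> n x *\<^sub>R grad \<eta> x) \<partial>\<mu>)
          = - (\<integral>x. \<eta> x *\<^sub>R grad (\<lambda>x. \<phi> n x * \<psi> n x) x \<partial>\<mu>)"
        using test_fun_by_parts[OF test_fun_mult[OF \<phi> \<psi>, of n n] \<eta>] by (simp only: scaleR_scaleR)
      also have "(\<integral>x. \<eta> x *\<^sub>R grad (\<lambda>x. \<phi> n x * \<psi> n x) x \<partial>\<mu>)
         = (\<integral>x. \<phi> n x *\<^sub>R (\<eta> x *\<^sub>R grad (\<psi> n) x) + \<psi> n x *\<^sub>R (\<eta> x *\<^sub>R grad (\<phi> n) x) \<partial>\<mu>)"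
        by (intro Bochner_Integration.integral_cong)
           (auto simp: grad_mult[OF \<phi> \<psi>] scaleR_add_right mult.commute)
      also have "\<dots> = (\<integral>x. \<phi> n x *\<^sub>R (\<eta> x *\<^sub>R grad (\<psi> n) x) \<partial>\<mu>)
          + (\<integral>x. \<psi> n x *\<^sub>R (\<eta> x *\<^sub>R grad (\<phi> n) x) \<partial>\<mu>)"
        by (rule Bochner_Integration.integral_add[OF i1])
      finally show ?thesis .
    qed
    ultimately have "(\<integral>x. f x *\<^sub>R (g x *\<^sub>R grad \<eta> x) \<partial>\<mu>)
        = - ((\<integral>x. f x *\<^sub>R (\<eta> x *\<^sub>R G x) \<partial>\<mu>) + (\<integral>x. g x *\<^sub>R (\<eta> x *\<^sub>R F x) \<partial>\<mu>))"
      by (simp only:) (rule LIMSEQ_unique, assumption, intro tendsto_minus tendsto_add a b)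
    also have "\<dots> = - (\<integral>x. f x *\<^sub>R (\<eta> x *\<^sub>R G x) + g x *\<^sub>R (\<eta> x *\<^sub>R F x) \<partial>\<mu>)"
      by (simp only: Bochner_Integration.integral_add[OF
            Lp_2_bilinear_integrable[OF bounded_bilinear_scaleR L(1) Lp_2_mult_test_fun[OF L(4) \<eta>]]
            Lp_2_bilinear_integrable[OF bounded_bilinear_scaleR L(3) Lp_2_mult_test_fun[OF L(2) \<eta>]]])
    finally show "(\<integral>x. (f x * g x) *\<^sub>R grad \<eta> x \<partial>\<mu>)
        = - (\<integral>x. \<eta> x *\<^sub>R (f x *\<^sub>R G x + g x *\<^sub>R F x) \<partial>\<mu>)"
      by (simp only: scaleR_scaleR scaleR_add_right mult.commute[of "\<eta> _"])
  qed
qed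

lemma H10_limit_weak_gradient:
  assumes f: "H10_limit \<Omega> f F"
  shows "weak_gradient \<Omega> f F"
proof -
  obtain \<phi> where \<phi>: "\<And>n::nat. \<phi> n \<in> test_fun \<Omega>" and \<phi>l: "L2_tendsto \<Omega> \<phi> f" "L2_tendsto \<Omega> (\<lambda>n. grad (\<phi> n)) F"
    using f unfolding H10_limit_def by blast
  show ?thesis
    unfolding weak_gradient_def
  proof (intro conjI ballI Lp_2_imp_Lp_loc_1 H10_limit_Lp_2[OF f])
    fix \<eta> assume \<eta>: "\<eta> \<in> test_fun \<Omega>"
    have a: "(\<lambda>n. \<integral>x. \<phi> n x *\<^sub>R grad \<eta> x \<partial>\<mu>) \<longlonglongrightarrow> (\<integral>x. f x *\<^sub>R grad \<eta> x \<partial>\<mu>)"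
      by (rule L2_tendsto_integral_bilinear[OF bounded_bilinear_scaleR \<phi>l(1) L2_tendsto_const[OF test_fun_Lp_2(2)[OF \<eta>]]])
    have b: "(\<lambda>n. \<integral>x. \<eta> x *\<^sub>R grad (\<phi> n) x \<partial>\<mu>) \<longlonglongrightarrow> (\<integral>x. \<eta> x *\<^sub>R F x \<partial>\<mu>)"
      by (rule L2_tendsto_integral_bilinear[OF bounded_bilinear_scaleR L2_tendsto_const[OF test_fun_Lp_2(1)[OF \<eta>]] \<phi>l(2)])
    show "(\<integral>x. f x *\<^sub>R grad \<eta> x \<partial>\<mu>) = - (\<integral>x. \<eta> x *\<^sub>R F x \<partial>\<mu>)"
      by (rule LIMSEQ_unique[OF a]) (use tendsto_minus[OF b] in \<open>simp only: test_fun_by_parts[OF \<phi> \<eta>]\<close>)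
  qed
qed

lemma H10_limit_imp_H10:
  assumes f: "H10_limit \<Omega> f F"
  shows "f \<in> H10 \<Omega>"
proof -
  obtain \<phi> where \<phi>: "\<And>n::nat. \<phi> n \<in> test_fun \<Omega>" and \<phi>l: "L2_tendsto \<Omega> \<phi> f" "L2_tendsto \<Omega> (\<lambda>n. grad (\<phi> n)) F"
    using f unfolding H10_limit_def by blast
  note w = H10_limit_weak_gradient[OF f]
  have "f \<in> H1 \<Omega>" unfolding H1_def using H10_limit_Lp_2[OF f] w by blast
  moreover have "(\<integral>x. (norm (grad (\<phi> n) x - wgrad \<Omega> f x))\<^sup>2 \<partial>\<mu>)
      = (\<integral>x. (norm (grad (\<phi> n) x - F x))\<^sup>2 \<partial>\<mu>)" for n
  proof (rule integral_AE_eq[OF Omega_sets, symmetric])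
    show "integrable \<mu> (\<lambda>x. (norm (grad (\<phi> n) x - F x))\<^sup>2)"
      by (intro Lp_2_square Lp_2_diff test_fun_Lp_2 \<phi> H10_limit_Lp_2(2)[OF f])
    show "AE x in \<mu>. (norm (grad (\<phi> n) x - F x))\<^sup>2 = (norm (grad (\<phi> n) x - wgrad \<Omega> f x))\<^sup>2"
      using wgrad_AE_eq[OF Omega_open w] by eventually_elim simp
  qed
  moreover have "(\<lambda>n. (\<integral>x. (\<phi> n x - f x)\<^sup>2 \<partial>\<mu>)
          + (\<integral>x. (norm (grad (\<phi> n) x - F x))\<^sup>2 \<partial>\<mu>)) \<longlonglongrightarrow> 0 + 0"
    using \<phi>l unfolding L2_tendsto_def by (intro tendsto_add) simp_all
  ultimately show ?thesis unfolding H10_def using \<phi>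
    by (intro CollectI conjI exI[of _ \<phi>] allI) (simp_all only: add_0)
qed

lemma H10_limit_AE_eq:
  assumes f: "H10_limit \<Omega> f F" and ae: "AE x in \<mu>. F x = F' x"
  shows "H10_limit \<Omega> f F'"
proof -
  have F': "F' \<in> Lp 2 \<Omega>" by (rule Lp_2_AE_eq[OF Omega_sets H10_limit_Lp_2(2)[OF f] ae])
  have "L2_tendsto \<Omega> \<psi> F'" if "L2_tendsto \<Omega> \<psi> F" for \<psi>
    by (rule L2_tendsto_mono[OF that _ F', of _ 1])
       (use that ae in \<open>auto simp: L2_tendsto_def elim: eventually_mono\<close>)
  then show ?thesis using f unfolding H10_limit_def by blast
qed

lemma H10_limit_add:
  assumes f: "H10_limit \<Omega> f F" and g: "H10_limit \<Omega> g G"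
  shows "H10_limit \<Omega> (\<lambda>x. f x + g x) (\<lambda>x. F x + G x)"
proof -
  obtain \<phi> where \<phi>: "\<And>n::nat. \<phi> n \<in> test_fun \<Omega>" and \<phi>l: "L2_tendsto \<Omega> \<phi> f" "L2_tendsto \<Omega> (\<lambda>n. grad (\<phi> n)) F"
    using f unfolding H10_limit_def by blast
  obtain \<psi> where \<psi>: "\<And>n::nat. \<psi> n \<in> test_fun \<Omega>" and \<psi>l: "L2_tendsto \<Omega> \<psi> g" "L2_tendsto \<Omega> (\<lambda>n. grad (\<psi> n)) G"
    using g unfolding H10_limit_def by blast
  show ?thesis
    unfolding H10_limit_def
  proof (intro exI[of _ "\<lambda>n x. \<phi> n x + \<psi> n x"] conjI allI test_fun_add \<phi> \<psi> L2_tendsto_add \<phi>l(1) \<psi>l(1))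
    show "L2_tendsto \<Omega> (\<lambda>n. grad (\<lambda>x. \<phi> n x + \<psi> n x)) (\<lambda>x. F x + G x)"
      using L2_tendsto_add[OF \<phi>l(2) \<psi>l(2)] by (simp only: grad_add[OF \<phi> \<psi>, abs_def])
  qed
qed

lemma H10_limit_test_fun_mult:
  assumes f: "H10_limit \<Omega> f F" and \<eta>: "\<eta> \<in> test_fun \<Omega>"
  shows "H10_limit \<Omega> (\<lambda>x. \<eta> x * f x) (\<lambda>x. \<eta> x *\<^sub>R F x + f x *\<^sub>R grad \<eta> x)"
proof -
  obtain \<phi> where \<phi>: "\<And>n::nat. \<phi> n \<in> test_fun \<Omega>" and \<phi>l: "L2_tendsto \<Omega> \<phi> f" "L2_tendsto \<Omega> (\<lambda>n. grad (\<phi> n)) F"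
    using f unfolding H10_limit_def by blast
  show ?thesis
    unfolding H10_limit_def
  proof (intro exI[of _ "\<lambda>n x. \<eta> x * \<phi> n x"] conjI allI test_fun_mult \<phi> \<eta>)
    show "L2_tendsto \<Omega> (\<lambda>n x. \<eta> x * \<phi> n x) (\<lambda>x. \<eta> x * f x)"
      using L2_tendsto_mult_test_fun[OF \<phi>l(1) \<eta>] by (simp only: real_scaleR_def)
    show "L2_tendsto \<Omega> (\<lambda>n. grad (\<lambda>x. \<eta> x * \<phi> n x)) (\<lambda>x. \<eta> x *\<^sub>R F x + f x *\<^sub>R grad \<eta> x)"
      using L2_tendsto_add[OF L2_tendsto_mult_test_fun[OF \<phi>l(2) \<eta>] L2_tendsto_mult_grad[OF \<phi>l(1) \<eta>]]
      by (simp only: grad_mult[OF \<eta> \<phi>, abs_def])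
  qed
qed

lemma L2_tendsto_scale:
  fixes f :: "nat \<Rightarrow> real^'n \<Rightarrow> 'b::euclidean_space"
  assumes "L2_tendsto \<Omega> f f'"
  shows "L2_tendsto \<Omega> (\<lambda>n x. c *\<^sub>R f n x) (\<lambda>x. c *\<^sub>R f' x)"
  by (rule L2_tendsto_bounded_bilinear[OF bounded_bilinear.flip[OF bounded_bilinear_scaleR] assms, of "\<lambda>x. c" "\<bar>c\<bar>"]) auto

lemma H10_limit_scale:
  assumes f: "H10_limit \<Omega> f F"
  shows "H10_limit \<Omega> (\<lambda>x. c * f x) (\<lambda>x. c *\<^sub>R F x)"
proof -
  obtain \<phi> where \<phi>: "\<And>n::nat. \<phi> n \<in> test_fun \<Omega>" and \<phi>l: "L2_tendsto \<Omega> \<phi> f" "L2_tendsto \<Omega> (\<lambda>n. grad (\<phi> n)) F"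
    using f unfolding H10_limit_def by blast
  show ?thesis
    unfolding H10_limit_def
  proof (intro exI[of _ "\<lambda>n x. c * \<phi> n x"] conjI allI test_fun_scale \<phi>)
    show "L2_tendsto \<Omega> (\<lambda>n x. c * \<phi> n x) (\<lambda>x. c * f x)"
      using L2_tendsto_scale[OF \<phi>l(1), of c] by (simp only: real_scaleR_def)
    show "L2_tendsto \<Omega> (\<lambda>n. grad (\<lambda>x. c * \<phi> n x)) (\<lambda>x. c *\<^sub>R F x)"
      using L2_tendsto_scale[OF \<phi>l(2), of c] by (simp only: grad_scale[OF \<phi>, abs_def])
  qed
qed

lemma H10_limit_diff:
  assumes "H10_limit \<Omega> f F" "H10_limit \<Omega> g G"
  shows "H10_limit \<Omega> (\<lambda>x. f x - g x) (\<lambda>x. F x - G x)"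
  using H10_limit_add[OF assms(1) H10_limit_scale[OF assms(2), of "-1"]] by simp

end

section \<open>The gradient of the positive part\<close>

text \<open>
A \<open>C\<^sup>1\<close> approximation of the positive part with derivative \<open>soft_step e\<close>. That derivative is Lipschitz,
so that composition with it preserves \<open>L\<^sup>2\<close> convergence, and it vanishes for \<open>s \<le> 0\<close>, so that its
limit as \<open>e \<rightarrow> 0\<close> is the indicator of \<open>s > 0\<close>, with value 0 at \<open>s = 0\<close>.
\<close>

definition soft_pos :: "real \<Rightarrow> real \<Rightarrow> real" where
  "soft_pos e s = ((max 0 s)\<^sup>2 - (max 0 (s - e))\<^sup>2) / (2 * e)"

definition soft_step :: "real \<Rightarrow> real \<Rightarrow> real" where
  "soft_step e s = (max 0 s - max 0 (s - e)) / e"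

text \<open>
The square removes the corner of the positive part: at 0 the difference quotient is the positive part itself.
\<close>

lemma DERIV_max_0_square: "((\<lambda>s. (max 0 s)\<^sup>2) has_real_derivative (2 * max 0 s)) (at s)"
proof -
  consider "s > 0" | "s = 0" | "s < 0" by linarith
  then show ?thesis
  proof cases
    case 1
    have "((\<lambda>s. s\<^sup>2) has_real_derivative (2 * max 0 s)) (at s)"
      using 1 by (auto intro!: derivative_eq_intros)
    then show ?thesis
      by (rule has_field_derivative_transform_within_open[where S="{0<..}"]) (use 1 in auto)
  next
    case 2
    have "((\<lambda>y. ((max 0 y)\<^sup>2 - (max 0 0)\<^sup>2) / (y - 0)) \<longlongrightarrow> 0) (at (0::real))"
    proof (rule Lim_transform_eventually)
      show "((\<lambda>y. max 0 y) \<longlongrightarrow> 0) (at (0::real))"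
        using tendsto_max[OF tendsto_const[of 0] tendsto_ident_at[of "0::real" UNIV]] by simp
      show "\<forall>\<^sub>F y in at 0. max 0 y = ((max 0 y)\<^sup>2 - (max 0 0)\<^sup>2) / (y - (0::real))"
        by (auto simp: eventually_at_filter max_def power2_eq_square)
    qed
    then show ?thesis using 2 by (simp add: has_field_derivative_iff)
  next
    case 3
    have "((\<lambda>s. 0) has_real_derivative (2 * max 0 s)) (at s)"
      using 3 by auto
    then show ?thesis
      by (rule has_field_derivative_transform_within_open[where S="{..<0}"]) (use 3 in auto)
  qed
qed

lemma DERIV_soft_pos:
  assumes "e > 0"
  shows "(soft_pos e has_real_derivative soft_step e s) (at s)"
proof -
  have 1: "((\<lambda>s. (max 0 (s - e))\<^sup>2) has_real_derivative (2 * max 0 (s - e))) (at s)"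
    using DERIV_shift[of "\<lambda>s. (max 0 s)\<^sup>2" "2 * max 0 (s - e)" s "-e"] DERIV_max_0_square[of "s - e"] by simp
  have "(2 * max 0 s - 2 * max 0 (s - e)) / (2 * e) = (max 0 s - max 0 (s - e)) / e"
    by (simp only: right_diff_distrib[symmetric] mult_divide_mult_cancel_left_if) simp
  then show ?thesis
    unfolding soft_pos_def[abs_def] soft_step_def
    using DERIV_cdivide[OF DERIV_diff[OF DERIV_max_0_square[of s] 1], of "2 * e"] by (simp only:)
qed

lemma soft_step_bounds: "e > 0 \<Longrightarrow> 0 \<le> soft_step e s" "e > 0 \<Longrightarrow> soft_step e s \<le> 1"
  by (auto simp: soft_step_def max_def divide_simps)

lemma soft_step_lipschitz: "e > 0 \<Longrightarrow> \<bar>soft_step e a - soft_step e b\<bar> \<le> (2 / e) * \<bar>a - b\<bar>"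
proof -
  assume e: "e > 0"
  have "\<bar>(max 0 a - max 0 (a - e)) - (max 0 b - max 0 (b - e))\<bar> \<le> 2 * \<bar>a - b\<bar>"
  proof -
    have "\<bar>max 0 x - max 0 y\<bar> \<le> \<bar>x - y\<bar>" for x y :: real by (auto simp: max_def)
    from this[of a b] this[of "a - e" "b - e"]
    have "\<bar>max 0 a - max 0 b\<bar> \<le> \<bar>a - b\<bar>" "\<bar>max 0 (a - e) - max 0 (b - e)\<bar> \<le> \<bar>a - b\<bar>"
      by simp_all
    moreover have "\<bar>(p - q) - (r - s)\<bar> \<le> 2 * t" if "\<bar>p - r\<bar> \<le> t" "\<bar>q - s\<bar> \<le> t" for p q r s t :: real
      using that by linarith
    ultimately show ?thesis by blast
  qed
  then have "\<bar>(max 0 a - max 0 (a - e)) - (max 0 b - max 0 (b - e))\<bar> / e \<le> 2 * \<bar>a - b\<bar> / e"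
    using e by (intro divide_right_mono) auto
  then show ?thesis
    using e by (simp add: soft_step_def diff_divide_distrib[symmetric] abs_divide)
qed

lemma soft_pos_lipschitz: "e > 0 \<Longrightarrow> \<bar>soft_pos e a - soft_pos e b\<bar> \<le> \<bar>a - b\<bar>"
  using field_differentiable_bound[of UNIV "soft_pos e" "soft_step e" 1 a b]
    DERIV_soft_pos[of e] soft_step_bounds[of e] by simp

lemma soft_pos_bounds:
  assumes "e > 0"
  shows "\<bar>soft_pos e s\<bar> \<le> \<bar>s\<bar>"
  using soft_pos_lipschitz[OF assms, of s 0] assms by (simp add: soft_pos_def)

lemma soft_step_eventually: "\<forall>\<^sub>F n in sequentially. soft_step (inverse (real (Suc n))) s = (if s > 0 then 1 else 0)"
  and soft_pos_tendsto: "(\<lambda>n. soft_pos (inverse (real (Suc n))) s) \<longlonglongrightarrow> max 0 s"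
proof -
  have e0: "(\<lambda>n. inverse (real (Suc n))) \<longlonglongrightarrow> 0" by (rule LIMSEQ_inverse_real_of_nat)
  show "\<forall>\<^sub>F n in sequentially. soft_step (inverse (real (Suc n))) s = (if s > 0 then 1 else 0)"
  proof (cases "s > 0")
    case True
    have "\<forall>\<^sub>F n in sequentially. inverse (real (Suc n)) < s" by (rule order_tendstoD(2)[OF e0 True])
    then show ?thesis
      by eventually_elim (use True in \<open>simp add: soft_step_def\<close>)
  next
    case False
    have "soft_step (inverse (real (Suc n))) s = 0" for n
    proof -
      have "inverse (real (Suc n)) > 0" by simp
      then have "s - inverse (real (Suc n)) < 0" using False by linarith
      then show ?thesis using False by (simp add: soft_step_def max_def)
    qed
    then show ?thesis using False by simp
  qed
  show "(\<lambda>n. soft_pos (inverse (real (Suc n))) s) \<longlonglongrightarrow> max 0 s"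
  proof (cases "s > 0")
    case True
    have "\<forall>\<^sub>F n in sequentially. inverse (real (Suc n)) < s" by (rule order_tendstoD(2)[OF e0 True])
    then have ev: "\<forall>\<^sub>F n in sequentially. s - inverse (real (Suc n)) / 2 = soft_pos (inverse (real (Suc n))) s"
    proof eventually_elim
      case (elim n)
      define e where "e = inverse (real (Suc n))"
      have "e > 0" "e < s" using elim by (auto simp: e_def)
      then have "soft_pos e s = (s\<^sup>2 - (s - e)\<^sup>2) / (2 * e)" using True by (simp add: soft_pos_def)
      also have "\<dots> = s - e / 2" using \<open>e > 0\<close> by (simp add: power2_eq_square field_simps)
      finally show ?case unfolding e_def by simp
    qed
    have "(\<lambda>n. s - inverse (real (Suc n)) / 2) \<longlonglongrightarrow> s - 0 / 2"
      by (intro tendsto_intros e0) simp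
    then have "(\<lambda>n. soft_pos (inverse (real (Suc n))) s) \<longlonglongrightarrow> s - 0 / 2"
      by (rule Lim_transform_eventually[OF _ ev])
    then show ?thesis using True by simp
  next
    case False
    have "soft_pos (inverse (real (Suc n))) s = 0" for n
    proof -
      have "inverse (real (Suc n)) > 0" by simp
      then have "s - inverse (real (Suc n)) < 0" using False by linarith
      then show ?thesis using False by (simp add: soft_pos_def max_def)
    qed
    then show ?thesis using False by simp
  qed
qed

context bounded_domain begin

lemma soft_pos_by_parts:
  assumes f: "H10_limit \<Omega> f F" and e: "e > 0" and \<eta>: "\<eta> \<in> test_fun \<Omega>"
  shows "(\<integral>x. soft_pos e (f x) *\<^sub>R grad \<eta> x \<partial>\<mu>)
     = - (\<integral>x. (soft_step e (f x) * \<eta> x) *\<^sub>R F x \<partial>\<mu>)"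
proof -
  obtain \<phi> where \<phi>: "\<And>n::nat. \<phi> n \<in> test_fun \<Omega>" and \<phi>l: "L2_tendsto \<Omega> \<phi> f" "L2_tendsto \<Omega> (\<lambda>n. grad (\<phi> n)) F"
    using f unfolding H10_limit_def by blast
  have c: "continuous_on UNIV (soft_pos e)" "continuous_on UNIV (soft_step e)"
    using DERIV_isCont[OF DERIV_soft_pos[OF e]] continuous_at_imp_continuous_on apply blast
    unfolding soft_step_def[abs_def] using e by (intro continuous_intros) auto
  have L1: "(\<lambda>x. soft_pos e (g x)) \<in> Lp 2 \<Omega>" if "g \<in> Lp 2 \<Omega>" for g
    by (rule Lp_2_bound[OF that continuous_compose_measurable[OF c(1) Lp_2_measurable[OF that]]])
       (simp add: soft_pos_bounds[OF e])
  have L2: "(\<lambda>x. soft_step e (g x)) \<in> Lp 2 \<Omega>" if "g \<in> Lp 2 \<Omega>" for g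
    by (rule Lp_2_bounded[OF Omega_lmeasurable continuous_compose_measurable[OF c(2) Lp_2_measurable[OF that]], of 1])
       (use soft_step_bounds[OF e] in \<open>simp add: abs_le_iff order_trans[OF _ soft_step_bounds(1)[OF e]]\<close>)
  have l1: "L2_tendsto \<Omega> (\<lambda>n x. soft_pos e (\<phi> n x)) (\<lambda>x. soft_pos e (f x))"
    by (rule L2_tendsto_mono[OF \<phi>l(1), of _ _ 1])
       (simp_all add: L1 soft_pos_lipschitz e test_fun_Lp_2(1)[OF \<phi>] H10_limit_Lp_2(1)[OF f])
  have l2: "L2_tendsto \<Omega> (\<lambda>n x. soft_step e (\<phi> n x)) (\<lambda>x. soft_step e (f x))"
    by (rule L2_tendsto_mono[OF \<phi>l(1), of _ _ "2 / e"])
       (use soft_step_lipschitz[OF e] in \<open>simp_all add: L2 test_fun_Lp_2(1)[OF \<phi>] H10_limit_Lp_2(1)[OF f]\<close>)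
  have a: "(\<lambda>n. \<integral>x. soft_pos e (\<phi> n x) *\<^sub>R grad \<eta> x \<partial>\<mu>)
      \<longlonglongrightarrow> (\<integral>x. soft_pos e (f x) *\<^sub>R grad \<eta> x \<partial>\<mu>)"
    by (rule L2_tendsto_integral_bilinear[OF bounded_bilinear_scaleR l1 L2_tendsto_const[OF test_fun_Lp_2(2)[OF \<eta>]]])
  have b: "(\<lambda>n. \<integral>x. soft_step e (\<phi> n x) *\<^sub>R (\<eta> x *\<^sub>R grad (\<phi> n) x) \<partial>\<mu>)
      \<longlonglongrightarrow> (\<integral>x. soft_step e (f x) *\<^sub>R (\<eta> x *\<^sub>R F x) \<partial>\<mu>)"
    by (rule L2_tendsto_integral_bilinear[OF bounded_bilinear_scaleR l2 L2_tendsto_mult_test_fun[OF \<phi>l(2) \<eta>]])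
  show ?thesis
  proof (rule LIMSEQ_unique[OF a])
    show "(\<lambda>n. \<integral>x. soft_pos e (\<phi> n x) *\<^sub>R grad \<eta> x \<partial>\<mu>)
       \<longlonglongrightarrow> - (\<integral>x. (soft_step e (f x) * \<eta> x) *\<^sub>R F x \<partial>\<mu>)"
      unfolding integral_by_parts_compose[OF DERIV_soft_pos[OF e] c(2) \<phi> \<eta> Omega_open]
      using tendsto_minus[OF b] by (simp only: scaleR_scaleR)
  qed
qed

text \<open>
The regularisation parameter of \<open>soft_pos_by_parts\<close> tends to 0, with \<open>|f|\<close> and \<open>|F|\<close> as dominating
functions.
\<close>

lemma H10_limit_max_0:
  assumes f: "H10_limit \<Omega> f F"
  shows "weak_gradient \<Omega> (\<lambda>x. max 0 (f x)) (\<lambda>x. (if f x > 0 then 1 else 0) *\<^sub>R F x)"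
  unfolding weak_gradient_def
proof (intro conjI ballI)
  note L = H10_limit_Lp_2[OF f]
  have [measurable]: "f \<in> borel_measurable \<mu>" "F \<in> borel_measurable \<mu>"
    using L by (auto intro: Lp_2_measurable)
  have 1: "(\<lambda>x. max 0 (f x)) \<in> Lp 2 \<Omega>"
    by (rule Lp_2_bound[OF L(1)]) auto
  have 2: "(\<lambda>x. (if f x > 0 then 1 else 0) *\<^sub>R F x) \<in> Lp 2 \<Omega>"
    by (rule Lp_2_bounded_scaleR[OF L(2), of _ 1]) auto
  show "(\<lambda>x. max 0 (f x)) \<in> Lp_loc 1 \<Omega>" "(\<lambda>x. (if f x > 0 then 1 else 0) *\<^sub>R F x) \<in> Lp_loc 1 \<Omega>"
    by (intro Lp_2_imp_Lp_loc_1 1 2)+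
  fix \<eta> assume \<eta>: "\<eta> \<in> test_fun \<Omega>"
  have [measurable]: "\<eta> \<in> borel_measurable \<mu>" "grad \<eta> \<in> borel_measurable \<mu>"
    using test_fun_measurable[OF \<eta>] grad_test_fun_measurable[OF \<eta>] .
  define e where "e = (\<lambda>n. inverse (real (Suc n)))"
  have e: "e n > 0" for n by (simp add: e_def)
  have c: "continuous_on UNIV (soft_pos (e n))" "continuous_on UNIV (soft_step (e n))" for n
    using DERIV_isCont[OF DERIV_soft_pos[OF e]] continuous_at_imp_continuous_on apply blast
    unfolding soft_step_def[abs_def] using e[of n] by (intro continuous_intros) auto
  note m = continuous_compose_measurable[OF c(1) Lp_2_measurable[OF L(1)], measurable]
    continuous_compose_measurable[OF c(2) Lp_2_measurable[OF L(1)], measurable]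
  have a: "(\<lambda>n. \<integral>x. soft_pos (e n) (f x) *\<^sub>R grad \<eta> x \<partial>\<mu>)
      \<longlonglongrightarrow> (\<integral>x. max 0 (f x) *\<^sub>R grad \<eta> x \<partial>\<mu>)"
  proof (rule integral_dominated_convergence[where w="\<lambda>x. norm (f x *\<^sub>R grad \<eta> x)"])
    show "integrable \<mu> (\<lambda>x. norm (f x *\<^sub>R grad \<eta> x))"
      by (intro integrable_norm Lp_2_bilinear_integrable[OF bounded_bilinear_scaleR L(1) test_fun_Lp_2(2)[OF \<eta>]])
    show "AE x in \<mu>. (\<lambda>n. soft_pos (e n) (f x) *\<^sub>R grad \<eta> x) \<longlonglongrightarrow> max 0 (f x) *\<^sub>R grad \<eta> x"
      unfolding e_def by (intro AE_I2 tendsto_scaleR soft_pos_tendsto tendsto_const)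
    show "AE x in \<mu>. norm (soft_pos (e n) (f x) *\<^sub>R grad \<eta> x) \<le> norm (f x *\<^sub>R grad \<eta> x)" for n
      unfolding norm_scaleR by (intro AE_I2 mult_right_mono soft_pos_bounds e norm_ge_zero)
  qed measurable
  have b: "(\<lambda>n. \<integral>x. (soft_step (e n) (f x) * \<eta> x) *\<^sub>R F x \<partial>\<mu>)
      \<longlonglongrightarrow> (\<integral>x. ((if f x > 0 then 1 else 0) * \<eta> x) *\<^sub>R F x \<partial>\<mu>)"
  proof (rule integral_dominated_convergence[where w="\<lambda>x. norm (\<eta> x *\<^sub>R F x)"])
    show "integrable \<mu> (\<lambda>x. norm (\<eta> x *\<^sub>R F x))"
      by (intro integrable_norm Lp_2_bilinear_integrable[OF bounded_bilinear_scaleR test_fun_Lp_2(1)[OF \<eta>] L(2)])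
    show "AE x in \<mu>. (\<lambda>n. (soft_step (e n) (f x) * \<eta> x) *\<^sub>R F x)
        \<longlonglongrightarrow> ((if f x > 0 then 1 else 0) * \<eta> x) *\<^sub>R F x"
      unfolding e_def by (intro AE_I2 tendsto_scaleR tendsto_mult tendsto_eventually[OF soft_step_eventually] tendsto_const)
    show "AE x in \<mu>. norm ((soft_step (e n) (f x) * \<eta> x) *\<^sub>R F x) \<le> norm (\<eta> x *\<^sub>R F x)" for n
    proof (rule AE_I2)
      fix x
      have "\<bar>soft_step (e n) (f x)\<bar> \<le> 1"
        using soft_step_bounds[OF e, of n "f x"] by simp
      then show "norm ((soft_step (e n) (f x) * \<eta> x) *\<^sub>R F x) \<le> norm (\<eta> x *\<^sub>R F x)"
        unfolding norm_scaleR abs_mult by (intro mult_right_mono mult_left_le_one_le) auto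
    qed
  qed measurable
  have "(\<integral>x. max 0 (f x) *\<^sub>R grad \<eta> x \<partial>\<mu>)
      = - (\<integral>x. ((if f x > 0 then 1 else 0) * \<eta> x) *\<^sub>R F x \<partial>\<mu>)"
    by (rule LIMSEQ_unique[OF a]) (use tendsto_minus[OF b] in \<open>simp only: soft_pos_by_parts[OF f e \<eta>]\<close>)
  then show "(\<integral>x. max 0 (f x) *\<^sub>R grad \<eta> x \<partial>\<mu>)
      = - (\<integral>x. \<eta> x *\<^sub>R (if f x > 0 then 1 else 0) *\<^sub>R F x \<partial>\<mu>)"
    by (simp only: scaleR_scaleR mult.commute[of "\<eta> _"])
qed

end

section \<open>Truncations of a solution\<close>

lemma Linf_measurable: "f \<in> Linf S \<Longrightarrow> f \<in> borel_measurable (lebesgue_on S)"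
  by (simp add: Linf_def)

lemma Lp_2_Linf_scaleR:
  fixes f :: "real^'n \<Rightarrow> 'b::euclidean_space"
  assumes "g \<in> Linf S" "f \<in> Lp 2 S"
  shows "(\<lambda>x. g x *\<^sub>R f x) \<in> Lp 2 S"
proof -
  obtain C where "AE x in lebesgue_on S. \<bar>g x\<bar> \<le> C" using assms(1) by (auto simp: Linf_def)
  then show ?thesis by (rule Lp_2_bounded_scaleR[OF assms(2) Linf_measurable[OF assms(1)]])
qed

lemma Gk_nonneg: "k > 0 \<Longrightarrow> s \<ge> 0 \<Longrightarrow> Gk k s = max 0 (s - k)"
  by (auto simp: Gk_def Tk_def)

lemma Tk_nonneg: "k > 0 \<Longrightarrow> s \<ge> 0 \<Longrightarrow> Tk k s = min s k"
  by (auto simp: Tk_def)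

lemma Tk_bound: "k > 0 \<Longrightarrow> \<bar>Tk k s\<bar> \<le> k"
  by (auto simp: Tk_def)

lemma continuous_on_Tk: "continuous_on UNIV (Tk k)"
  unfolding Tk_def[abs_def] by (intro continuous_intros)

context bounded_domain begin

lemma test_fun_H10_Linf: "\<eta> \<in> test_fun \<Omega> \<Longrightarrow> \<eta> \<in> H10 \<Omega> \<inter> Linf \<Omega>"
proof (rule IntI)
  assume \<eta>: "\<eta> \<in> test_fun \<Omega>"
  show "\<eta> \<in> H10 \<Omega>" by (rule H10_limit_imp_H10[OF H10_limit_test_fun[OF \<eta>]])
  obtain C where "C > 0" "\<And>x. \<bar>\<eta> x\<bar> \<le> C" "\<And>x. norm (grad \<eta> x) \<le> C"
    using test_fun_bounded[OF \<eta>] by blast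
  then show "\<eta> \<in> Linf \<Omega>" using test_fun_measurable[OF \<eta>] by (auto simp: Linf_def)
qed

lemma wgrad_H10_limit:
  assumes "H10_limit \<Omega> f F"
  shows "AE x in \<mu>. wgrad \<Omega> f x = F x"
  by (rule wgrad_AE_eq[OF Omega_open H10_limit_weak_gradient[OF assms]])

lemma wgrad_H10_Lp_2: "f \<in> H10 \<Omega> \<Longrightarrow> wgrad \<Omega> f \<in> Lp 2 \<Omega>"
  by (rule H10_limit_Lp_2(2)[OF H10_imp_H10_limit])

text \<open>
Gradients of functions that are only locally in \<open>H\<^sup>1\<close> are compared after localisation; nonnegative
cut-offs suffice since the bumps are nonnegative.
\<close>

lemma AE_eq_of_test_fun_mult:
  fixes X Y :: "real^'n \<Rightarrow> 'b::real_vector"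
  assumes "\<And>\<eta>. \<eta> \<in> test_fun \<Omega> \<Longrightarrow> (\<And>x. 0 \<le> \<eta> x) \<Longrightarrow> AE x in \<mu>. \<eta> x *\<^sub>R X x = \<eta> x *\<^sub>R Y x"
  shows "AE x in \<mu>. X x = Y x"
proof (rule AE_lebesgue_on_open_boxI[OF Omega_open])
  fix a b :: "real^'n" assume ab: "cbox a b \<subseteq> \<Omega>"
  have "AE x in \<mu>. bump 1 a b x *\<^sub>R X x = bump 1 a b x *\<^sub>R Y x"
    by (rule assms[OF bump_test_fun[OF _ ab] bump_bounds(1)]) simp
  then have "AE x in lebesgue. x \<in> \<Omega> \<longrightarrow> bump 1 a b x *\<^sub>R X x = bump 1 a b x *\<^sub>R Y x"
    using Omega_sets by (subst (asm) AE_restrict_space_iff) auto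
  then show "AE x in lebesgue. x \<in> box a b \<longrightarrow> X x = Y x"
  proof eventually_elim
    case (elim x)
    show ?case
    proof
      assume x: "x \<in> box a b"
      then have "x \<in> \<Omega>" using ab box_subset_cbox by blast
      then have "bump 1 a b x *\<^sub>R X x = bump 1 a b x *\<^sub>R Y x" using elim by blast
      moreover have "bump 1 a b x \<noteq> 0" using bump_pos[OF _ x, of 1] by simp
      ultimately show "X x = Y x" by (simp only: scaleR_cancel_left) blast
    qed
  qed
qed

end

text \<open>
The regularity part of the definition of solution.
\<close>

locale truncatable = bounded_domain \<Omega> for \<Omega> :: "(real^'n) set" +
  fixes u :: "real^'n \<Rightarrow> real"
  assumes u_Lp: "u \<in> Lp 2 \<Omega>" and u_H1_loc: "u \<in> H1_loc \<Omega>"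
    and u_nonneg: "AE x in lebesgue_on \<Omega>. u x \<ge> 0"
    and Gk_H10: "\<And>k. k > 0 \<Longrightarrow> (\<lambda>x. Gk k (u x)) \<in> H10 \<Omega>"
    and Tk_H10: "\<And>k \<phi>. k > 0 \<Longrightarrow> \<phi> \<in> H10 \<Omega> \<inter> Linf \<Omega> \<Longrightarrow> (\<lambda>x. \<phi> x * Tk k (u x)) \<in> H10 \<Omega>"
begin

abbreviation Du where "Du \<equiv> wgrad \<Omega> u"

lemma u_measurable[measurable]: "u \<in> borel_measurable \<mu>"
  by (rule Lp_2_measurable[OF u_Lp])

lemma weak_gradient_u: "weak_gradient \<Omega> u Du"
  using u_H1_loc weak_gradient_wgrad unfolding H1_loc_def by blast

lemma Tk_Linf: "k > 0 \<Longrightarrow> (\<lambda>x. Tk k (u x)) \<in> Linf \<Omega>"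
  unfolding Linf_def using Tk_bound[of k] continuous_compose_measurable[OF continuous_on_Tk u_measurable, of k]
  by blast

text \<open>
Both summands of \<open>\<eta> u = \<eta> T\<^sub>1(u) + \<eta> G\<^sub>1(u)\<close> are in \<open>H\<^sub>0\<^sup>1\<close>, the first by the assumption on truncations
and the second because \<open>\<eta>\<close> is smooth. Uniqueness identifies the gradient.
\<close>

lemma H10_limit_test_fun_u:
  assumes \<eta>: "\<eta> \<in> test_fun \<Omega>"
  shows "H10_limit \<Omega> (\<lambda>x. \<eta> x * u x) (\<lambda>x. \<eta> x *\<^sub>R Du x + u x *\<^sub>R grad \<eta> x)"
proof -
  have "H10_limit \<Omega> (\<lambda>x. \<eta> x * Tk 1 (u x) + \<eta> x * Gk 1 (u x))
     (\<lambda>x. wgrad \<Omega> (\<lambda>x. \<eta> x * Tk 1 (u x)) x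
       + (\<eta> x *\<^sub>R wgrad \<Omega> (\<lambda>x. Gk 1 (u x)) x + Gk 1 (u x) *\<^sub>R grad \<eta> x))" (is "H10_limit _ _ ?G")
    by (intro H10_limit_add H10_limit_test_fun_mult H10_imp_H10_limit Tk_H10 Gk_H10 test_fun_H10_Linf \<eta>) simp_all
  then have l: "H10_limit \<Omega> (\<lambda>x. \<eta> x * u x) ?G"
    by (simp add: Gk_def distrib_left[symmetric])
  show ?thesis
    by (rule H10_limit_AE_eq[OF l weak_gradient_unique[OF Omega_open H10_limit_weak_gradient[OF l]
            weak_gradient_test_fun_mult[OF Omega_open weak_gradient_u \<eta>]]])
qed

text \<open>
For \<open>\<eta> \<ge> 0\<close> one has \<open>\<eta> G\<^sub>k(u) = (\<eta> u - k \<eta>)\<^sup>+\<close> because \<open>u \<ge> 0\<close>. The gradient of the left side is given by the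
product rule and that of the right side by \<open>H10_limit_max_0\<close>; the terms with \<open>D\<eta>\<close> agree.
\<close>

lemma wgrad_Gk:
  assumes k: "k > 0"
  shows "AE x in \<mu>. wgrad \<Omega> (\<lambda>x. Gk k (u x)) x = (if u x > k then Du x else 0)"
proof (rule AE_eq_of_test_fun_mult)
  fix \<eta> assume \<eta>: "\<eta> \<in> test_fun \<Omega>" and pos: "\<And>x. 0 \<le> \<eta> x"
  have "H10_limit \<Omega> (\<lambda>x. \<eta> x * u x - k * \<eta> x) (\<lambda>x. \<eta> x *\<^sub>R Du x + u x *\<^sub>R grad \<eta> x - k *\<^sub>R grad \<eta> x)"
    by (intro H10_limit_diff H10_limit_scale H10_limit_test_fun H10_limit_test_fun_u \<eta>)
  note w = H10_limit_max_0[OF this]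
  have ae: "AE x in \<mu>. max 0 (\<eta> x * u x - k * \<eta> x) = \<eta> x * Gk k (u x)"
    using u_nonneg
  proof eventually_elim
    case (elim x)
    have "max 0 (\<eta> x * u x - k * \<eta> x) = \<eta> x * max 0 (u x - k)"
      using pos[of x] by (simp add: max_mult_distrib_left algebra_simps)
    then show ?case using Gk_nonneg[OF k elim] by simp
  qed
  have w': "weak_gradient \<Omega> (\<lambda>x. \<eta> x * Gk k (u x))
      (\<lambda>x. (if 0 < \<eta> x * u x - k * \<eta> x then 1 else 0) *\<^sub>R (\<eta> x *\<^sub>R Du x + u x *\<^sub>R grad \<eta> x - k *\<^sub>R grad \<eta> x))"
    by (rule weak_gradient_AE_eq[OF w Omega_open ae]) simp
  have "weak_gradient \<Omega> (\<lambda>x. \<eta> x * Gk k (u x))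
      (\<lambda>x. \<eta> x *\<^sub>R wgrad \<Omega> (\<lambda>x. Gk k (u x)) x + Gk k (u x) *\<^sub>R grad \<eta> x)"
    by (rule weak_gradient_test_fun_mult[OF Omega_open H10_limit_weak_gradient[OF H10_imp_H10_limit[OF Gk_H10[OF k]]] \<eta>])
  from weak_gradient_unique[OF Omega_open this w'] u_nonneg
  show "AE x in \<mu>. \<eta> x *\<^sub>R wgrad \<Omega> (\<lambda>x. Gk k (u x)) x = \<eta> x *\<^sub>R (if u x > k then Du x else 0)"
  proof eventually_elim
    case (elim x)
    show ?case
    proof (cases "\<eta> x = 0")
      case True
      show ?thesis by (simp only: True scaleR_zero_left)
    next
      case False
      then have p: "\<eta> x > 0" using pos[of x] by simp
      have iff: "0 < \<eta> x * u x - k * \<eta> x \<longleftrightarrow> u x > k"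
        using p by (simp add: mult.commute[of k])
      show ?thesis
      proof (cases "u x > k")
        case True
        then have "Gk k (u x) = u x - k" using Gk_nonneg[OF k elim(2)] by simp
        then show ?thesis
          using elim(1) True unfolding iff by (simp add: scaleR_diff_left)
      next
        case False
        then have "Gk k (u x) = 0" using Gk_nonneg[OF k elim(2)] by simp
        then show ?thesis
          using elim(1) False unfolding iff by simp
      qed
    qed
  qed
qed

lemma weak_gradient_Tk:
  assumes k: "k > 0"
  shows "weak_gradient \<Omega> (\<lambda>x. Tk k (u x)) (\<lambda>x. if u x \<le> k then Du x else 0)"
proof -
  have "weak_gradient \<Omega> (\<lambda>x. u x - Gk k (u x)) (\<lambda>x. Du x - wgrad \<Omega> (\<lambda>x. Gk k (u x)) x)"
    by (intro weak_gradient_diff Omega_open weak_gradient_u H10_limit_weak_gradient H10_imp_H10_limit Gk_H10 k)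
  then show ?thesis
  proof (rule weak_gradient_AE_eq[OF _ Omega_open])
    show "AE x in \<mu>. u x - Gk k (u x) = Tk k (u x)" by (simp add: Gk_def)
    show "AE x in \<mu>. Du x - wgrad \<Omega> (\<lambda>x. Gk k (u x)) x = (if u x \<le> k then Du x else 0)"
      using wgrad_Gk[OF k] by eventually_elim simp
  qed
qed

text \<open>
The gradient of \<open>\<eta> \<phi> T\<^sub>k(u)\<close> is computed twice: as \<open>\<eta>\<close> times the function in question, and as the product of
\<open>\<phi>\<close> with \<open>\<eta> T\<^sub>k(u)\<close>, both of which are in \<open>H\<^sub>0\<^sup>1\<close>.
\<close>

lemma wgrad_mult_Tk:
  assumes k: "k > 0" and \<phi>: "\<phi> \<in> H10 \<Omega> \<inter> Linf \<Omega>"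
  shows "AE x in \<mu>. wgrad \<Omega> (\<lambda>x. \<phi> x * Tk k (u x)) x
      = Tk k (u x) *\<^sub>R wgrad \<Omega> \<phi> x + \<phi> x *\<^sub>R (if u x \<le> k then Du x else 0)"
proof (rule AE_eq_of_test_fun_mult)
  fix \<eta> assume \<eta>: "\<eta> \<in> test_fun \<Omega>"
  have \<phi>l: "H10_limit \<Omega> \<phi> (wgrad \<Omega> \<phi>)" using \<phi> H10_imp_H10_limit by blast
  have \<eta>T: "H10_limit \<Omega> (\<lambda>x. \<eta> x * Tk k (u x)) (\<lambda>x. \<eta> x *\<^sub>R (if u x \<le> k then Du x else 0) + Tk k (u x) *\<^sub>R grad \<eta> x)"
  proof -
    have l: "H10_limit \<Omega> (\<lambda>x. \<eta> x * Tk k (u x)) (wgrad \<Omega> (\<lambda>x. \<eta> x * Tk k (u x)))"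
      by (intro H10_imp_H10_limit Tk_H10 k test_fun_H10_Linf \<eta>)
    show ?thesis
      by (rule H10_limit_AE_eq[OF l weak_gradient_unique[OF Omega_open H10_limit_weak_gradient[OF l]
            weak_gradient_test_fun_mult[OF Omega_open weak_gradient_Tk[OF k] \<eta>]]])
  qed
  have 1: "weak_gradient \<Omega> (\<lambda>x. \<eta> x * (\<phi> x * Tk k (u x)))
     (\<lambda>x. \<phi> x *\<^sub>R (\<eta> x *\<^sub>R (if u x \<le> k then Du x else 0) + Tk k (u x) *\<^sub>R grad \<eta> x)
        + (\<eta> x * Tk k (u x)) *\<^sub>R wgrad \<Omega> \<phi> x)"
    using H10_limit_product[OF \<phi>l \<eta>T] by (simp only: mult.left_commute[of "\<phi> _" "\<eta> _"])
  have 2: "weak_gradient \<Omega> (\<lambda>x. \<eta> x * (\<phi> x * Tk k (u x)))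
     (\<lambda>x. \<eta> x *\<^sub>R wgrad \<Omega> (\<lambda>x. \<phi> x * Tk k (u x)) x + (\<phi> x * Tk k (u x)) *\<^sub>R grad \<eta> x)"
    by (intro weak_gradient_test_fun_mult Omega_open H10_limit_weak_gradient H10_imp_H10_limit Tk_H10 k \<phi> \<eta>)
  show "AE x in \<mu>. \<eta> x *\<^sub>R wgrad \<Omega> (\<lambda>x. \<phi> x * Tk k (u x)) x
      = \<eta> x *\<^sub>R (Tk k (u x) *\<^sub>R wgrad \<Omega> \<phi> x + \<phi> x *\<^sub>R (if u x \<le> k then Du x else 0))"
    using weak_gradient_unique[OF Omega_open 2 1]
  proof eventually_elim
    case (elim x)
    have cancel: "e *\<^sub>R W = e *\<^sub>R (t *\<^sub>R p + f *\<^sub>R d)"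
      if "e *\<^sub>R W + (f * t) *\<^sub>R g = f *\<^sub>R (e *\<^sub>R d + t *\<^sub>R g) + (e * t) *\<^sub>R p"
      for e f t :: real and W d g p :: "real^'n"
    proof -
      have "e *\<^sub>R W = f *\<^sub>R (e *\<^sub>R d + t *\<^sub>R g) + (e * t) *\<^sub>R p - (f * t) *\<^sub>R g"
        using that by (simp only: eq_diff_eq)
      then show ?thesis by (simp add: algebra_simps)
    qed
    show ?case by (rule cancel[OF elim])
  qed
qed

text \<open>
\<open>\<phi> Du\<close> is recovered from \<open>D(\<phi> T\<^sub>1(u))\<close> on \<open>{u \<le> 1}\<close> and from \<open>D G\<^sub>1(u)\<close> on \<open>{u > 1}\<close>.
\<close>

lemma mult_Du_Lp_2:
  assumes \<phi>: "\<phi> \<in> H10 \<Omega> \<inter> Linf \<Omega>"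
  shows "(\<lambda>x. \<phi> x *\<^sub>R Du x) \<in> Lp 2 \<Omega>"
proof (rule Lp_2_AE_eq[OF Omega_sets])
  let ?f = "\<lambda>x. wgrad \<Omega> (\<lambda>x. \<phi> x * Tk 1 (u x)) x - Tk 1 (u x) *\<^sub>R wgrad \<Omega> \<phi> x
      + \<phi> x *\<^sub>R wgrad \<Omega> (\<lambda>x. Gk 1 (u x)) x"
  have "\<phi> \<in> H10 \<Omega>" "\<phi> \<in> Linf \<Omega>" using \<phi> by auto
  then show "?f \<in> Lp 2 \<Omega>"
    by (intro Lp_2_add Lp_2_diff Lp_2_Linf_scaleR wgrad_H10_Lp_2 Gk_H10 Tk_H10 Tk_Linf \<phi>) simp_all
  show "AE x in \<mu>. ?f x = \<phi> x *\<^sub>R Du x"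
    using wgrad_mult_Tk[OF zero_less_one \<phi>] wgrad_Gk[OF zero_less_one]
    by eventually_elim (simp add: not_le)
qed

lemma indicator_Du_Lp_2: "k > 0 \<Longrightarrow> (\<lambda>x. if u x > k then Du x else 0) \<in> Lp 2 \<Omega>"
  by (rule Lp_2_AE_eq[OF Omega_sets wgrad_H10_Lp_2[OF Gk_H10] wgrad_Gk])

end

section \<open>Coefficient matrices\<close>

lemma Lp_2_sum:
  "(\<And>i. i \<in> J \<Longrightarrow> f i \<in> Lp 2 S) \<Longrightarrow> S \<in> lmeasurable \<Longrightarrow> (\<lambda>x. \<Sum>i\<in>J. f i x) \<in> Lp 2 S"
proof (induction J rule: infinite_finite_induct)
  case (insert i J)
  then show ?case by (auto intro!: Lp_2_add)
qed (auto intro: Lp_2_bounded[where C=0])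

lemma Lp_2_matrix_vector:
  fixes A :: "real^'n \<Rightarrow> real^'n^'n"
  assumes A: "\<And>i j. (\<lambda>x. A x $ i $ j) \<in> Linf S" and X: "X \<in> Lp 2 S" and S: "S \<in> lmeasurable"
  shows "(\<lambda>x. transpose (A x) *v X x) \<in> Lp 2 S"
proof -
  have Xj: "(\<lambda>x. X x $ j) \<in> Lp 2 S" for j
  proof (rule Lp_2_bound[OF X])
    show "(\<lambda>x. X x $ j) \<in> borel_measurable (lebesgue_on S)"
      using continuous_compose_measurable[OF continuous_on_component[OF continuous_on_id] Lp_2_measurable[OF X]]
      by simp
    show "AE x in lebesgue_on S. norm (X x $ j) \<le> norm (X x)"
      unfolding real_norm_def by (intro AE_I2 component_le_norm_cart)
  qed
  have "(\<lambda>x. (A x $ j $ i * X x $ j) *\<^sub>R (axis i 1 :: real^'n)) \<in> Lp 2 S" for i j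
  proof -
    have "(\<lambda>x. A x $ j $ i *\<^sub>R X x $ j) \<in> Lp 2 S" by (rule Lp_2_Linf_scaleR[OF A Xj])
    from this[unfolded real_scaleR_def] show ?thesis
      by (rule Lp_2_bilinear_bounded[OF bounded_bilinear_scaleR, where g="\<lambda>x. axis i 1"
            and C="norm (axis i 1 :: real^'n)"]) simp_all
  qed
  then have "(\<lambda>x. \<Sum>i\<in>UNIV. \<Sum>j\<in>UNIV. (A x $ j $ i * X x $ j) *\<^sub>R (axis i 1 :: real^'n)) \<in> Lp 2 S"
    by (intro Lp_2_sum S)
  moreover have "transpose (A x) *v X x = (\<Sum>i\<in>UNIV. \<Sum>j\<in>UNIV. (A x $ j $ i * X x $ j) *\<^sub>R (axis i 1 :: real^'n))" for x
  proof -
    have "transpose (A x) *v X x = (\<Sum>i\<in>UNIV. (transpose (A x) *v X x) $ i *\<^sub>R axis i 1)"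
      using basis_expansion[of "transpose (A x) *v X x"] by (simp only: scalar_mult_eq_scaleR)
    then show ?thesis
      by (simp only: matrix_vector_mult_def transpose_def vec_lambda_beta scaleR_sum_left)
  qed
  ultimately show ?thesis by simp
qed

lemma inner_transpose_matrix: "(transpose (A :: real^'n^'n) *v x) \<bullet> y = x \<bullet> (A *v y)"
  by (simp add: dot_lmul_matrix)

context truncatable begin

text \<open>
The left-hand side of the equation that defines solutions, with \<open>X\<close> in place of \<open>\<^sup>tA Dv\<close>.
\<close>

abbreviation sol_lhs where
  "sol_lhs k X J \<phi> g f \<equiv>
     (\<integral>x. X x \<bullet> wgrad \<Omega> (\<lambda>y. Gk k (u y)) x \<partial>\<mu>)
     + (\<Sum>i\<in>J. \<integral>x. g i x \<bullet> wgrad \<Omega> (\<lambda>y. \<phi> i y * Tk k (u y)) x \<partial>\<mu>)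
     + (\<integral>x. f x * Tk k (u x) \<partial>\<mu>)"

definition sol_integrand ::
  "real \<Rightarrow> (real^'n \<Rightarrow> real^'n) \<Rightarrow> nat set \<Rightarrow> (nat \<Rightarrow> real^'n \<Rightarrow> real) \<Rightarrow> (nat \<Rightarrow> real^'n \<Rightarrow> real^'n)
    \<Rightarrow> (real^'n \<Rightarrow> real) \<Rightarrow> real^'n \<Rightarrow> real" where
  "sol_integrand k X J \<phi> g f x = X x \<bullet> (if u x > k then Du x else 0)
     + ((\<Sum>i\<in>J. g i x \<bullet> wgrad \<Omega> (\<phi> i) x) + f x) * Tk k (u x)
     + (if u x \<le> k then 1 else 0) * (\<Sum>i\<in>J. \<phi> i x * (g i x \<bullet> Du x))"

text \<open>
The gradients of the truncations are inserted and everything is gathered into a single integral. In this form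
equations for different levels or different test functions can be compared pointwise.
\<close>

lemma solution_integrals:
  assumes k: "k > 0" and I: "finite I" and \<phi>: "\<And>i. i \<in> I \<Longrightarrow> \<phi>h i \<in> H10 \<Omega> \<inter> Linf \<Omega>"
    and g: "\<And>i. i \<in> I \<Longrightarrow> gh i \<in> Lp 2 \<Omega>" and f: "fh \<in> Lp 1 \<Omega>" and X: "X \<in> Lp 2 \<Omega>"
  shows "integrable \<mu> (sol_integrand k X I \<phi>h gh fh)"
    and "sol_lhs k X I \<phi>h gh fh = (\<integral>x. sol_integrand k X I \<phi>h gh fh x \<partial>\<mu>)"
proof -
  define a where "a = (\<lambda>x. X x \<bullet> (if u x > k then Du x else 0))"
  define b where "b = (\<lambda>i x. (gh i x \<bullet> wgrad \<Omega> (\<phi>h i) x) * Tk k (u x)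
      + (if u x \<le> k then 1 else 0) * (\<phi>h i x * (gh i x \<bullet> Du x)))"
  define c where "c = (\<lambda>x. fh x * Tk k (u x))"
  have ai: "integrable \<mu> a"
    unfolding a_def by (rule Lp_2_bilinear_integrable[OF bounded_bilinear_inner X indicator_Du_Lp_2[OF k]])
  have aI: "(\<integral>x. X x \<bullet> wgrad \<Omega> (\<lambda>y. Gk k (u y)) x \<partial>\<mu>) = (\<integral>x. a x \<partial>\<mu>)"
    by (rule integral_AE_eq[OF Omega_sets Lp_2_bilinear_integrable[OF bounded_bilinear_inner X wgrad_H10_Lp_2[OF Gk_H10[OF k]]]])
       (use wgrad_Gk[OF k] in eventually_elim, simp only: a_def)
  have b: "integrable \<mu> (b i)"
    "(\<integral>x. gh i x \<bullet> wgrad \<Omega> (\<lambda>y. \<phi>h i y * Tk k (u y)) x \<partial>\<mu>) = (\<integral>x. b i x \<partial>\<mu>)"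
    if i: "i \<in> I" for i
  proof -
    have ae: "AE x in \<mu>. gh i x \<bullet> wgrad \<Omega> (\<lambda>y. \<phi>h i y * Tk k (u y)) x = b i x"
      using wgrad_mult_Tk[OF k \<phi>[OF i]]
      by eventually_elim (simp add: b_def inner_add_right mult.commute)
    have int: "integrable \<mu> (\<lambda>x. gh i x \<bullet> wgrad \<Omega> (\<lambda>y. \<phi>h i y * Tk k (u y)) x)"
      by (rule Lp_2_bilinear_integrable[OF bounded_bilinear_inner g[OF i] wgrad_H10_Lp_2[OF Tk_H10[OF k \<phi>[OF i]]]])
    show "(\<integral>x. gh i x \<bullet> wgrad \<Omega> (\<lambda>y. \<phi>h i y * Tk k (u y)) x \<partial>\<mu>) = (\<integral>x. b i x \<partial>\<mu>)"
      by (rule integral_AE_eq[OF Omega_sets int ae])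
    show "integrable \<mu> (b i)"
      using integrable_cong_AE[OF borel_measurable_integrable[OF int]
          borel_measurable_AE_eq[OF Omega_sets borel_measurable_integrable[OF int] ae] ae] int by blast
  qed
  have ci: "integrable \<mu> c"
    unfolding c_def
    by (rule integrable_bilinear_bounded[OF bounded_bilinear_mult _ Linf_measurable[OF Tk_Linf[OF k]], of _ k])
       (use f Lp_1_iff Tk_bound[OF k] in auto)
  have bi: "integrable \<mu> (\<lambda>x. \<Sum>i\<in>I. b i x)"
    by (rule Bochner_Integration.integrable_sum[OF b(1)])
  have E: "sol_integrand k X I \<phi>h gh fh = (\<lambda>x. a x + (\<Sum>i\<in>I. b i x) + c x)"
    unfolding a_def b_def c_def
    by (simp add: sol_integrand_def sum.distrib sum_distrib_right sum_distrib_left distrib_right fun_eq_iff)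
  show "integrable \<mu> (sol_integrand k X I \<phi>h gh fh)"
    unfolding E by (intro Bochner_Integration.integrable_add ai bi ci)
  show "sol_lhs k X I \<phi>h gh fh = (\<integral>x. sol_integrand k X I \<phi>h gh fh x \<partial>\<mu>)"
  proof -
    have sum: "(\<Sum>i\<in>I. \<integral>x. gh i x \<bullet> wgrad \<Omega> (\<lambda>y. \<phi>h i y * Tk k (u y)) x \<partial>\<mu>)
        = (\<integral>x. (\<Sum>i\<in>I. b i x) \<partial>\<mu>)"
      using b by simp
    show ?thesis
      unfolding E Bochner_Integration.integral_add[OF Bochner_Integration.integrable_add[OF ai bi] ci]
        Bochner_Integration.integral_add[OF ai bi] aI sum by (simp only: c_def)
  qed
qed

end

section \<open>The test function \<open>Z\<^sub>\<delta>(u) v\<close>\<close>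

locale truncated_test = truncatable \<Omega> u for \<Omega> :: "(real^'n) set" and u :: "real^'n \<Rightarrow> real" +
  fixes A :: "real^'n \<Rightarrow> real^'n^'n" and v :: "real^'n \<Rightarrow> real" and I :: "nat set"
    and \<phi>h :: "nat \<Rightarrow> real^'n \<Rightarrow> real" and gh :: "nat \<Rightarrow> real^'n \<Rightarrow> real^'n" and fh :: "real^'n \<Rightarrow> real"
    and \<delta> :: real
  assumes A_Linf: "\<And>i j. (\<lambda>x. A x $ i $ j) \<in> Linf \<Omega>"
    and v: "v \<in> H10 \<Omega> \<inter> Linf \<Omega>"
    and rep: "V_rep \<Omega> A v I \<phi>h gh fh"
    and \<delta>: "\<delta> > 0"
begin

lemma rep_data: "finite I" "i \<in> I \<Longrightarrow> \<phi>h i \<in> H10 \<Omega> \<inter> Linf \<Omega>" "i \<in> I \<Longrightarrow> gh i \<in> Lp 2 \<Omega>" "fh \<in> Lp 1 \<Omega>"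
  using rep unfolding V_rep_def by blast+

abbreviation Dv where "Dv \<equiv> wgrad \<Omega> v"

text \<open>
The function \<open>w\<close> is \<open>1 - Z\<^sub>\<delta>(u)\<close> written with truncations, for which the gradient is known; on the null
set where \<open>u < 0\<close> the two may differ. Accordingly \<open>z\<close> is \<open>Z\<^sub>\<delta>(u) v\<close> almost everywhere.
\<close>

definition w :: "real^'n \<Rightarrow> real" where "w x = (Tk (2 * \<delta>) (u x) - Tk \<delta> (u x)) / \<delta>"

definition Dw :: "real^'n \<Rightarrow> real^'n" where
  "Dw x = (if \<delta> < u x \<and> u x \<le> 2 * \<delta> then (1 / \<delta>) *\<^sub>R Du x else 0)"

definition z :: "real^'n \<Rightarrow> real" where "z x = v x - v x * w x"

definition Dz :: "real^'n \<Rightarrow> real^'n" where "Dz x = Dv x - (v x *\<^sub>R Dw x + w x *\<^sub>R Dv x)"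

lemma H10_limit_v: "H10_limit \<Omega> v Dv"
  using v H10_imp_H10_limit by blast

lemma H10_limit_w: "H10_limit \<Omega> w Dw"
proof -
  have \<delta>2: "2 * \<delta> > 0" using \<delta> by simp
  have l: "H10_limit \<Omega> (\<lambda>x. (1 / \<delta>) * (Gk \<delta> (u x) - Gk (2 * \<delta>) (u x)))
     (\<lambda>x. (1 / \<delta>) *\<^sub>R (wgrad \<Omega> (\<lambda>x. Gk \<delta> (u x)) x - wgrad \<Omega> (\<lambda>x. Gk (2 * \<delta>) (u x)) x))"
    by (intro H10_limit_scale H10_limit_diff H10_imp_H10_limit Gk_H10 \<delta> \<delta>2)
  have w: "(\<lambda>x. (1 / \<delta>) * (Gk \<delta> (u x) - Gk (2 * \<delta>) (u x))) = w"
    by (simp add: w_def Gk_def fun_eq_iff)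
  have ae: "AE x in \<mu>.
      (1 / \<delta>) *\<^sub>R (wgrad \<Omega> (\<lambda>x. Gk \<delta> (u x)) x - wgrad \<Omega> (\<lambda>x. Gk (2 * \<delta>) (u x)) x) = Dw x"
    using wgrad_Gk[OF \<delta>] wgrad_Gk[OF \<delta>2] by eventually_elim (use \<delta> in \<open>simp add: Dw_def\<close>)
  show ?thesis by (rule H10_limit_AE_eq[OF l[unfolded w] ae])
qed

lemma w_abs: "\<bar>w x\<bar> \<le> 1"
  using \<delta> by (simp add: w_def Tk_def abs_divide divide_le_eq)

lemma w_bounds: "u x \<ge> 0 \<Longrightarrow> 0 \<le> w x" "w x \<le> 1"
proof -
  show "w x \<le> 1" using w_abs[of x] by linarith
  assume "u x \<ge> 0"
  then have "w x = (min (u x) (2 * \<delta>) - min (u x) \<delta>) / \<delta>"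
    using \<delta> by (simp add: w_def Tk_nonneg)
  moreover have "min (u x) \<delta> \<le> min (u x) (2 * \<delta>)" using \<delta> by (intro min.mono) auto
  ultimately show "0 \<le> w x" using \<delta> by simp
qed

lemma w_measurable[measurable]: "w \<in> borel_measurable \<mu>"
  by (rule Lp_2_measurable[OF H10_limit_Lp_2(1)[OF H10_limit_w]])

lemma w_H10_Linf: "w \<in> H10 \<Omega> \<inter> Linf \<Omega>"
proof
  show "w \<in> H10 \<Omega>" by (rule H10_limit_imp_H10[OF H10_limit_w])
  show "w \<in> Linf \<Omega>" unfolding Linf_def using w_measurable w_abs by blast
qed

lemma w_eq:
  "u x \<ge> 0 \<Longrightarrow> u x \<le> \<delta> \<Longrightarrow> w x = 0" "u x \<ge> 2 * \<delta> \<Longrightarrow> w x = 1"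
  "\<delta> \<le> u x \<Longrightarrow> u x \<le> 2 * \<delta> \<Longrightarrow> w x = (u x - \<delta>) / \<delta>"
  using \<delta> by (simp_all add: w_def Tk_nonneg)

lemma Zd_eq: "u x \<ge> 0 \<Longrightarrow> Zd \<delta> (u x) = 1 - w x"
  using \<delta> w_eq[of x] by (auto simp: Zd_def diff_divide_distrib)

lemma z_eq: "u x \<ge> 0 \<Longrightarrow> z x = v x * Zd \<delta> (u x)"
  by (simp add: Zd_eq z_def algebra_simps)

text \<open>
That \<open>v w\<close> lies in \<open>H\<^sub>0\<^sup>1\<close> comes from the assumption on \<open>v T\<^sub>k(u)\<close>; its gradient comes from the product rule.
\<close>

lemma H10_limit_z: "H10_limit \<Omega> z Dz"
proof -
  have \<delta>2: "2 * \<delta> > 0" using \<delta> by simp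
  have "H10_limit \<Omega> (\<lambda>x. (1 / \<delta>) * (v x * Tk (2 * \<delta>) (u x) - v x * Tk \<delta> (u x)))
     (\<lambda>x. (1 / \<delta>) *\<^sub>R (wgrad \<Omega> (\<lambda>x. v x * Tk (2 * \<delta>) (u x)) x - wgrad \<Omega> (\<lambda>x. v x * Tk \<delta> (u x)) x))"
    (is "H10_limit _ _ ?G")
    by (intro H10_limit_scale H10_limit_diff H10_imp_H10_limit Tk_H10 \<delta> \<delta>2 v)
  moreover have "(\<lambda>x. (1 / \<delta>) * (v x * Tk (2 * \<delta>) (u x) - v x * Tk \<delta> (u x))) = (\<lambda>x. v x * w x)"
    by (simp add: w_def fun_eq_iff right_diff_distrib diff_divide_distrib)
  ultimately have l: "H10_limit \<Omega> (\<lambda>x. v x * w x) ?G" by simp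
  have "H10_limit \<Omega> (\<lambda>x. v x * w x) (\<lambda>x. v x *\<^sub>R Dw x + w x *\<^sub>R Dv x)"
    by (rule H10_limit_AE_eq[OF l weak_gradient_unique[OF Omega_open H10_limit_weak_gradient[OF l]
          H10_limit_product[OF H10_limit_v H10_limit_w]]])
  from H10_limit_diff[OF H10_limit_v this]
  show ?thesis by (simp only: z_def[abs_def] Dz_def[abs_def])
qed

lemma z_H10_Linf: "z \<in> H10 \<Omega> \<inter> Linf \<Omega>"
proof
  show "z \<in> H10 \<Omega>" by (rule H10_limit_imp_H10[OF H10_limit_z])
  obtain C where "AE x in \<mu>. \<bar>v x\<bar> \<le> C" using v by (auto simp: Linf_def)
  then have "AE x in \<mu>. \<bar>z x\<bar> \<le> C"
    using u_nonneg
  proof eventually_elim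
    case (elim x)
    have "\<bar>z x\<bar> = \<bar>v x\<bar> * \<bar>1 - w x\<bar>" by (simp add: z_def abs_mult[symmetric] algebra_simps)
    also have "\<dots> \<le> \<bar>v x\<bar> * 1" using w_bounds[of x] elim(2) by (intro mult_left_mono) auto
    finally show ?case using elim by simp
  qed
  then show "z \<in> Linf \<Omega>"
    unfolding Linf_def using Lp_2_measurable[OF H10_limit_Lp_2(1)[OF H10_limit_z]] by blast
qed

abbreviation tA where "tA X \<equiv> (\<lambda>x. transpose (A x) *v X x)"

lemma tA_Lp_2: "X \<in> Lp 2 \<Omega> \<Longrightarrow> tA X \<in> Lp 2 \<Omega>"
  by (rule Lp_2_matrix_vector[OF A_Linf _ Omega_lmeasurable])

lemma wgrad_mult_test_fun:
  assumes f: "H10_limit \<Omega> f F" and \<eta>: "\<eta> \<in> test_fun \<Omega>"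
  shows "AE x in \<mu>. wgrad \<Omega> (\<lambda>y. f y * \<eta> y) x = \<eta> x *\<^sub>R F x + f x *\<^sub>R grad \<eta> x"
    and "(\<lambda>x. \<eta> x *\<^sub>R F x + f x *\<^sub>R grad \<eta> x) \<in> Lp 2 \<Omega>"
  using wgrad_H10_limit[OF H10_limit_test_fun_mult[OF f \<eta>]] H10_limit_Lp_2(2)[OF H10_limit_test_fun_mult[OF f \<eta>]]
  by (simp_all only: mult.commute[of "\<eta> _"])

text \<open>
With \<open>D(f \<eta>) = f D\<eta> + \<eta> Df\<close> for \<open>f = v, w\<close>, the product rule
\<open>\<^sup>tA D(v w) \<bullet> D\<eta> = \<^sup>tA Dv \<bullet> D(w \<eta>) + \<^sup>tA Dw \<bullet> D(v \<eta>) - (\<^sup>tA Dv \<bullet> Dw + \<^sup>tA Dw \<bullet> Dv) \<eta>\<close> holds pointwise.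
\<close>

lemma V_rep_z:
  assumes p: "p \<notin> I" and q: "q \<notin> I" "q \<noteq> p"
  shows "V_rep \<Omega> A z (insert p (insert q I)) (\<phi>h(p := w, q := v))
    (gh(p := \<lambda>x. - tA Dv x, q := \<lambda>x. - tA Dw x))
    (\<lambda>x. fh x + (tA Dv x \<bullet> Dw x + tA Dw x \<bullet> Dv x))"
  unfolding V_rep_def
proof (intro conjI ballI)
  have Dv2: "Dv \<in> Lp 2 \<Omega>" and Dw2: "Dw \<in> Lp 2 \<Omega>"
    using H10_limit_Lp_2(2)[OF H10_limit_v] H10_limit_Lp_2(2)[OF H10_limit_w] .
  note tDv = tA_Lp_2[OF Dv2] and tDw = tA_Lp_2[OF Dw2]
  show "finite (insert p (insert q I))" using rep_data(1) by simp
  show "(\<phi>h(p := w, q := v)) i \<in> H10 \<Omega> \<inter> Linf \<Omega>" if "i \<in> insert p (insert q I)" for i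
    using that rep_data(2)[of i] w_H10_Linf v by auto
  show "(gh(p := \<lambda>x. - tA Dv x, q := \<lambda>x. - tA Dw x)) i \<in> Lp 2 \<Omega>" if "i \<in> insert p (insert q I)" for i
    using that rep_data(3)[of i] Lp_2_scaleR[OF tDv, of "-1"] Lp_2_scaleR[OF tDw, of "-1"] by auto
  have di: "integrable \<mu> (\<lambda>x. tA Dv x \<bullet> Dw x + tA Dw x \<bullet> Dv x)"
    by (intro Bochner_Integration.integrable_add Lp_2_bilinear_integrable[OF bounded_bilinear_inner] tDv tDw Dv2 Dw2)
  have fi: "integrable \<mu> fh" using rep_data(4) by (simp only: Lp_1_iff)
  show "(\<lambda>x. fh x + (tA Dv x \<bullet> Dw x + tA Dw x \<bullet> Dv x)) \<in> Lp 1 \<Omega>"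
    unfolding Lp_1_iff by (rule Bochner_Integration.integrable_add[OF fi di])
  fix \<eta> assume \<eta>: "\<eta> \<in> test_fun \<Omega>"
  obtain C where C: "C > 0" "\<And>x. \<bar>\<eta> x\<bar> \<le> C" "\<And>x. norm (grad \<eta> x) \<le> C"
    using test_fun_bounded[OF \<eta>] by blast
  note \<eta>m = test_fun_measurable[OF \<eta>]
  define a where "a = (\<lambda>x. tA Dv x \<bullet> grad \<eta> x)"
  define b where "b = (\<lambda>x. - tA Dv x \<bullet> (\<eta> x *\<^sub>R Dw x + w x *\<^sub>R grad \<eta> x))"
  define c where "c = (\<lambda>x. - tA Dw x \<bullet> (\<eta> x *\<^sub>R Dv x + v x *\<^sub>R grad \<eta> x))"
  define d where "d = (\<lambda>x. (tA Dv x \<bullet> Dw x + tA Dw x \<bullet> Dv x) * \<eta> x)"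
  have mDv: "(\<lambda>x. - tA Dv x) \<in> Lp 2 \<Omega>" and mDw: "(\<lambda>x. - tA Dw x) \<in> Lp 2 \<Omega>"
    using Lp_2_scaleR[OF tDv, of "-1"] Lp_2_scaleR[OF tDw, of "-1"] by simp_all
  have ai: "integrable \<mu> a"
    unfolding a_def by (rule Lp_2_bilinear_integrable[OF bounded_bilinear_inner tDv test_fun_Lp_2(2)[OF \<eta>]])
  have bi: "integrable \<mu> b"
    unfolding b_def
    by (rule Lp_2_bilinear_integrable[OF bounded_bilinear_inner mDv wgrad_mult_test_fun(2)[OF H10_limit_w \<eta>]])
  have ci: "integrable \<mu> c"
    unfolding c_def
    by (rule Lp_2_bilinear_integrable[OF bounded_bilinear_inner mDw wgrad_mult_test_fun(2)[OF H10_limit_v \<eta>]])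
  have di': "integrable \<mu> d"
    unfolding d_def by (rule integrable_bilinear_bounded[OF bounded_bilinear_mult di \<eta>m, of C]) (simp add: C)
  have fi': "integrable \<mu> (\<lambda>x. fh x * \<eta> x)"
    by (rule integrable_bilinear_bounded[OF bounded_bilinear_mult fi \<eta>m, of C]) (simp add: C)
  have z: "neg_div \<Omega> (tA (wgrad \<Omega> z)) \<eta> = (\<integral>x. a x + b x + c x + d x \<partial>\<mu>)"
    unfolding neg_div_def
  proof (rule integral_AE_eq[OF Omega_sets])
    show "integrable \<mu> (\<lambda>x. tA (wgrad \<Omega> z) x \<bullet> grad \<eta> x)"
      by (rule Lp_2_bilinear_integrable[OF bounded_bilinear_inner tA_Lp_2 test_fun_Lp_2(2)[OF \<eta>]])
         (use wgrad_H10_Lp_2 z_H10_Linf in blast)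
    show "AE x in \<mu>. tA (wgrad \<Omega> z) x \<bullet> grad \<eta> x = a x + b x + c x + d x"
      using wgrad_H10_limit[OF H10_limit_z]
    proof eventually_elim
      case (elim x)
      show ?case
        unfolding elim Dz_def a_def b_def c_def d_def
        by (simp add: matrix_vector_right_distrib matrix_vector_mult_diff_distrib matrix_vector_mult_scaleR
            inner_simps algebra_simps)
    qed
  qed
  have b: "mult_neg_div \<Omega> w (\<lambda>x. - tA Dv x) \<eta> = (\<integral>x. b x \<partial>\<mu>)"
    unfolding mult_neg_div_def
  proof (rule integral_AE_eq[OF Omega_sets, symmetric, OF bi])
    show "AE x in \<mu>. b x = - tA Dv x \<bullet> wgrad \<Omega> (\<lambda>y. w y * \<eta> y) x"
      using wgrad_mult_test_fun(1)[OF H10_limit_w \<eta>] by eventually_elim (simp only: b_def)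
  qed
  have c: "mult_neg_div \<Omega> v (\<lambda>x. - tA Dw x) \<eta> = (\<integral>x. c x \<partial>\<mu>)"
    unfolding mult_neg_div_def
  proof (rule integral_AE_eq[OF Omega_sets, symmetric, OF ci])
    show "AE x in \<mu>. c x = - tA Dw x \<bullet> wgrad \<Omega> (\<lambda>y. v y * \<eta> y) x"
      using wgrad_mult_test_fun(1)[OF H10_limit_v \<eta>] by eventually_elim (simp only: c_def)
  qed
  have a: "(\<integral>x. a x \<partial>\<mu>)
      = (\<Sum>i\<in>I. mult_neg_div \<Omega> (\<phi>h i) (gh i) \<eta>) + (\<integral>x. fh x * \<eta> x \<partial>\<mu>)"
    using rep \<eta> unfolding V_rep_def neg_div_def a_def by blast
  have d: "(\<integral>x. (fh x + (tA Dv x \<bullet> Dw x + tA Dw x \<bullet> Dv x)) * \<eta> x \<partial>\<mu>)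
      = (\<integral>x. fh x * \<eta> x \<partial>\<mu>) + (\<integral>x. d x \<partial>\<mu>)"
    unfolding distrib_right[of "fh _"] d_def by (rule Bochner_Integration.integral_add[OF fi' di'[unfolded d_def]])
  have abcd: "(\<integral>x. a x + b x + c x + d x \<partial>\<mu>) = (\<integral>x. a x \<partial>\<mu>) + (\<integral>x. b x \<partial>\<mu>)
      + (\<integral>x. c x \<partial>\<mu>) + (\<integral>x. d x \<partial>\<mu>)"
    using ai bi ci di' by simp
  have sum: "(\<Sum>i\<in>insert p (insert q I). mult_neg_div \<Omega> ((\<phi>h(p := w, q := v)) i)
        ((gh(p := \<lambda>x. - tA Dv x, q := \<lambda>x. - tA Dw x)) i) \<eta>)
     = (\<integral>x. b x \<partial>\<mu>) + (\<integral>x. c x \<partial>\<mu>) + (\<Sum>i\<in>I. mult_neg_div \<Omega> (\<phi>h i) (gh i) \<eta>)"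
  proof -
    have "(\<Sum>i\<in>I. mult_neg_div \<Omega> ((\<phi>h(p := w, q := v)) i) ((gh(p := \<lambda>x. - tA Dv x, q := \<lambda>x. - tA Dw x)) i) \<eta>)
       = (\<Sum>i\<in>I. mult_neg_div \<Omega> (\<phi>h i) (gh i) \<eta>)"
      using p q by (intro sum.cong) auto
    then show ?thesis using p q rep_data(1) b c by simp
  qed
  show "neg_div \<Omega> (tA (wgrad \<Omega> z)) \<eta>
      = (\<Sum>i\<in>insert p (insert q I). mult_neg_div \<Omega> ((\<phi>h(p := w, q := v)) i)
          ((gh(p := \<lambda>x. - tA Dv x, q := \<lambda>x. - tA Dw x)) i) \<eta>)
        + (\<integral>x. (fh x + (tA Dv x \<bullet> Dw x + tA Dw x \<bullet> Dv x)) * \<eta> x \<partial>\<mu>)"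
    unfolding z abcd sum a d by simp
qed

end

section \<open>Weighted identities\<close>

text \<open>
Subdivide \<open>[a, c]\<close> into \<open>n\<close> equal intervals: the increments of \<open>e\<close> sum up to at most
\<open>(c - a) (b c - b a) / n\<close>. Where \<open>b\<close> jumps, the hypothesis does not yield a zero derivative of \<open>e\<close>; hence
the summation instead of a differentiation.
\<close>

lemma constant_of_interval_bound:
  fixes e b :: "real \<Rightarrow> real"
  assumes bd: "\<And>k m. a \<le> k \<Longrightarrow> k \<le> m \<Longrightarrow> m \<le> c \<Longrightarrow> \<bar>e m - e k\<bar> \<le> (m - k) * (b m - b k)"
    and "a \<le> c"
  shows "e c = e a"
proof -
  have le: "\<bar>e c - e a\<bar> \<le> ((c - a) * (b c - b a)) * inverse (real (Suc n))" for n
  proof -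
    define N where "N = real (Suc n)"
    define h where "h = (c - a) / N"
    define x where "x = (\<lambda>j. a + real j * h)"
    have N: "N > 0" by (simp add: N_def)
    have Nh: "N * h = c - a" using N by (simp add: h_def)
    have step: "0 \<le> h" using N \<open>a \<le> c\<close> by (simp add: h_def)
    have x0: "x 0 = a" and xN: "x (Suc n) = c"
      using Nh by (simp_all add: x_def N_def)
    have xs: "x (Suc j) - x j = h" for j
      by (simp add: x_def algebra_simps)
    have xa: "a \<le> x j" for j using step by (simp add: x_def)
    have xc: "x (Suc j) \<le> c" if "j < Suc n" for j
    proof -
      have "real (Suc j) * h \<le> N * h"
        using that by (intro mult_right_mono step) (simp add: N_def)
      then show ?thesis using Nh by (simp add: x_def)
    qed
    have "\<bar>e c - e a\<bar> = \<bar>\<Sum>j<Suc n. e (x (Suc j)) - e (x j)\<bar>"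
      unfolding sum_lessThan_telescope[of "\<lambda>j. e (x j)"] x0 xN ..
    also have "\<dots> \<le> (\<Sum>j<Suc n. \<bar>e (x (Suc j)) - e (x j)\<bar>)" by (rule sum_abs)
    also have "\<dots> \<le> (\<Sum>j<Suc n. h * (b (x (Suc j)) - b (x j)))"
    proof (rule sum_mono)
      fix j assume "j \<in> {..<Suc n}"
      then have "x (Suc j) \<le> c" using xc by simp
      moreover have "x j \<le> x (Suc j)" using xs[of j] step by linarith
      ultimately have "\<bar>e (x (Suc j)) - e (x j)\<bar> \<le> (x (Suc j) - x j) * (b (x (Suc j)) - b (x j))"
        by (intro bd xa)
      then show "\<bar>e (x (Suc j)) - e (x j)\<bar> \<le> h * (b (x (Suc j)) - b (x j))"
        unfolding xs .
    qed
    also have "\<dots> = h * (b c - b a)"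
      unfolding sum_distrib_left[symmetric] sum_lessThan_telescope[of "\<lambda>j. b (x j)"] x0 xN ..
    finally show ?thesis by (simp add: h_def N_def divide_inverse mult_ac)
  qed
  have "(\<lambda>n. ((c - a) * (b c - b a)) * inverse (real (Suc n))) \<longlonglongrightarrow> ((c - a) * (b c - b a)) * 0"
    by (intro tendsto_mult tendsto_const LIMSEQ_inverse_real_of_nat)
  then have "\<bar>e c - e a\<bar> \<le> ((c - a) * (b c - b a)) * 0"
    by (rule LIMSEQ_le_const) (use le in blast)
  then show ?thesis by simp
qed

text \<open>
On \<open>[0, 2d]\<close> this is the primitive of \<open>1 - Z\<^sub>d\<close>, hence \<open>s - half_square d s\<close> is there the primitive of \<open>Z\<^sub>d\<close>.
\<close>

definition half_square :: "real \<Rightarrow> real \<Rightarrow> real" where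
  "half_square d s = (max 0 (s - d))\<^sup>2 / (2 * d)"

text \<open>
On \<open>[k, m]\<close> the derivative of \<open>half_square d\<close> differs from its value \<open>(k - d) / d\<close> at the left end by at
most \<open>(m - k) / d\<close>.
\<close>

lemma half_square_increment:
  fixes d k m s :: real
  assumes "0 < d" "d \<le> k" "k \<le> m"
  shows "\<bar>half_square d (min s m) - half_square d (min s k) - (k - d) / d * (min s m - min s k)\<bar>
     \<le> (m - k) / d * (min s m - min s k)"
proof (cases "s \<le> k")
  case True
  then have "min s m = s" "min s k = s" using assms by auto
  then show ?thesis by simp
next
  case False
  define b where "b = min s m"
  have k: "min s k = k" and b: "k \<le> b" "b \<le> m" using False assms by (auto simp: b_def)
  have "half_square d b - half_square d k - (k - d) / d * (b - k) = (b - k)\<^sup>2 / (2 * d)"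
    using assms b by (simp add: half_square_def power2_eq_square field_simps)
  moreover have "(b - k)\<^sup>2 / (2 * d) \<le> (m - k) / d * (b - k)"
  proof -
    have "(b - k)\<^sup>2 \<le> (m - k) * (b - k)"
      unfolding power2_eq_square using b by (intro mult_right_mono) auto
    moreover have "0 \<le> (m - k) * (b - k)" using b by simp
    ultimately have "(b - k)\<^sup>2 \<le> 2 * ((m - k) * (b - k))" by linarith
    then show ?thesis using assms(1) by (simp add: field_simps)
  qed
  moreover have "0 \<le> (b - k)\<^sup>2 / (2 * d)" using assms by simp
  ultimately show ?thesis unfolding k b_def[symmetric] by linarith
qed

lemma half_square_remainder:
  fixes d t :: real
  assumes "0 < d" "0 \<le> t" "t \<le> 2 * d"
  shows "0 \<le> t - half_square d t" "t - half_square d t \<le> 3 / 2 * d"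
proof -
  have "0 \<le> t - half_square d t \<and> t - half_square d t \<le> 3 / 2 * d"
  proof (cases "t \<le> d")
    case True
    then show ?thesis using assms by (simp add: half_square_def)
  next
    case False
    have "(t - d)\<^sup>2 \<le> d\<^sup>2" using False assms by (intro power_mono) auto
    moreover have "d\<^sup>2 \<le> d * t" unfolding power2_eq_square using False assms by (intro mult_left_mono) auto
    moreover have "0 \<le> d * t" using assms by simp
    ultimately have "(t - d)\<^sup>2 \<le> 2 * d * t" by linarith
    moreover have "0 \<le> (t - 2 * d)\<^sup>2" by simp
    then have "2 * d * t - (t - d)\<^sup>2 \<le> 3 * d * d" by (simp add: power2_eq_square algebra_simps)
    ultimately show ?thesis
      using False assms by (simp add: half_square_def field_simps power2_eq_square)
  qed
  then show "0 \<le> t - half_square d t" "t - half_square d t \<le> 3 / 2 * d" by auto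
qed

lemma continuous_on_half_square: "continuous_on UNIV (half_square d)"
  unfolding half_square_def[abs_def] divide_inverse by (intro continuous_intros)

context truncated_test begin

text \<open>
After the gradients of truncations have been inserted, the data of the representation enter the equations
only through the coefficients \<open>K\<close> of \<open>T\<^sub>k(u)\<close> and \<open>P\<close> of the indicator of \<open>{u \<le> k}\<close>.
\<close>

definition K :: "real^'n \<Rightarrow> real" where
  "K x = (\<Sum>i\<in>I. gh i x \<bullet> wgrad \<Omega> (\<phi>h i) x) + fh x"

definition P :: "real^'n \<Rightarrow> real" where
  "P x = (\<Sum>i\<in>I. \<phi>h i x * (gh i x \<bullet> Du x))"

text \<open>
The cut-off at level \<open>\<delta>\<close> is what makes \<open>H\<close> integrable: \<open>Du\<close> is square-integrable on \<open>{u > \<delta>}\<close>, but in general only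
locally on \<open>\<Omega>\<close>.
\<close>

definition H :: "real^'n \<Rightarrow> real" where
  "H x = (if u x > \<delta> then tA Dv x \<bullet> Du x - P x else 0)"

lemma K_integrable: "integrable \<mu> K"
  unfolding K_def[abs_def]
proof (intro Bochner_Integration.integrable_add Bochner_Integration.integrable_sum)
  show "integrable \<mu> fh" using rep_data(4) by (simp only: Lp_1_iff)
  show "integrable \<mu> (\<lambda>x. gh i x \<bullet> wgrad \<Omega> (\<phi>h i) x)" if "i \<in> I" for i
    using rep_data(2,3)[OF that] by (intro Lp_2_bilinear_integrable[OF bounded_bilinear_inner] wgrad_H10_Lp_2) auto
qed

lemma integrable_mult_bounded:
  fixes f g :: "real^'n \<Rightarrow> real"
  assumes "integrable \<mu> f" "g \<in> borel_measurable \<mu>" "\<And>x. \<bar>g x\<bar> \<le> C"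
  shows "integrable \<mu> (\<lambda>x. f x * g x)"
  by (rule integrable_bilinear_bounded[OF bounded_bilinear_mult assms(1,2), of C]) (simp add: assms(3))

lemma step_measurable:
  "(\<lambda>x. if u x > k then 1 else 0 :: real) \<in> borel_measurable \<mu>"
  "(\<lambda>x. if u x \<le> k then 1 else 0 :: real) \<in> borel_measurable \<mu>"
proof -
  have "(\<lambda>s::real. if s > k then 1 else 0 :: real) \<in> borel_measurable borel"
    "(\<lambda>s::real. if s \<le> k then 1 else 0 :: real) \<in> borel_measurable borel" by measurable
  from this[THEN measurable_compose[OF u_measurable]]
  show "(\<lambda>x. if u x > k then 1 else 0 :: real) \<in> borel_measurable \<mu>"
    "(\<lambda>x. if u x \<le> k then 1 else 0 :: real) \<in> borel_measurable \<mu>" .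
qed

lemma P_summand_integrable:
  assumes "i \<in> I"
  shows "integrable \<mu> (\<lambda>x. \<phi>h i x * (gh i x \<bullet> Du x))"
  using Lp_2_bilinear_integrable[OF bounded_bilinear_inner rep_data(3)[OF assms] mult_Du_Lp_2[OF rep_data(2)[OF assms]]]
  by (simp only: inner_scaleR_right)

lemma P_integrable: "integrable \<mu> P"
  unfolding P_def[abs_def] by (intro Bochner_Integration.integrable_sum P_summand_integrable)

lemma tA_Dv_Lp_2: "tA Dv \<in> Lp 2 \<Omega>"
  by (rule tA_Lp_2[OF H10_limit_Lp_2(2)[OF H10_limit_v]])

lemma H_integrable: "integrable \<mu> H"
proof -
  have "integrable \<mu> (\<lambda>x. tA Dv x \<bullet> (if u x > \<delta> then Du x else 0) - P x * (if u x > \<delta> then 1 else 0))"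
  proof (rule Bochner_Integration.integrable_diff)
    show "integrable \<mu> (\<lambda>x. tA Dv x \<bullet> (if u x > \<delta> then Du x else 0))"
      by (rule Lp_2_bilinear_integrable[OF bounded_bilinear_inner tA_Dv_Lp_2 indicator_Du_Lp_2[OF \<delta>]])
    show "integrable \<mu> (\<lambda>x. P x * (if u x > \<delta> then 1 else 0))"
      by (rule integrable_mult_bounded[OF P_integrable step_measurable(1), where C=1]) simp
  qed
  moreover have "(\<lambda>x. tA Dv x \<bullet> (if u x > \<delta> then Du x else 0) - P x * (if u x > \<delta> then 1 else 0)) = H"
    by (auto simp: H_def fun_eq_iff)
  ultimately show ?thesis by (simp only:)
qed

lemma H_restrict_integrable:
  assumes "g \<in> borel_measurable \<mu>" "\<And>x. \<bar>g x\<bar> \<le> C"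
  shows "integrable \<mu> (\<lambda>x. g x * H x)"
  using integrable_mult_bounded[OF H_integrable assms] by (simp only: mult.commute)

lemma K_compose_integrable:
  assumes "continuous_on UNIV S" "k > 0" "\<And>s. \<bar>S (Tk k s)\<bar> \<le> C"
  shows "integrable \<mu> (\<lambda>x. K x * S (Tk k (u x)))"
  by (rule integrable_mult_bounded[OF K_integrable, of _ C])
     (use continuous_compose_measurable[OF continuous_on_compose2[OF assms(1) continuous_on_Tk subset_UNIV] u_measurable]
        assms(3) in auto)

lemma K_Tk_integrable: "k > 0 \<Longrightarrow> integrable \<mu> (\<lambda>x. K x * Tk k (u x))"
  by (rule K_compose_integrable[of "\<lambda>s. s" k k]) (auto simp: Tk_bound)

lemma half_square_Tk_bound:
  assumes "k > 0"
  shows "\<bar>half_square \<delta> (Tk k s)\<bar> \<le> k\<^sup>2 / (2 * \<delta>)"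
proof -
  have "max 0 (Tk k s - \<delta>) \<le> k" using Tk_bound[OF assms, of s] \<delta> by auto
  then have "(max 0 (Tk k s - \<delta>))\<^sup>2 \<le> k\<^sup>2" by (intro power_mono) auto
  then show ?thesis using \<delta> by (simp add: half_square_def divide_right_mono)
qed

lemma K_half_square_integrable:
  "k > 0 \<Longrightarrow> integrable \<mu> (\<lambda>x. K x * half_square \<delta> (Tk k (u x)))"
  by (rule K_compose_integrable[OF continuous_on_half_square _ half_square_Tk_bound])

text \<open>
The right-hand side of the equation for \<open>v\<close> does not depend on the level, so it drops out of the difference
of the equations at the levels \<open>k\<close> and \<open>m\<close>. This is the representation of \<open>-div \<^sup>tA Dv\<close> tested with
\<open>T\<^sub>m(u) - T\<^sub>k(u)\<close>.
\<close>

lemma level_identity: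
  assumes sol: "\<And>k. k > 0 \<Longrightarrow> sol_lhs k (tA Dv) I \<phi>h gh fh = c"
    and k: "\<delta> \<le> k" "k \<le> m"
  shows "(\<integral>x. (if k < u x \<and> u x \<le> m then 1 else 0) * H x - K x * (Tk m (u x) - Tk k (u x)) \<partial>\<mu>) = 0"
proof -
  have pos: "k > 0" "m > 0" using \<delta> k by auto
  define E where "E = (\<lambda>k. sol_integrand k (tA Dv) I \<phi>h gh fh)"
  have E: "integrable \<mu> (E k)" "(\<integral>x. E k x \<partial>\<mu>) = c" if "k > 0" for k
    using solution_integrals[OF that rep_data tA_Dv_Lp_2] sol[OF that] unfolding E_def by simp_all
  have "(\<integral>x. E k x - E m x \<partial>\<mu>) = 0"
    using E[OF pos(1)] E[OF pos(2)] by simp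
  moreover have "E k x - E m x = (if k < u x \<and> u x \<le> m then 1 else 0) * H x - K x * (Tk m (u x) - Tk k (u x))" for x
  proof -
    have E': "E l x = (if u x > l then tA Dv x \<bullet> Du x else P x) + K x * Tk l (u x)" for l
      unfolding E_def sol_integrand_def K_def[symmetric] P_def[symmetric] by simp
    show ?thesis
      unfolding E' H_def using k by (simp add: algebra_simps)
  qed
  ultimately show ?thesis by simp
qed

text \<open>
This is the representation of \<open>-div \<^sup>tA Dv\<close> tested with \<open>half_square \<delta> (T\<^bsub>2\<delta>\<^esub>(u))\<close>. The integral, as a
function of the upper level, vanishes at \<open>\<delta>\<close> and is constant by \<open>constant_of_interval_bound\<close>: on a slice
\<open>{k < u \<le> m}\<close> the weight \<open>w\<close> is replaced by its value at \<open>u = k\<close>, where \<open>level_identity\<close> applies.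
\<close>

lemma weighted_identity:
  assumes sol: "\<And>k. k > 0 \<Longrightarrow> sol_lhs k (tA Dv) I \<phi>h gh fh = c"
  shows "(\<integral>x. (if u x \<le> 2 * \<delta> then w x else 0) * H x - K x * half_square \<delta> (Tk (2 * \<delta>) (u x)) \<partial>\<mu>) = 0"
proof -
  define E where "E = (\<lambda>m x. (if u x \<le> m then w x else 0) * H x - K x * half_square \<delta> (Tk m (u x)))"
  define B where "B = (\<lambda>m x. (if u x \<le> m then 1 else 0) * \<bar>H x\<bar> + \<bar>K x\<bar> * Tk m (u x))"
  define e where "e = (\<lambda>m. \<integral>x. E m x \<partial>\<mu>)"
  define b where "b = (\<lambda>m. (\<integral>x. B m x \<partial>\<mu>) / \<delta>)"
  have Ei: "integrable \<mu> (E m)" if "m > 0" for m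
    unfolding E_def
  proof (intro Bochner_Integration.integrable_diff K_half_square_integrable that H_restrict_integrable[of _ 1])
    show "(\<lambda>x. if u x \<le> m then w x else 0) \<in> borel_measurable \<mu>" by measurable
    show "\<bar>if u x \<le> m then w x else 0\<bar> \<le> 1" for x using w_abs[of x] by simp
  qed
  have Bi: "integrable \<mu> (B m)" if "m > 0" for m
    unfolding B_def
  proof (intro Bochner_Integration.integrable_add)
    have "integrable \<mu> (\<lambda>x. \<bar>H x\<bar> * (if u x \<le> m then 1 else 0))"
      by (rule integrable_mult_bounded[OF integrable_abs[OF H_integrable] step_measurable(2), where C=1]) simp
    then show "integrable \<mu> (\<lambda>x. (if u x \<le> m then 1 else 0) * \<bar>H x\<bar>)"
      by (simp only: mult.commute)
    show "integrable \<mu> (\<lambda>x. \<bar>K x\<bar> * Tk m (u x))"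
      by (rule integrable_mult_bounded[OF integrable_abs[OF K_integrable] Linf_measurable[OF Tk_Linf[OF that]] Tk_bound[OF that]])
  qed
  have "e (2 * \<delta>) = e \<delta>"
  proof (rule constant_of_interval_bound[of \<delta> "2 * \<delta>" e b])
    show "\<delta> \<le> 2 * \<delta>" using \<delta> by simp
    fix k m assume km: "\<delta> \<le> k" "k \<le> m" "m \<le> 2 * \<delta>"
    then have pos: "k > 0" "m > 0" using \<delta> by auto
    \<comment> \<open>the value of the weight on the level set \<open>u = k\<close>\<close>
    define C where "C = (k - \<delta>) / \<delta>"
    define L where "L = (\<lambda>x. (if k < u x \<and> u x \<le> m then 1 else 0) * H x - K x * (Tk m (u x) - Tk k (u x)))"
    have Li: "integrable \<mu> L"
      unfolding L_def right_diff_distrib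
      by (intro Bochner_Integration.integrable_diff K_Tk_integrable pos H_restrict_integrable[of _ 1]) auto
    have L0: "(\<integral>x. L x \<partial>\<mu>) = 0"
      unfolding L_def by (rule level_identity[OF sol km(1,2)])
    have "e m - e k = (\<integral>x. E m x - E k x - C * L x \<partial>\<mu>)"
      unfolding e_def using Ei[OF pos(1)] Ei[OF pos(2)] Li L0 by simp
    also have "\<bar>\<dots>\<bar> \<le> (\<integral>x. \<bar>E m x - E k x - C * L x\<bar> \<partial>\<mu>)"
      by (rule integral_abs_bound)
    also have "\<dots> \<le> (\<integral>x. (m - k) / \<delta> * (B m x - B k x) \<partial>\<mu>)"
    proof (rule integral_mono_AE)
      show "integrable \<mu> (\<lambda>x. \<bar>E m x - E k x - C * L x\<bar>)"
        by (intro integrable_abs Bochner_Integration.integrable_diff integrable_mult_right Ei Li pos)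
      show "integrable \<mu> (\<lambda>x. (m - k) / \<delta> * (B m x - B k x))"
        by (intro Bochner_Integration.integrable_diff integrable_mult_right Bi pos)
      show "AE x in \<mu>. \<bar>E m x - E k x - C * L x\<bar> \<le> (m - k) / \<delta> * (B m x - B k x)"
        using u_nonneg
      proof eventually_elim
        case (elim x)
        define cut :: real where "cut = (if k < u x \<and> u x \<le> m then 1 else 0)"
        define \<Delta>T where "\<Delta>T = Tk m (u x) - Tk k (u x)"
        define \<Delta>W where "\<Delta>W = half_square \<delta> (Tk m (u x)) - half_square \<delta> (Tk k (u x))"
        have eq1: "E m x - E k x - C * L x = cut * (w x - C) * H x - K x * (\<Delta>W - C * \<Delta>T)"
          unfolding E_def L_def cut_def \<Delta>T_def \<Delta>W_def using km by (auto simp: algebra_simps)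
        have eq2: "B m x - B k x = cut * \<bar>H x\<bar> + \<bar>K x\<bar> * \<Delta>T"
          unfolding B_def cut_def \<Delta>T_def using km by (auto simp: algebra_simps)
        have mk: "0 \<le> (m - k) / \<delta>" using km \<delta> by simp
        have h: "\<bar>cut * (w x - C)\<bar> \<le> (m - k) / \<delta> * cut"
        proof (cases "k < u x \<and> u x \<le> m")
          case True
          then have "w x = (u x - \<delta>) / \<delta>" using km by (intro w_eq) auto
          then have "w x - C = (u x - k) / \<delta>" by (simp add: C_def diff_divide_distrib)
          moreover have "0 \<le> (u x - k) / \<delta>" "(u x - k) / \<delta> \<le> (m - k) / \<delta>"
            using True \<delta> by (auto intro: divide_right_mono)
          ultimately show ?thesis using True by (simp add: cut_def)
        next
          case False
          then have "cut = 0" unfolding cut_def by (rule if_not_P)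
          then show ?thesis by simp
        qed
        have kk: "\<bar>\<Delta>W - C * \<Delta>T\<bar> \<le> (m - k) / \<delta> * \<Delta>T"
          using half_square_increment[OF \<delta> km(1,2), of "u x"]
          unfolding \<Delta>W_def \<Delta>T_def C_def Tk_nonneg[OF pos(1) elim] Tk_nonneg[OF pos(2) elim] .
        have "\<bar>cut * (w x - C) * H x - K x * (\<Delta>W - C * \<Delta>T)\<bar>
            \<le> \<bar>cut * (w x - C)\<bar> * \<bar>H x\<bar> + \<bar>K x\<bar> * \<bar>\<Delta>W - C * \<Delta>T\<bar>"
          unfolding abs_mult[symmetric] by (rule abs_triangle_ineq4)
        also have "\<dots> \<le> (m - k) / \<delta> * cut * \<bar>H x\<bar> + \<bar>K x\<bar> * ((m - k) / \<delta> * \<Delta>T)"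
          by (intro add_mono mult_right_mono mult_left_mono h kk) auto
        also have "\<dots> = (m - k) / \<delta> * (cut * \<bar>H x\<bar> + \<bar>K x\<bar> * \<Delta>T)"
          by (simp only: distrib_left mult_ac)
        finally show ?case unfolding eq1 eq2 .
      qed
    qed
    also have "\<dots> = (m - k) * (b m - b k)"
      using Bi[OF pos(1)] Bi[OF pos(2)] by (simp add: b_def diff_divide_distrib[symmetric])
    finally show "\<bar>e m - e k\<bar> \<le> (m - k) * (b m - b k)" .
  qed
  also have "e \<delta> = 0"
    unfolding e_def
  proof (rule integral_eq_zero_AE)
    show "AE x in \<mu>. E \<delta> x = 0"
      using u_nonneg
    proof eventually_elim
      case (elim x)
      have "half_square \<delta> (Tk \<delta> (u x)) = 0"
      proof -
        have "Tk \<delta> (u x) - \<delta> \<le> 0" using Tk_bound[OF \<delta>, of "u x"] by linarith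
        then show ?thesis by (simp add: half_square_def max.absorb1)
      qed
      then show ?case using w_eq(1)[OF elim] by (simp add: E_def)
    qed
  qed
  finally show ?thesis unfolding e_def E_def .
qed

text \<open>
In the equation for \<open>z\<close> the level \<open>2\<delta>\<close> is chosen because \<open>Dz\<close> vanishes above it, which removes the term with
\<open>G\<^sub>k(u)\<close>. The coefficient of \<open>T\<^bsub>2\<delta>\<^esub>(u)\<close> is again \<open>K\<close>. Adding the weighted identity replaces \<open>T\<^bsub>2\<delta>\<^esub>(u)\<close> by the
primitive of \<open>Z\<^sub>\<delta>\<close> and the terms with \<open>w\<close> by \<open>Z\<^sub>\<delta>(u) P\<close>; the only other term has a sign by coercivity.
\<close>

lemma truncated_estimate:
  assumes sol_v: "\<And>k. k > 0 \<Longrightarrow> sol_lhs k (tA Dv) I \<phi>h gh fh = c"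
    and sol_z: "\<And>J \<phi> g f. V_rep \<Omega> A z J \<phi> g f \<Longrightarrow>
      sol_lhs (2 * \<delta>) (tA (wgrad \<Omega> z)) J \<phi> g f = r"
    and coercive: "AE x in \<mu>. \<forall>\<xi>. 0 \<le> (A x *v \<xi>) \<bullet> \<xi>"
    and v_nonneg: "AE x in \<mu>. v x \<ge> 0"
  shows "r \<le> 3 / 2 * (\<integral>x. \<bar>K x\<bar> \<partial>\<mu>) * \<delta>
     + (\<Sum>i\<in>I. \<integral>x. Zd \<delta> (u x) * (gh i x \<bullet> Du x) * \<phi>h i x \<partial>\<mu>)"
proof -
  have \<delta>2: "2 * \<delta> > 0" using \<delta> by simp
  \<comment> \<open>fresh indices for the two terms that the product rule adds to the representation\<close>
  obtain p where p: "p \<notin> I" using rep_data(1) ex_new_if_finite infinite_UNIV_nat by blast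
  obtain q where q: "q \<notin> insert p I" using rep_data(1) ex_new_if_finite[of "insert p I"] infinite_UNIV_nat by blast
  then have q': "q \<notin> I" "q \<noteq> p" by auto
  note rz = V_rep_z[OF p q']
  define J where "J = insert p (insert q I)"
  define \<phi> where "\<phi> = \<phi>h(p := w, q := v)"
  define g where "g = gh(p := \<lambda>x. - tA Dv x, q := \<lambda>x. - tA Dw x)"
  define f where "f = (\<lambda>x. fh x + (tA Dv x \<bullet> Dw x + tA Dw x \<bullet> Dv x))"
  have rz: "V_rep \<Omega> A z J \<phi> g f" unfolding J_def \<phi>_def g_def f_def by (rule rz)
  then have J: "finite J" "\<And>i. i \<in> J \<Longrightarrow> \<phi> i \<in> H10 \<Omega> \<inter> Linf \<Omega>" "\<And>i. i \<in> J \<Longrightarrow> g i \<in> Lp 2 \<Omega>" "f \<in> Lp 1 \<Omega>"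
    unfolding V_rep_def by blast+
  have sumJ: "(\<Sum>i\<in>J. F i (\<phi> i) (g i)) = F p w (\<lambda>x. - tA Dv x) + F q v (\<lambda>x. - tA Dw x) + (\<Sum>i\<in>I. F i (\<phi>h i) (gh i))"
    for F :: "nat \<Rightarrow> (real^'n \<Rightarrow> real) \<Rightarrow> (real^'n \<Rightarrow> real^'n) \<Rightarrow> real"
  proof -
    have "(\<Sum>i\<in>I. F i (\<phi> i) (g i)) = (\<Sum>i\<in>I. F i (\<phi>h i) (gh i))"
      using p q' by (intro sum.cong) (auto simp: \<phi>_def g_def)
    moreover have "\<phi> p = w" "g p = (\<lambda>x. - tA Dv x)" "\<phi> q = v" "g q = (\<lambda>x. - tA Dw x)"
      using q' by (auto simp: \<phi>_def g_def)
    ultimately show ?thesis unfolding J_def using p q' rep_data(1) by simp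
  qed
  define E where "E = sol_integrand (2 * \<delta>) (tA (wgrad \<Omega> z)) J \<phi> g f"
  have "z \<in> H10 \<Omega>" using z_H10_Linf by blast
  note si = solution_integrals[OF \<delta>2 J tA_Lp_2[OF wgrad_H10_Lp_2[OF this]]]
  have Ei: "integrable \<mu> E" unfolding E_def by (rule si(1))
  have Er: "(\<integral>x. E x \<partial>\<mu>) = r" unfolding E_def by (rule trans[OF si(2)[symmetric] sol_z[OF rz]])
  define Q where "Q = (\<lambda>x. (if u x \<le> 2 * \<delta> then w x else 0) * H x - K x * half_square \<delta> (Tk (2 * \<delta>) (u x)))"
  have Qi: "integrable \<mu> Q"
    unfolding Q_def
  proof (intro Bochner_Integration.integrable_diff K_half_square_integrable \<delta>2 H_restrict_integrable[of _ 1])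
    show "(\<lambda>x. if u x \<le> 2 * \<delta> then w x else 0) \<in> borel_measurable \<mu>" by measurable
    show "\<bar>if u x \<le> 2 * \<delta> then w x else 0\<bar> \<le> 1" for x using w_abs[of x] by simp
  qed
  have Q0: "(\<integral>x. Q x \<partial>\<mu>) = 0" unfolding Q_def by (rule weighted_identity[OF sol_v])
  have Zi: "integrable \<mu> (\<lambda>x. Zd \<delta> (u x) * (gh i x \<bullet> Du x) * \<phi>h i x)" if "i \<in> I" for i
  proof -
    have "integrable \<mu> (\<lambda>x. (\<phi>h i x * (gh i x \<bullet> Du x)) * Zd \<delta> (u x))"
    proof (rule integrable_mult_bounded[OF P_summand_integrable[OF that], of _ 1])
      have [measurable]: "Zd \<delta> \<in> borel_measurable borel" unfolding Zd_def[abs_def] by measurable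
      show "(\<lambda>x. Zd \<delta> (u x)) \<in> borel_measurable \<mu>" by measurable
      show "\<bar>Zd \<delta> (u x)\<bar> \<le> 1" for x using \<delta> by (auto simp: Zd_def abs_le_iff field_simps)
    qed
    then show ?thesis by (simp only: mult_ac)
  qed
  define R where "R = (\<lambda>x. 3 / 2 * \<bar>K x\<bar> * \<delta> + (\<Sum>i\<in>I. Zd \<delta> (u x) * (gh i x \<bullet> Du x) * \<phi>h i x))"
  have R1: "integrable \<mu> (\<lambda>x. 3 / 2 * \<bar>K x\<bar> * \<delta>)"
    using K_integrable by simp
  have R2: "integrable \<mu> (\<lambda>x. \<Sum>i\<in>I. Zd \<delta> (u x) * (gh i x \<bullet> Du x) * \<phi>h i x)"
    by (rule Bochner_Integration.integrable_sum[OF Zi])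
  have Ri: "integrable \<mu> R"
    unfolding R_def by (rule Bochner_Integration.integrable_add[OF R1 R2])
  have RI: "(\<integral>x. R x \<partial>\<mu>) = 3 / 2 * (\<integral>x. \<bar>K x\<bar> \<partial>\<mu>) * \<delta>
     + (\<Sum>i\<in>I. \<integral>x. Zd \<delta> (u x) * (gh i x \<bullet> Du x) * \<phi>h i x \<partial>\<mu>)"
    unfolding R_def Bochner_Integration.integral_add[OF R1 R2] using Zi by simp
  have "r = (\<integral>x. E x + Q x \<partial>\<mu>)"
    using Ei Qi Er Q0 by simp
  also have "\<dots> \<le> (\<integral>x. R x \<partial>\<mu>)"
  proof (rule integral_mono_AE[OF Bochner_Integration.integrable_add[OF Ei Qi] Ri])
    show "AE x in \<mu>. E x + Q x \<le> R x"
      using u_nonneg v_nonneg coercive wgrad_H10_limit[OF H10_limit_z] wgrad_H10_limit[OF H10_limit_w]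
    proof eventually_elim
      case (elim x)
      define T where "T = Tk (2 * \<delta>) (u x)"
      have T: "0 \<le> T" "T \<le> 2 * \<delta>" using elim(1) \<delta> by (auto simp: T_def Tk_nonneg)
      have K': "(\<Sum>i\<in>J. g i x \<bullet> wgrad \<Omega> (\<phi> i) x) + f x = K x"
        unfolding sumJ[of "\<lambda>i \<phi> g. g x \<bullet> wgrad \<Omega> \<phi> x"] K_def f_def elim(5) by simp
      have P': "(\<Sum>i\<in>J. \<phi> i x * (g i x \<bullet> Du x)) = P x - w x * (tA Dv x \<bullet> Du x) - v x * (tA Dw x \<bullet> Du x)"
        unfolding sumJ[of "\<lambda>i \<phi> g. \<phi> x * (g x \<bullet> Du x)"] P_def by simp
      have z0: "tA (wgrad \<Omega> z) x \<bullet> (if u x > 2 * \<delta> then Du x else 0) = 0"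
      proof (cases "u x > 2 * \<delta>")
        case True
        then have "w x = 1" "Dw x = 0" using w_eq(2)[of x] by (auto simp: Dw_def)
        then have "wgrad \<Omega> z x = 0" unfolding elim(4) Dz_def by simp
        then show ?thesis by simp
      qed simp
      have Ex: "E x = K x * T + (if u x \<le> 2 * \<delta> then 1 else 0) * (P x - w x * (tA Dv x \<bullet> Du x) - v x * (tA Dw x \<bullet> Du x))"
        unfolding E_def sol_integrand_def K' P' z0 T_def by simp
      have sign: "0 \<le> v x * (tA Dw x \<bullet> Du x)"
      proof (cases "\<delta> < u x \<and> u x \<le> 2 * \<delta>")
        case True
        then have Dw: "Dw x = (1 / \<delta>) *\<^sub>R Du x" by (simp add: Dw_def)
        have "tA Dw x \<bullet> Du x = (1 / \<delta>) * ((A x *v Du x) \<bullet> Du x)"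
          unfolding Dw matrix_vector_mult_scaleR inner_scaleR_left inner_transpose_matrix
          by (simp only: inner_commute)
        moreover have "0 \<le> (A x *v Du x) \<bullet> Du x" using elim(3) by blast
        ultimately show ?thesis using elim(2) \<delta> by simp
      next
        case False
        then have "Dw x = 0" unfolding Dw_def by (rule if_not_P)
        then show ?thesis by simp
      qed
      have wH: "(if u x \<le> 2 * \<delta> then w x else 0) * H x
          = (if u x \<le> 2 * \<delta> then 1 else 0) * (w x * (tA Dv x \<bullet> Du x) - w x * P x)"
        using w_eq(1)[OF elim(1)] by (auto simp: H_def algebra_simps)
      have Z: "Zd \<delta> (u x) = (if u x \<le> 2 * \<delta> then 1 else 0) * (1 - w x)"
        using Zd_eq[OF elim(1)] w_eq(2)[of x] by auto
      have ZP: "(\<Sum>i\<in>I. Zd \<delta> (u x) * (gh i x \<bullet> Du x) * \<phi>h i x) = Zd \<delta> (u x) * P x"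
        unfolding P_def sum_distrib_left by (intro sum.cong) (auto simp: mult_ac)
      have "E x + Q x = K x * (T - half_square \<delta> T) + Zd \<delta> (u x) * P x
          - (if u x \<le> 2 * \<delta> then 1 else 0) * (v x * (tA Dw x \<bullet> Du x))"
        unfolding Ex Q_def wH Z T_def[symmetric] by (simp add: algebra_simps)
      also have "\<dots> \<le> K x * (T - half_square \<delta> T) + Zd \<delta> (u x) * P x"
        using sign by simp
      also have "K x * (T - half_square \<delta> T) \<le> \<bar>K x\<bar> * (3 / 2 * \<delta>)"
      proof -
        have "K x * (T - half_square \<delta> T) \<le> \<bar>K x\<bar> * (T - half_square \<delta> T)"
          by (intro mult_right_mono half_square_remainder \<delta> T) simp
        also have "\<dots> \<le> \<bar>K x\<bar> * (3 / 2 * \<delta>)"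
          by (intro mult_left_mono half_square_remainder \<delta> T) simp
        finally show ?thesis .
      qed
      finally show ?case unfolding R_def ZP by (simp add: mult_ac)
    qed
  qed
  finally show ?thesis unfolding RI .
qed

end

section \<open>The estimate near the set where the solution vanishes\<close>

theorem proposition5p9:
  fixes \<Omega> :: "(real^'n) set"
    and A :: "real^'n \<Rightarrow> real^'n^'n"
    and F :: "real^'n \<Rightarrow> real \<Rightarrow> ennreal"
    and h :: "real^'n \<Rightarrow> real"
    and \<Gamma> \<Gamma>' :: "real \<Rightarrow> real"
    and u v fh :: "real^'n \<Rightarrow> real"
    and I :: "nat set"
    and \<phi>h :: "nat \<Rightarrow> real^'n \<Rightarrow> real"
    and gh :: "nat \<Rightarrow> real^'n \<Rightarrow> real^'n"
    and \<alpha> r \<delta> :: real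
  assumes "open \<Omega>" and "bounded \<Omega>"
    and A_Linf: "\<And>i j. (\<lambda>x. A x $ i $ j) \<in> Linf \<Omega>"
    and "\<alpha> > 0"
    and A_coercive: "AE x in lebesgue_on \<Omega>. \<forall>\<xi>. (A x *v \<xi>) \<bullet> \<xi> \<ge> \<alpha> * (norm \<xi>)\<^sup>2"
    and F_car: "Caratheodory_fun \<Omega> F"
    and F_bound: "AE x in lebesgue_on \<Omega>. \<forall>s>0. F x s \<le> ennreal (h x / \<Gamma> s)"
    and h_nonneg: "AE x in lebesgue_on \<Omega>. h x \<ge> 0"
    and h_Lr: "h \<in> Lp r \<Omega>"
    and r3: "CARD('n) \<ge> 3 \<Longrightarrow> r = 2 * real CARD('n) / (real CARD('n) + 2)"
    and r2: "CARD('n) = 2 \<Longrightarrow> r > 1"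
    and r1: "CARD('n) = 1 \<Longrightarrow> r = 1"
    and \<Gamma>_nonneg: "\<And>s. s \<ge> 0 \<Longrightarrow> \<Gamma> s \<ge> 0"
    and \<Gamma>_deriv: "\<And>s. s \<ge> 0 \<Longrightarrow> (\<Gamma> has_real_derivative \<Gamma>' s) (at s within {0..})"
    and \<Gamma>'_cont: "continuous_on {0..} \<Gamma>'"
    and \<Gamma>_0: "\<Gamma> 0 = 0"
    and \<Gamma>'_pos: "\<And>s. s > 0 \<Longrightarrow> \<Gamma>' s > 0"
    and u_sol: "is_solution \<Omega> A F u"
    and v_V: "v \<in> V_space \<Omega> A"
    and v_nonneg: "AE x in lebesgue_on \<Omega>. v x \<ge> 0"
    and v_rep: "V_rep \<Omega> A v I \<phi>h gh fh"
    and "\<delta> > 0"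
  shows "enn2ereal (\<integral>\<^sup>+x. F x (u x) * ennreal (Zd \<delta> (u x)) * ennreal (v x) \<partial>lebesgue_on \<Omega>)
    \<le> ereal (3 / 2 * (\<integral>x. \<bar>(\<Sum>i\<in>I. gh i x \<bullet> wgrad \<Omega> (\<phi>h i) x) + fh x\<bar> \<partial>lebesgue_on \<Omega>) * \<delta>
        + (\<Sum>i\<in>I. \<integral>x. Zd \<delta> (u x) * (gh i x \<bullet> wgrad \<Omega> u x) * \<phi>h i x \<partial>lebesgue_on \<Omega>))"
proof -
  have u_props: "u \<in> Lp 2 \<Omega>" "u \<in> H1_loc \<Omega>" "AE x in lebesgue_on \<Omega>. u x \<ge> 0"
    and Gk_H10: "\<And>k. k > 0 \<Longrightarrow> (\<lambda>x. Gk k (u x)) \<in> H10 \<Omega>"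
    and Tk_H10: "\<And>k \<phi>. k > 0 \<Longrightarrow> \<phi> \<in> H10 \<Omega> \<inter> Linf \<Omega> \<Longrightarrow> (\<lambda>x. \<phi> x * Tk k (u x)) \<in> H10 \<Omega>"
    using u_sol unfolding is_solution_def by blast+
  have sol: "(\<integral>\<^sup>+x. F x (u x) * ennreal (v x) \<partial>lebesgue_on \<Omega>) < \<infinity>"
      "k > 0 \<Longrightarrow>
       (\<integral>x. (transpose (A x) *v wgrad \<Omega> v x) \<bullet> wgrad \<Omega> (\<lambda>y. Gk k (u y)) x \<partial>lebesgue_on \<Omega>)
       + (\<Sum>i\<in>I. \<integral>x. gh i x \<bullet> wgrad \<Omega> (\<lambda>y. \<phi>h i y * Tk k (u y)) x \<partial>lebesgue_on \<Omega>)
       + (\<integral>x. fh x * Tk k (u x) \<partial>lebesgue_on \<Omega>)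
       = enn2real (\<integral>\<^sup>+x. F x (u x) * ennreal (v x) \<partial>lebesgue_on \<Omega>)"
    if "v \<in> V_space \<Omega> A" "AE x in lebesgue_on \<Omega>. v x \<ge> 0" "V_rep \<Omega> A v I \<phi>h gh fh"
    for v I \<phi>h gh fh k
    using u_sol that unfolding is_solution_def by blast+
  have v: "v \<in> H10 \<Omega> \<inter> Linf \<Omega>" using v_V unfolding V_space_def by blast
  interpret truncated_test \<Omega> u A v I \<phi>h gh fh \<delta>
    by unfold_locales (fact assms u_props Gk_H10 Tk_H10 v)+
  obtain p where p: "p \<notin> I" using rep_data(1) ex_new_if_finite infinite_UNIV_nat by blast
  obtain q where q: "q \<notin> insert p I"
    using rep_data(1) ex_new_if_finite[of "insert p I"] infinite_UNIV_nat by blast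
  have z_V: "z \<in> V_space \<Omega> A"
    using V_rep_z[OF p, of q] q z_H10_Linf unfolding V_space_def by blast
  have z_nonneg: "AE x in lebesgue_on \<Omega>. z x \<ge> 0"
    using v_nonneg u_nonneg
  proof eventually_elim
    case (elim x)
    have "z x = v x * (1 - w x)" by (simp add: z_def algebra_simps)
    then show ?case using elim(1) w_bounds(2)[of x] by simp
  qed
  define X where "X = (\<integral>\<^sup>+x. F x (u x) * ennreal (z x) \<partial>lebesgue_on \<Omega>)"
  have X: "X < \<infinity>"
    unfolding X_def using sol(1)[OF z_V z_nonneg V_rep_z[OF p, of q]] q by blast
  have coercive: "AE x in lebesgue_on \<Omega>. \<forall>\<xi>. 0 \<le> (A x *v \<xi>) \<bullet> \<xi>"
    using A_coercive
  proof eventually_elim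
    case (elim x)
    have "0 \<le> \<alpha> * (norm \<xi>)\<^sup>2" for \<xi> :: "real^'n" using \<open>\<alpha> > 0\<close> by simp
    then show ?case using elim order_trans by blast
  qed
  have est: "enn2real X \<le> 3 / 2 * (\<integral>x. \<bar>(\<Sum>i\<in>I. gh i x \<bullet> wgrad \<Omega> (\<phi>h i) x) + fh x\<bar> \<partial>lebesgue_on \<Omega>) * \<delta>
     + (\<Sum>i\<in>I. \<integral>x. Zd \<delta> (u x) * (gh i x \<bullet> wgrad \<Omega> u x) * \<phi>h i x \<partial>lebesgue_on \<Omega>)"
    using truncated_estimate[OF sol(2)[OF v_V v_nonneg v_rep]
        sol(2)[OF z_V z_nonneg, folded X_def] coercive v_nonneg] \<delta>
    unfolding K_def by simp
  have X_eq: "(\<integral>\<^sup>+x. F x (u x) * ennreal (Zd \<delta> (u x)) * ennreal (v x) \<partial>lebesgue_on \<Omega>) = X"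
    unfolding X_def
  proof (rule nn_integral_cong_AE)
    show "AE x in lebesgue_on \<Omega>. F x (u x) * ennreal (Zd \<delta> (u x)) * ennreal (v x) = F x (u x) * ennreal (z x)"
      using u_nonneg v_nonneg
      by eventually_elim (simp add: z_eq ennreal_mult'' mult.commute[of "v _"] mult.assoc)
  qed
  have "enn2ereal X = ereal (enn2real X)"
    using X by (metis enn2ereal_ennreal enn2real_nonneg ennreal_enn2real infinity_ennreal_def)
  then show ?thesis unfolding X_eq using est by simp
qed

end
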